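(* Let $V^{[*]}$ be a dg vertex operator algebra, considered as the adjoint module over itself. Then $\Psi_{V^{[*]}}$, $(\operatorname{gr}_*\psi)_{V^{[*]}}$, $(\operatorname{gr}^{[*]}\varphi)_{V^{[*]}}$ and $\psi_{V^{[*]}}$ are isomorphisms. If $V^{[p]}=\{0\}$ for $p\ll0$, then $\varphi_{V^{[*]}}$ is an isomorphism.
   Context: All vector spaces are over $\mathbb C$. A (cochain) complex $V^{[*]}=\bigoplus_{p\in\mathbb Z}V^{[p]}$ has a differential $d_V$ of degree $+1$ with $d_V^2=0$; $|v|=p$ for $v\in V^{[p]}$. $\operatorname{End}^{[*]}(V^{[*]})=\bigoplus_p\operatorname{End}^{[p]}(V^{[*]})$, where $\operatorname{End}^{[p]}$ is the space of linear maps of degree $p$. A dg vertex algebra $(V^{[*]},d_V,Y(\cdot,x),\mathbf 1)$ is a complex with a linear map $v\mapsto Y(v,x)=\sum_{n\in\mathbb Z}v_nx^{-n-1}\in\operatorname{End}^{[*]}(V^{[*]})[[x,x^{-1}]]$ such that for $v\in V^{[p]}$ one has $v_n\in\operatorname{End}^{[p-2n-2]}(V^{[*]})$ and $(d_Vv)_n=d_V\circ v_n-(-1)^{p}v_n\circ d_V$, and a vector $\mathbf 1\in V^{[0]}$ with $d_V\mathbf 1=0$, such that: $u_nv=0$ for $n$ sufficiently large; $Y(\mathbf 1,x)=\operatorname{id}$; $Y(v,x)\mathbf 1\in V^{[*]}[[x]]$ with constant term $v$; and (Jacobi identity) for homogeneous $u,v$ and all $l,m,n\in\mathbb Z$, $$\sum_{i\ge0}(-1)^i\binom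 li\left(u_{m+l-i}v_{n+i}-(-1)^{l}(-1)^{|u||v|}v_{n+l-i}u_{m+i}\right)=\sum_{i\ge0}\binom mi(u_{l+i}v)_{m+n-i}.$$ A dg vertex operator algebra is a dg vertex algebra with $\omega\in V^{[4]}$, $d_V\omega=0$, such that, writing $Y(\omega,x)=\sum_nL(n)x^{-n-2}$: $[L(m),L(n)]=(m-n)L(m+n)+\frac1{12}(m^3-m)\delta_{m+n,0}c_V$ for some $c_V\in\mathbb C$; $L(0)$ is semisimple with $V^{[*]}=\bigoplus_{n\in\frac12\mathbb Z}V_n^{[*]}$, $V_n^{[*]}$ the eigenspace of eigenvalue (weight) $n$, $\omega\in V_2^{[*]}$, $\dim V_n^{[*]}<\infty$, $V_n^{[*]}=0$ for $n\ll0$; and $L(-1)v=v_{-2}\mathbf 1$. Put $V_n^{[p]}=V_n^{[*]}\cap V^{[p]}$ and $\operatorname{wt}(u)=n$ for $u\in V_n^{[*]}$. $C_2$-algebra: $R=R^{[*]}(V^{[*]})=V^{[*]}/C_2^{[*]}(V^{[*]})$ with $C_2^{[*]}(V^{[*]})=\operatorname{Span}\{u_{-2}v\}$ (bigraded subcomplex); it is a weight graded, graded commutative dg Poisson algebra with $\overline u\cdot\overline v=\overline{u_{-1}v}$, $\{\overline u,\overline v\}=\overline{u_0v}$. Zhu algebra: for $u$ weight homogeneous (extended linearly in $u$), $u\ast v=\sum_{n\ge0}\binom{\operatorname{wt}(u)}{n}u_{n-1}v$ and $u\circ v=\sum_{n\ge0}\binom{\operatorname{wt}(u)}{n}u_{n-2}v$;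 $O(V^{[*]})$ is the span of all $u\circ v$, and $A=A(V^{[*]})=V^{[*]}/O(V^{[*]})$ is an associative algebra under $\ast$. $F^pA$ is the image of $\bigoplus_{q\le p}V^{[q]}$, $W_nA$ the image of $\bigoplus_{m\le n}V_m^{[*]}$, $W_{<n}A=\bigcup_{m<n}W_mA$. Put $\operatorname{gr}^{[*]}A=\bigoplus_pF^pA/F^{p-1}A$, $\operatorname{gr}_*A=\bigoplus_{n\in\frac12\mathbb Z}W_nA/W_{<n}A$, and $\operatorname{gr}_*\operatorname{gr}^{[*]}A=\bigoplus_{p,n}(V_n^{[p]}\bmod I_n^{[p]})$, with $I_n^{[p]}=O(V^{[*]})+\bigoplus_{q\le p,\,m<n}V_m^{[q]}+\bigoplus_{q<p,\,m\le n}V_m^{[q]}$ and $\bmod$ meaning the image in $V^{[*]}/I_n^{[p]}$; products and differentials are induced by $\ast$ and $d_V$. There are surjective morphisms $\eta_{F^\bullet}:R\to\operatorname{gr}^{[*]}A$, $\eta_{W_\bullet}:R\to\operatorname{gr}_*A$, $\eta_{F^\bullet W_\bullet}:R\to\operatorname{gr}_*\operatorname{gr}^{[*]}A$ sending the class of $u$ (homogeneous in degree, resp. weight, resp. both) to its class in the component of degree $|u|$, resp. weight $\operatorname{wt}(u)$, resp. bidegree $(|u|,\operatorname{wt}(u))$. For an $R$-module $W$ and $\eta$ any of these morphisms with target $B$, put $\eta(W)=B\otimes_RW\cong W/((\operatorname{Ker}\eta)W)$. The maps $$\psi_{V^{[*]}}:\eta_{F^\bullet}(R)\to\operatorname{gr}^{[*]}A,\qquad\varphi_{V^{[*]}}:\eta_{W_\bullet}(R)\to\operatorname{gr}_*A,\qquad\Psi_{V^{[*]}}:\eta_{F^\bullet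 W_\bullet}(R)\to\operatorname{gr}_*\operatorname{gr}^{[*]}A$$ send the class of a (homogeneous) $m\in V^{[*]}$ to its class in the component of degree $|m|$, resp. weight $\operatorname{wt}(m)$, resp. bidegree $(|m|,\operatorname{wt}(m))$; they are surjective morphisms of modules over the respective target algebras. The weight grading of $V^{[*]}$ induces weight filtrations (by images of the elements of weight $\le n$) on $\eta_{F^\bullet}(R)$ and $\operatorname{gr}^{[*]}A$ preserved by $\psi_{V^{[*]}}$; $(\operatorname{gr}_*\psi)_{V^{[*]}}=\operatorname{gr}_*(\psi_{V^{[*]}})$ is the induced map on the associated graded objects. Likewise the cohomological grading of $V^{[*]}$ induces filtrations on $\eta_{W_\bullet}(R)$ and $\operatorname{gr}_*A$ preserved by $\varphi_{V^{[*]}}$, and $(\operatorname{gr}^{[*]}\varphi)_{V^{[*]}}=\operatorname{gr}^{[*]}(\varphi_{V^{[*]}})$ is the induced map on the associated graded objects. *)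

theory Defs
  imports
    Complex_Main
    "HOL-Library.Groups_Big_Fun"
    "HOL-Library.Product_Plus"
    "HOL-Algebra.QuotRing"
    "HOL-Algebra.Module"
    "HOL-Algebra.Ideal_Product"
begin

section \<open>Dg vertex operator algebras\<close>

text \<open>The underlying vector space of \<open>V\<close> is a whole type, with scalar multiplication
  \<open>scl\<close>; \<open>Vdeg V p\<close> is the subspace of vectors of cohomological degree \<open>p\<close>, and
  \<open>mode V v n w\<close> is \<open>v\<^sub>n w\<close>.\<close>

record 'a dg_va =
  scl :: "complex \<Rightarrow> 'a \<Rightarrow> 'a"
  Vdeg :: "int \<Rightarrow> 'a set"
  dV :: "'a \<Rightarrow> 'a"
  mode :: "'a \<Rightarrow> int \<Rightarrow> 'a \<Rightarrow> 'a"
  vac :: 'a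

record 'a dg_voa = "'a dg_va" +
  conf :: 'a

abbreviation vspan :: "('a::ab_group_add, 'm) dg_va_scheme \<Rightarrow> 'a set \<Rightarrow> 'a set" where
  "vspan V \<equiv> Modules.module.span (scl V)"

abbreviation vsubspace :: "('a::ab_group_add, 'm) dg_va_scheme \<Rightarrow> 'a set \<Rightarrow> bool" where
  "vsubspace V \<equiv> Modules.module.subspace (scl V)"

definition decomposes :: "'i set \<Rightarrow> ('i \<Rightarrow> 'a::ab_group_add set) \<Rightarrow> 'a \<Rightarrow> ('i \<Rightarrow> 'a) \<Rightarrow> bool" where
  "decomposes I X v c \<longleftrightarrow> (\<forall>i\<in>I. c i \<in> X i) \<and> (\<forall>i. i \<notin> I \<longrightarrow> c i = 0) \<and>
     finite {i. c i \<noteq> 0} \<and> v = (\<Sum>i | c i \<noteq> 0. c i)"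

definition internal_direct_sum ::
    "('a::ab_group_add, 'm) dg_va_scheme \<Rightarrow> 'i set \<Rightarrow> ('i \<Rightarrow> 'a set) \<Rightarrow> bool" where
  "internal_direct_sum V I X \<longleftrightarrow>
     (\<forall>i\<in>I. vsubspace V (X i)) \<and> (\<forall>v. \<exists>!c. decomposes I X v c)"

definition component :: "'i set \<Rightarrow> ('i \<Rightarrow> 'a::ab_group_add set) \<Rightarrow> 'i \<Rightarrow> 'a \<Rightarrow> 'a" where
  "component I X i v = (THE c. decomposes I X v c) i"

text \<open>By truncation, all sums in the Jacobi identity have finite support once they are applied
  to a vector \<open>w\<close>.\<close>

locale dg_vertex_algebra = Vector_Spaces.vector_space "scl V"
  for V :: "('a::ab_group_add, 'm) dg_va_scheme" +
  assumes degree_decomposition: "internal_direct_sum V UNIV (Vdeg V)"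
    and d_linear: "Vector_Spaces.linear (scl V) (scl V) (dV V)"
    and d_degree: "\<And>p v. v \<in> Vdeg V p \<Longrightarrow> dV V v \<in> Vdeg V (p + 1)"
    and d_square: "\<And>v. dV V (dV V v) = 0"
    and mode_linear_left: "\<And>n w. Vector_Spaces.linear (scl V) (scl V) (\<lambda>v. mode V v n w)"
    and mode_linear_right: "\<And>v n. Vector_Spaces.linear (scl V) (scl V) (mode V v n)"
    and mode_degree: "\<And>p q v w n. v \<in> Vdeg V p \<Longrightarrow> w \<in> Vdeg V q \<Longrightarrow>
          mode V v n w \<in> Vdeg V (q + (p - 2 * n - 2))"
    and d_mode: "\<And>p v n w. v \<in> Vdeg V p \<Longrightarrow>
          mode V (dV V v) n w =
            dV V (mode V v n w) - scl V ((-1) powi p) (mode V v n (dV V w))"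
    and vac_degree: "vac V \<in> Vdeg V 0"
    and d_vac: "dV V (vac V) = 0"
    and truncation: "\<And>u v. \<exists>N. \<forall>n\<ge>N. mode V u n v = 0"
    and vac_mode: "\<And>n w. mode V (vac V) n w = (if n = -1 then w else 0)"
    and creation: "\<And>v n. n \<ge> 0 \<Longrightarrow> mode V v n (vac V) = 0"
    and creation_constant: "\<And>v. mode V v (-1) (vac V) = v"
    and jacobi: "\<And>p q u v w l m n. u \<in> Vdeg V p \<Longrightarrow> v \<in> Vdeg V q \<Longrightarrow>
          Sum_any (\<lambda>i::nat. scl V ((-1) ^ i * (of_int l gchoose i))
            (mode V u (m + l - int i) (mode V v (n + int i) w)
              - scl V ((-1) powi l * (-1) powi (p * q))
                  (mode V v (n + l - int i) (mode V u (m + int i) w))))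
          = Sum_any (\<lambda>i::nat. scl V (of_int m gchoose i)
              (mode V (mode V u (l + int i) v) (m + n - int i) w))"

definition half_ints :: "rat set" where
  "half_ints = range (\<lambda>k::int. of_int k / 2)"

definition Lop :: "'a dg_voa \<Rightarrow> int \<Rightarrow> 'a \<Rightarrow> 'a" where
  "Lop V n = mode V (conf V) (n + 1)"

definition Vwt :: "'a dg_voa \<Rightarrow> rat \<Rightarrow> 'a set" where
  "Vwt V n = {v. Lop V 0 v = scl V (of_rat n) v}"

locale dg_vertex_operator_algebra = dg_vertex_algebra V
  for V :: "'a::ab_group_add dg_voa" +
  assumes conf_degree: "conf V \<in> Vdeg V 4"
    and d_conf: "dV V (conf V) = 0"
    and virasoro: "\<exists>c. \<forall>m n v. Lop V m (Lop V n v) - Lop V n (Lop V m v) =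
          scl V (of_int (m - n)) (Lop V (m + n) v)
          + scl V (1 / 12 * of_int (m ^ 3 - m) * (if m + n = 0 then 1 else 0) * c) v"
    and weight_decomposition: "internal_direct_sum V half_ints (Vwt V)"
    and conf_weight: "conf V \<in> Vwt V 2"
    and weight_finite_dim: "\<And>n. n \<in> half_ints \<Longrightarrow> \<exists>B. finite B \<and> vspan V B = Vwt V n"
    and weight_bounded_below: "\<exists>N. \<forall>n\<in>half_ints. n < N \<longrightarrow> Vwt V n = {0}"
    and L_minus_one: "\<And>v. Lop V (-1) v = mode V v (-2) (vac V)"

definition Vbi :: "'a dg_voa \<Rightarrow> int \<Rightarrow> rat \<Rightarrow> 'a set" where
  "Vbi V p n = Vwt V n \<inter> Vdeg V p"

abbreviation deg_part :: "'a::ab_group_add dg_voa \<Rightarrow> int \<Rightarrow> 'a \<Rightarrow> 'a" where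
  "deg_part V \<equiv> component UNIV (Vdeg V)"

abbreviation wt_part :: "'a::ab_group_add dg_voa \<Rightarrow> rat \<Rightarrow> 'a \<Rightarrow> 'a" where
  "wt_part V \<equiv> component half_ints (Vwt V)"

definition deg_le :: "'a::ab_group_add dg_voa \<Rightarrow> int \<Rightarrow> 'a set" where
  "deg_le V p = vspan V (\<Union>q\<in>{..p}. Vdeg V q)"

definition wt_le :: "'a::ab_group_add dg_voa \<Rightarrow> rat \<Rightarrow> 'a set" where
  "wt_le V n = vspan V (\<Union>m\<in>half_ints \<inter> {..n}. Vwt V m)"


section \<open>Quotients and graded objects\<close>

text \<open>Complex vector spaces with a product and a differential. Everything below is built from
  such structures by taking quotients and direct sums of subquotients. As for
  \<^const>\<open>FactRing\<close>, an operation on cosets is the union of the cosets obtained from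
  all representatives.\<close>

record 'b dg_alg = "(complex, 'b) module" +
  diff :: "'b \<Rightarrow> 'b"

definition dg_quot :: "'b dg_alg \<Rightarrow> 'b set \<Rightarrow> 'b set dg_alg" where
  "dg_quot M N =
    \<lparr>carrier = a_rcosets\<^bsub>M\<^esub> N, mult = rcoset_mult M N, one = N +>\<^bsub>M\<^esub> \<one>\<^bsub>M\<^esub>,
     zero = N, add = set_add M,
     smult = (\<lambda>c X. \<Union>x\<in>X. N +>\<^bsub>M\<^esub> (c \<odot>\<^bsub>M\<^esub> x)),
     diff = (\<lambda>X. \<Union>x\<in>X. N +>\<^bsub>M\<^esub> diff M x)\<rparr>"

text \<open>Subspaces \<open>H i\<close>, \<open>N i\<close> of \<open>M\<close> give the graded object whose component \<open>i\<close> is the image of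
  \<open>H i\<close> in \<open>M / N i\<close>. For a filtration \<open>H\<close> and \<open>N i\<close> the preceding step of the filtration,
  this is the associated graded object.

  A family of bilinear maps \<open>H1 i \<times> H2 j \<Rightarrow> M / N (i + j)\<close> induced by \<open>\<mu>\<close> defines a bilinear
  map on direct sums; \<open>N1\<close> gives the zero elements of the components of the first factor.\<close>

definition gr_bilinear ::
    "'i::ab_group_add set \<Rightarrow> ('i \<Rightarrow> 'b set) \<Rightarrow> ('i \<Rightarrow> 'b set) \<Rightarrow> ('i \<Rightarrow> 'c set) \<Rightarrow>
     'e dg_alg \<Rightarrow> ('i \<Rightarrow> 'e set) \<Rightarrow> ('b \<Rightarrow> 'c \<Rightarrow> 'e) \<Rightarrow>
     ('i \<Rightarrow> 'b set) \<Rightarrow> ('i \<Rightarrow> 'c set) \<Rightarrow> 'i \<Rightarrow> 'e set" where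
  "gr_bilinear I H1 N1 H2 M N \<mu> f g =
     (\<lambda>k\<in>I. finsum (dg_quot M (N k))
        (\<lambda>i. \<Union>x\<in>f i \<inter> H1 i. \<Union>y\<in>g (k - i) \<inter> H2 (k - i). N k +>\<^bsub>M\<^esub> \<mu> x y)
        {i\<in>I. f i \<noteq> N1 i})"

definition gr_elem ::
    "'i set \<Rightarrow> 'b dg_alg \<Rightarrow> ('i \<Rightarrow> 'b set) \<Rightarrow> 'i \<Rightarrow> 'b \<Rightarrow> 'i \<Rightarrow> 'b set" where
  "gr_elem I M N i x = (\<lambda>j\<in>I. if j = i then N i +>\<^bsub>M\<^esub> x else N j)"

text \<open>\<open>e\<close> is the degree of the differential.\<close>

definition gr_obj ::
    "'i::ab_group_add set \<Rightarrow> 'i \<Rightarrow> 'b dg_alg \<Rightarrow> ('i \<Rightarrow> 'b set) \<Rightarrow> ('i \<Rightarrow> 'b set) \<Rightarrow>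
     ('i \<Rightarrow> 'b set) dg_alg" where
  "gr_obj I e M H N =
    \<lparr>carrier = {f \<in> (\<Pi>\<^sub>E i\<in>I. (\<lambda>x. N i +>\<^bsub>M\<^esub> x) ` H i). finite {i\<in>I. f i \<noteq> N i}},
     mult = gr_bilinear I H N H M N (mult M),
     one = gr_elem I M N 0 \<one>\<^bsub>M\<^esub>,
     zero = (\<lambda>i\<in>I. N i),
     add = (\<lambda>f g. \<lambda>i\<in>I. f i <+>\<^bsub>M\<^esub> g i),
     smult = (\<lambda>c f. \<lambda>i\<in>I. \<Union>x\<in>f i. N i +>\<^bsub>M\<^esub> (c \<odot>\<^bsub>M\<^esub> x)),
     diff = (\<lambda>f. \<lambda>i\<in>I. \<Union>x\<in>f (i - e) \<inter> H (i - e). N i +>\<^bsub>M\<^esub> diff M x)\<rparr>"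

definition gr_map ::
    "'i set \<Rightarrow> 'c dg_alg \<Rightarrow> ('i \<Rightarrow> 'c set) \<Rightarrow> ('b \<Rightarrow> 'c) \<Rightarrow> ('i \<Rightarrow> 'b set) \<Rightarrow> 'i \<Rightarrow> 'c set" where
  "gr_map I M N h f = (\<lambda>i\<in>I. \<Union>x\<in>f i. N i +>\<^bsub>M\<^esub> h x)"

text \<open>Cohomological filtrations are indexed by all integers, weight filtrations by half-integers.
  The differential raises the degree by one and preserves the weight.\<close>

definition below_deg :: "(int \<Rightarrow> 'b set) \<Rightarrow> int \<Rightarrow> 'b set" where
  "below_deg F p = F (p - 1)"

definition below_wt :: "(rat \<Rightarrow> 'b set) \<Rightarrow> rat \<Rightarrow> 'b set" where
  "below_wt W n = (\<Union>m\<in>half_ints \<inter> {..<n}. W m)"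

definition gr_deg :: "'b dg_alg \<Rightarrow> (int \<Rightarrow> 'b set) \<Rightarrow> (int \<Rightarrow> 'b set) dg_alg" where
  "gr_deg M F = gr_obj UNIV 1 M F (below_deg F)"

definition gr_wt :: "'b dg_alg \<Rightarrow> (rat \<Rightarrow> 'b set) \<Rightarrow> (rat \<Rightarrow> 'b set) dg_alg" where
  "gr_wt M W = gr_obj half_ints 0 M W (below_wt W)"

text \<open>The homogeneous parts of a module \<open>M\<close> and an algebra \<open>B\<close>, both graded by \<open>J\<close>, are \<open>GM\<close>
  and \<open>GB\<close>; \<open>act\<close> is the action of \<open>B\<close> on \<open>M\<close>, and \<open>B\<close> acts on itself by multiplication.\<close>

definition dg_module_iso ::
    "'j set \<Rightarrow> 'b dg_alg \<Rightarrow> ('j \<Rightarrow> 'b set) \<Rightarrow> 'c dg_alg \<Rightarrow> ('j \<Rightarrow> 'c set) \<Rightarrow>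
     ('b \<Rightarrow> 'c \<Rightarrow> 'c) \<Rightarrow> ('c \<Rightarrow> 'b) \<Rightarrow> bool" where
  "dg_module_iso J B GB M GM act h \<longleftrightarrow>
     bij_betw h (carrier M) (carrier B) \<and>
     (\<forall>x\<in>carrier M. \<forall>y\<in>carrier M. h (x \<oplus>\<^bsub>M\<^esub> y) = h x \<oplus>\<^bsub>B\<^esub> h y) \<and>
     (\<forall>c. \<forall>x\<in>carrier M. h (c \<odot>\<^bsub>M\<^esub> x) = c \<odot>\<^bsub>B\<^esub> h x) \<and>
     (\<forall>b\<in>carrier B. \<forall>x\<in>carrier M. h (act b x) = b \<otimes>\<^bsub>B\<^esub> h x) \<and>
     (\<forall>x\<in>carrier M. h (diff M x) = diff B (h x)) \<and>
     (\<forall>j\<in>J. h ` GM j = GB j)"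


section \<open>The C2-algebra, the Zhu algebra and its associated graded algebras\<close>

definition alg_on :: "'a::ab_group_add dg_voa \<Rightarrow> ('a \<Rightarrow> 'a \<Rightarrow> 'a) \<Rightarrow> 'a dg_alg" where
  "alg_on V \<mu> = \<lparr>carrier = UNIV, mult = \<mu>, one = vac V, zero = 0, add = (+),
     smult = scl V, diff = dV V\<rparr>"

definition C2 :: "'a::ab_group_add dg_voa \<Rightarrow> 'a set" where
  "C2 V = vspan V {mode V u (-2) v |u v. True}"

definition V_C2 :: "'a::ab_group_add dg_voa \<Rightarrow> 'a dg_alg" where
  "V_C2 V = alg_on V (\<lambda>u v. mode V u (-1) v)"

definition R_alg :: "'a::ab_group_add dg_voa \<Rightarrow> 'a set dg_alg" where
  "R_alg V = dg_quot (V_C2 V) (C2 V)"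

text \<open>For \<open>k = -1\<close> and \<open>k = -2\<close> these are \<open>u \<ast> v\<close> and \<open>u \<circ> v\<close>, extended linearly from weight
  homogeneous \<open>u\<close>.\<close>

definition zhu_product :: "'a::ab_group_add dg_voa \<Rightarrow> int \<Rightarrow> 'a \<Rightarrow> 'a \<Rightarrow> 'a" where
  "zhu_product V k u v =
     (\<Sum>h | h \<in> half_ints \<and> wt_part V h u \<noteq> 0.
        Sum_any (\<lambda>n::nat. scl V (of_rat h gchoose n) (mode V (wt_part V h u) (int n + k) v)))"

definition star :: "'a::ab_group_add dg_voa \<Rightarrow> 'a \<Rightarrow> 'a \<Rightarrow> 'a" where
  "star V = zhu_product V (-1)"

definition circ :: "'a::ab_group_add dg_voa \<Rightarrow> 'a \<Rightarrow> 'a \<Rightarrow> 'a" where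
  "circ V = zhu_product V (-2)"

definition O_sub :: "'a::ab_group_add dg_voa \<Rightarrow> 'a set" where
  "O_sub V = vspan V {circ V u v |u v. True}"

definition V_zhu :: "'a::ab_group_add dg_voa \<Rightarrow> 'a dg_alg" where
  "V_zhu V = alg_on V (star V)"

definition A_alg :: "'a::ab_group_add dg_voa \<Rightarrow> 'a set dg_alg" where
  "A_alg V = dg_quot (V_zhu V) (O_sub V)"

definition A_class :: "'a::ab_group_add dg_voa \<Rightarrow> 'a \<Rightarrow> 'a set" where
  "A_class V v = O_sub V +>\<^bsub>V_zhu V\<^esub> v"

definition FA :: "'a::ab_group_add dg_voa \<Rightarrow> int \<Rightarrow> 'a set set" where
  "FA V p = A_class V ` deg_le V p"

definition WA :: "'a::ab_group_add dg_voa \<Rightarrow> rat \<Rightarrow> 'a set set" where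
  "WA V n = A_class V ` wt_le V n"

definition grF_A :: "'a::ab_group_add dg_voa \<Rightarrow> (int \<Rightarrow> 'a set set) dg_alg" where
  "grF_A V = gr_deg (A_alg V) (FA V)"

definition grW_A :: "'a::ab_group_add dg_voa \<Rightarrow> (rat \<Rightarrow> 'a set set) dg_alg" where
  "grW_A V = gr_wt (A_alg V) (WA V)"

definition I_sub :: "'a::ab_group_add dg_voa \<Rightarrow> int \<times> rat \<Rightarrow> 'a set" where
  "I_sub V = (\<lambda>(p, n). vspan V (O_sub V
      \<union> (\<Union>q\<in>{..p}. \<Union>m\<in>half_ints \<inter> {..<n}. Vbi V q m)
      \<union> (\<Union>q\<in>{..<p}. \<Union>m\<in>half_ints \<inter> {..n}. Vbi V q m)))"

definition bidegrees :: "(int \<times> rat) set" where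
  "bidegrees = UNIV \<times> half_ints"

definition grFW_A :: "'a::ab_group_add dg_voa \<Rightarrow> (int \<times> rat \<Rightarrow> 'a set) dg_alg" where
  "grFW_A V = gr_obj bidegrees (1, 0) (V_zhu V) (\<lambda>(p, n). Vbi V p n) (I_sub V)"

definition grF_A_part :: "'a::ab_group_add dg_voa \<Rightarrow> int \<Rightarrow> (int \<Rightarrow> 'a set set) set" where
  "grF_A_part V p = gr_elem UNIV (A_alg V) (below_deg (FA V)) p ` FA V p"

definition grW_A_part :: "'a::ab_group_add dg_voa \<Rightarrow> rat \<Rightarrow> (rat \<Rightarrow> 'a set set) set" where
  "grW_A_part V n = gr_elem half_ints (A_alg V) (below_wt (WA V)) n ` WA V n"

definition grFW_A_part :: "'a::ab_group_add dg_voa \<Rightarrow> int \<times> rat \<Rightarrow> (int \<times> rat \<Rightarrow> 'a set) set" where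
  "grFW_A_part V = (\<lambda>(p, n). gr_elem bidegrees (V_zhu V) (I_sub V) (p, n) ` Vbi V p n)"

text \<open>A homogeneous vector goes to its class in the component of its own degree, weight or
  bidegree; the maps are extended linearly to all vectors.\<close>

definition symbF :: "'a::ab_group_add dg_voa \<Rightarrow> 'a \<Rightarrow> int \<Rightarrow> 'a set set" where
  "symbF V v = (\<lambda>p\<in>UNIV. below_deg (FA V) p +>\<^bsub>A_alg V\<^esub> A_class V (deg_part V p v))"

definition symbW :: "'a::ab_group_add dg_voa \<Rightarrow> 'a \<Rightarrow> rat \<Rightarrow> 'a set set" where
  "symbW V v = (\<lambda>n\<in>half_ints. below_wt (WA V) n +>\<^bsub>A_alg V\<^esub> A_class V (wt_part V n v))"

definition symbFW :: "'a::ab_group_add dg_voa \<Rightarrow> 'a \<Rightarrow> int \<times> rat \<Rightarrow> 'a set" where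
  "symbFW V v = (\<lambda>(p, n)\<in>bidegrees. I_sub V (p, n) +>\<^bsub>V_zhu V\<^esub> deg_part V p (wt_part V n v))"

text \<open>Elements of \<open>R\<close> are cosets of vectors, so the maps out of \<open>R\<close> are given by the common value on
  all representatives.\<close>

definition etaF :: "'a::ab_group_add dg_voa \<Rightarrow> 'a set \<Rightarrow> int \<Rightarrow> 'a set set" where
  "etaF V r = the_elem (symbF V ` r)"

definition etaW :: "'a::ab_group_add dg_voa \<Rightarrow> 'a set \<Rightarrow> rat \<Rightarrow> 'a set set" where
  "etaW V r = the_elem (symbW V ` r)"

definition etaFW :: "'a::ab_group_add dg_voa \<Rightarrow> 'a set \<Rightarrow> int \<times> rat \<Rightarrow> 'a set" where
  "etaFW V r = the_elem (symbFW V ` r)"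


section \<open>Base change of the adjoint module\<close>

text \<open>For \<open>\<eta> : R \<rightarrow> B\<close> surjective, \<open>\<eta>(R) = B \<otimes>\<^sub>R R\<close> is the quotient \<open>R / (Ker \<eta>) R\<close>, where \<open>\<eta> r\<close> acts
  as \<open>r\<close>.\<close>

definition ker_sub :: "'b dg_alg \<Rightarrow> 'c dg_alg \<Rightarrow> ('b \<Rightarrow> 'c) \<Rightarrow> 'b set" where
  "ker_sub R B \<eta> = a_kernel R B \<eta> \<cdot>\<^bsub>R\<^esub> carrier R"

definition eta_mod :: "'b dg_alg \<Rightarrow> 'c dg_alg \<Rightarrow> ('b \<Rightarrow> 'c) \<Rightarrow> 'b set dg_alg" where
  "eta_mod R B \<eta> = dg_quot R (ker_sub R B \<eta>)"

definition eta_act ::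
    "'b dg_alg \<Rightarrow> 'c dg_alg \<Rightarrow> ('b \<Rightarrow> 'c) \<Rightarrow> 'c \<Rightarrow> 'b set \<Rightarrow> 'b set" where
  "eta_act R B \<eta> b X =
     (\<Union>r\<in>{r \<in> carrier R. \<eta> r = b}. \<Union>w\<in>X. ker_sub R B \<eta> +>\<^bsub>R\<^esub> (r \<otimes>\<^bsub>R\<^esub> w))"

definition eta_class ::
    "'a::ab_group_add dg_voa \<Rightarrow> 'c dg_alg \<Rightarrow> ('a set \<Rightarrow> 'c) \<Rightarrow> 'a \<Rightarrow> 'a set set" where
  "eta_class V B \<eta> v = ker_sub (R_alg V) B \<eta> +>\<^bsub>R_alg V\<^esub> (C2 V +>\<^bsub>V_C2 V\<^esub> v)"

abbreviation etaF_R where "etaF_R V \<equiv> eta_mod (R_alg V) (grF_A V) (etaF V)"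
abbreviation etaW_R where "etaW_R V \<equiv> eta_mod (R_alg V) (grW_A V) (etaW V)"
abbreviation etaFW_R where "etaFW_R V \<equiv> eta_mod (R_alg V) (grFW_A V) (etaFW V)"

abbreviation etaF_act where "etaF_act V \<equiv> eta_act (R_alg V) (grF_A V) (etaF V)"
abbreviation etaW_act where "etaW_act V \<equiv> eta_act (R_alg V) (grW_A V) (etaW V)"
abbreviation etaFW_act where "etaFW_act V \<equiv> eta_act (R_alg V) (grFW_A V) (etaFW V)"

definition etaF_R_part :: "'a::ab_group_add dg_voa \<Rightarrow> int \<Rightarrow> 'a set set set" where
  "etaF_R_part V p = eta_class V (grF_A V) (etaF V) ` Vdeg V p"

definition etaW_R_part :: "'a::ab_group_add dg_voa \<Rightarrow> rat \<Rightarrow> 'a set set set" where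
  "etaW_R_part V n = eta_class V (grW_A V) (etaW V) ` Vwt V n"

definition etaFW_R_part :: "'a::ab_group_add dg_voa \<Rightarrow> int \<times> rat \<Rightarrow> 'a set set set" where
  "etaFW_R_part V = (\<lambda>(p, n). eta_class V (grFW_A V) (etaFW V) ` Vbi V p n)"

text \<open>An element \<open>X\<close> of \<open>\<eta>(R)\<close> is a coset of cosets, and \<open>\<Union>X\<close> is the set of all vectors
  representing it.\<close>

definition psi :: "'a::ab_group_add dg_voa \<Rightarrow> 'a set set \<Rightarrow> int \<Rightarrow> 'a set set" where
  "psi V X = the_elem (symbF V ` \<Union>X)"

definition phi :: "'a::ab_group_add dg_voa \<Rightarrow> 'a set set \<Rightarrow> rat \<Rightarrow> 'a set set" where
  "phi V X = the_elem (symbW V ` \<Union>X)"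

definition Psi :: "'a::ab_group_add dg_voa \<Rightarrow> 'a set set \<Rightarrow> int \<times> rat \<Rightarrow> 'a set" where
  "Psi V X = the_elem (symbFW V ` \<Union>X)"

subsection \<open>Associated graded of the maps psi and phi\<close>

definition W_etaF_R :: "'a::ab_group_add dg_voa \<Rightarrow> rat \<Rightarrow> 'a set set set" where
  "W_etaF_R V n = eta_class V (grF_A V) (etaF V) ` wt_le V n"

definition W_grF_A :: "'a::ab_group_add dg_voa \<Rightarrow> rat \<Rightarrow> (int \<Rightarrow> 'a set set) set" where
  "W_grF_A V n = symbF V ` wt_le V n"

definition F_etaW_R :: "'a::ab_group_add dg_voa \<Rightarrow> int \<Rightarrow> 'a set set set" where
  "F_etaW_R V p = eta_class V (grW_A V) (etaW V) ` deg_le V p"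

definition F_grW_A :: "'a::ab_group_add dg_voa \<Rightarrow> int \<Rightarrow> (rat \<Rightarrow> 'a set set) set" where
  "F_grW_A V p = symbW V ` deg_le V p"

definition grW_etaF_R :: "'a::ab_group_add dg_voa \<Rightarrow> (rat \<Rightarrow> 'a set set set) dg_alg" where
  "grW_etaF_R V = gr_wt (etaF_R V) (W_etaF_R V)"

definition grW_grF_A :: "'a::ab_group_add dg_voa \<Rightarrow> (rat \<Rightarrow> (int \<Rightarrow> 'a set set) set) dg_alg" where
  "grW_grF_A V = gr_wt (grF_A V) (W_grF_A V)"

definition grF_etaW_R :: "'a::ab_group_add dg_voa \<Rightarrow> (int \<Rightarrow> 'a set set set) dg_alg" where
  "grF_etaW_R V = gr_deg (etaW_R V) (F_etaW_R V)"

definition grF_grW_A :: "'a::ab_group_add dg_voa \<Rightarrow> (int \<Rightarrow> (rat \<Rightarrow> 'a set set) set) dg_alg" where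
  "grF_grW_A V = gr_deg (grW_A V) (F_grW_A V)"

definition grW_etaF_act where
  "grW_etaF_act V = gr_bilinear half_ints (W_grF_A V) (below_wt (W_grF_A V)) (W_etaF_R V)
     (etaF_R V) (below_wt (W_etaF_R V)) (etaF_act V)"

definition grF_etaW_act where
  "grF_etaW_act V = gr_bilinear UNIV (F_grW_A V) (below_deg (F_grW_A V)) (F_etaW_R V)
     (etaW_R V) (below_deg (F_etaW_R V)) (etaW_act V)"

definition grW_etaF_R_part :: "'a::ab_group_add dg_voa \<Rightarrow> int \<times> rat \<Rightarrow> (rat \<Rightarrow> 'a set set set) set" where
  "grW_etaF_R_part V = (\<lambda>(p, n). gr_elem half_ints (etaF_R V) (below_wt (W_etaF_R V)) n `
     (W_etaF_R V n \<inter> etaF_R_part V p))"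

definition grW_grF_A_part ::
    "'a::ab_group_add dg_voa \<Rightarrow> int \<times> rat \<Rightarrow> (rat \<Rightarrow> (int \<Rightarrow> 'a set set) set) set" where
  "grW_grF_A_part V = (\<lambda>(p, n). gr_elem half_ints (grF_A V) (below_wt (W_grF_A V)) n `
     (W_grF_A V n \<inter> grF_A_part V p))"

definition grF_etaW_R_part :: "'a::ab_group_add dg_voa \<Rightarrow> int \<times> rat \<Rightarrow> (int \<Rightarrow> 'a set set set) set" where
  "grF_etaW_R_part V = (\<lambda>(p, n). gr_elem UNIV (etaW_R V) (below_deg (F_etaW_R V)) p `
     (F_etaW_R V p \<inter> etaW_R_part V n))"

definition grF_grW_A_part ::
    "'a::ab_group_add dg_voa \<Rightarrow> int \<times> rat \<Rightarrow> (int \<Rightarrow> (rat \<Rightarrow> 'a set set) set) set" where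
  "grF_grW_A_part V = (\<lambda>(p, n). gr_elem UNIV (grW_A V) (below_deg (F_grW_A V)) p `
     (F_grW_A V p \<inter> grW_A_part V n))"

definition gr_psi :: "'a::ab_group_add dg_voa \<Rightarrow> (rat \<Rightarrow> 'a set set set) \<Rightarrow> rat \<Rightarrow> (int \<Rightarrow> 'a set set) set" where
  "gr_psi V = gr_map half_ints (grF_A V) (below_wt (W_grF_A V)) (psi V)"

definition gr_phi :: "'a::ab_group_add dg_voa \<Rightarrow> (int \<Rightarrow> 'a set set set) \<Rightarrow> int \<Rightarrow> (rat \<Rightarrow> 'a set set) set" where
  "gr_phi V = gr_map UNIV (grW_A V) (below_deg (F_grW_A V)) (phi V)"

end

theory Submission
  imports Defs "HOL-Computational_Algebra.Formal_Laurent_Series"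
begin

text \<open>The algebra \<open>R\<close> acts on itself and contains the class of the vacuum, which is a right unit. Hence
\<open>(Ker \<eta>) R = Ker \<eta>\<close> for each of the three maps \<open>\<eta>\<close> out of \<open>R\<close>, and \<open>\<eta>(R)\<close> is \<open>R / Ker \<eta>\<close>. The maps
\<open>\<psi>\<close>, \<open>\<phi>\<close> and \<open>\<Psi>\<close> are then the maps that \<open>\<eta>\<close> induces on \<open>R / Ker \<eta>\<close>, so they are bijective as soon as \<open>\<eta>\<close>
is a well defined surjective homomorphism. To make this precise, every algebra and module in the
theorem is described as the quotient of the space \<open>V\<close> by an explicit subspace, by means of a map from \<open>V\<close>
under which addition, scalars and differential come from those of \<open>V\<close>, and the product comes from a product on
\<open>V\<close> (\<open>quotient_map\<close>, \<open>compatible\<close>). The source and the target of each comparison map turn out to be quotients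
of \<open>V\<close> by the same subspace, with product induced by \<open>u\<^sub>-\<^sub>1 v\<close>, and the comparison map sends the
class of \<open>v\<close> to the class of \<open>v\<close>; such a map is an isomorphism (\<open>dg_module_isoI\<close>, \<open>base_change\<close>).

Passing to an associated graded object stays within this framework. The symbol of \<open>v\<close> collects the classes of
the homogeneous components of \<open>v\<close>, each modulo the preceding step of the filtration. The symbol map is again
the quotient of \<open>V\<close> by a subspace, which depends only on the filtration of \<open>V\<close> and on the kernel
of the map at the start, and the product of symbols is the symbol of the leading term of the
product (\<open>gr_bilinear_symbol\<close>). Two quotients of \<open>V\<close> with the same kernel therefore have associated graded
objects with the same kernel, which gives the statements on \<open>gr \<psi>\<close> and \<open>gr \<phi>\<close> (\<open>graded_iso\<close>).

Two facts on \<open>V\<close> remain. First, the products on \<open>R\<close> and \<open>A\<close> are well defined, that is, \<open>C\<^sub>2\<close> and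
\<open>O\<close> are two-sided ideals. Both are values, at \<open>\<epsilon> = 0\<close> and \<open>\<epsilon> = 1\<close>, of one family of subspaces, spanned by the residues of
\<open>(1 + \<epsilon> x)\<^bsup>wt u\<^esup> x\<^sup>-\<^sup>2 Y(u,x) v\<close>, and Zhu's argument works for every \<open>\<epsilon>\<close> (\<open>zhu_ideal_left\<close>,
\<open>zhu_ideal_right\<close>): it is the Jacobi identity, summed against Laurent series in two variables
(\<open>residue_jacobi\<close>), together with the observation that a higher pole at \<open>0\<close> does not lead out of the
ideal, since \<open>L(-1)\<close> acts as a derivative. Second, the symbol maps kill \<open>C\<^sub>2\<close>: up to the element \<open>u \<circ> v\<close> of \<open>O\<close>, the
vector \<open>u\<^sub>-\<^sub>2 v\<close> is a combination of vectors \<open>u\<^sub>n v\<close> with \<open>n > -2\<close>, whose degree and weight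
are both strictly smaller (\<open>C2_subset_kernels\<close>). For the same reason the product \<open>u \<ast> v\<close> has the leading term \<open>u\<^sub>-\<^sub>1 v\<close>.\<close>

unbundle fps_syntax

section \<open>Quotients of a space and operations on cosets\<close>

text \<open>Only the additive structure enters here, because the steps of a cohomological filtration are not stable
under the differential, and finite sums in the quotients by these steps are needed for the products of symbols.\<close>

definition quotient_map :: "('a::ab_group_add \<Rightarrow> 'b) \<Rightarrow> 'b dg_alg \<Rightarrow> 'a set \<Rightarrow> bool" where
  "quotient_map \<pi> M K \<longleftrightarrow> range \<pi> = carrier M \<and> (\<forall>x y. \<pi> x = \<pi> y \<longleftrightarrow> x - y \<in> K) \<and>
     (\<forall>x y. \<pi> (x + y) = \<pi> x \<oplus>\<^bsub>M\<^esub> \<pi> y) \<and> \<pi> 0 = \<zero>\<^bsub>M\<^esub>"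

lemma quotient_mapD:
  assumes "quotient_map \<pi> M K"
  shows "range \<pi> = carrier M" "\<pi> x = \<pi> y \<longleftrightarrow> x - y \<in> K" "\<pi> (x + y) = \<pi> x \<oplus>\<^bsub>M\<^esub> \<pi> y" "\<pi> 0 = \<zero>\<^bsub>M\<^esub>"
    "\<pi> x \<in> carrier M"
  using assms unfolding quotient_map_def by blast+

text \<open>The group laws of \<open>M\<close> are inherited from \<open>V\<close> along the surjection; this makes \<^const>\<open>finsum\<close> usable in \<open>M\<close>.\<close>

lemma quotient_map_abelian_monoid:
  assumes "quotient_map \<pi> M K"
  shows "abelian_monoid M"
proof -
  note q = quotient_mapD[OF assms]
  show ?thesis
    by (rule abelian_monoidI)
      (auto simp flip: q(1) q(3) simp flip: q(4) simp flip: q(3) simp: add_ac)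
qed

lemma finsum_quotient_map:
  assumes "quotient_map \<pi> M K" "finite S"
  shows "finsum M (\<lambda>i. \<pi> (t i)) S = \<pi> (\<Sum>i\<in>S. t i)"
proof -
  interpret abelian_monoid M using quotient_map_abelian_monoid[OF assms(1)] .
  note q = quotient_mapD[OF assms(1)]
  show ?thesis using assms(2)
    by (induction S rule: finite_induct) (auto simp: q(3,4,5))
qed

definition biadditive :: "('a::ab_group_add \<Rightarrow> 'a \<Rightarrow> 'a) \<Rightarrow> bool" where
  "biadditive \<mu> \<longleftrightarrow> (\<forall>x y z. \<mu> (x + y) z = \<mu> x z + \<mu> y z \<and> \<mu> z (x + y) = \<mu> z x + \<mu> z y)"

lemma biadditiveD:
  assumes "biadditive \<mu>"
  shows "\<mu> (x + y) z = \<mu> x z + \<mu> y z" "\<mu> z (x + y) = \<mu> z x + \<mu> z y"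
    "\<mu> 0 z = 0" "\<mu> z 0 = 0" "\<mu> (x - y) z = \<mu> x z - \<mu> y z" "\<mu> z (x - y) = \<mu> z x - \<mu> z y"
    "\<mu> (sum g S) z = (\<Sum>i\<in>S. \<mu> (g i) z)" "\<mu> z (sum g S) = (\<Sum>i\<in>S. \<mu> z (g i))"
proof -
  have l: "additive (\<lambda>x. \<mu> x z)" and r: "additive (\<mu> z)"
    using assms by (auto simp: biadditive_def additive_def)
  show "\<mu> (x + y) z = \<mu> x z + \<mu> y z" "\<mu> 0 z = 0" "\<mu> (x - y) z = \<mu> x z - \<mu> y z"
    "\<mu> (sum g S) z = (\<Sum>i\<in>S. \<mu> (g i) z)"
    using additive.add[OF l] additive.zero[OF l] additive.diff[OF l] additive.sum[OF l] by auto
  show "\<mu> z (x + y) = \<mu> z x + \<mu> z y" "\<mu> z 0 = 0" "\<mu> z (x - y) = \<mu> z x - \<mu> z y"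
    "\<mu> z (sum g S) = (\<Sum>i\<in>S. \<mu> z (g i))"
    using additive.add[OF r] additive.zero[OF r] additive.diff[OF r] additive.sum[OF r] by auto
qed

definition ideal_for :: "('a \<Rightarrow> 'a \<Rightarrow> 'a) \<Rightarrow> 'a set \<Rightarrow> bool" where
  "ideal_for \<mu> K \<longleftrightarrow> (\<forall>x\<in>K. \<forall>y. \<mu> x y \<in> K \<and> \<mu> y x \<in> K)"

lemma UN_constant_on:
  assumes "S \<noteq> {}" "\<And>z. z \<in> S \<Longrightarrow> g z = C"
  shows "(\<Union>z\<in>S. g z) = C"
  using assms by auto

locale dg_space = Vector_Spaces.vector_space scale
  for scale :: "complex \<Rightarrow> 'a::ab_group_add \<Rightarrow> 'a" +
  fixes \<delta> :: "'a \<Rightarrow> 'a"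
  assumes diff_add: "\<delta> (x + y) = \<delta> x + \<delta> y"
begin

lemma diff_zero: "\<delta> 0 = 0" and diff_minus: "\<delta> (x - y) = \<delta> x - \<delta> y"
  and diff_sum: "\<delta> (sum g S) = (\<Sum>i\<in>S. \<delta> (g i))"
proof -
  have "additive \<delta>" by (simp add: additive_def diff_add)
  then show "\<delta> 0 = 0" "\<delta> (x - y) = \<delta> x - \<delta> y" "\<delta> (sum g S) = (\<Sum>i\<in>S. \<delta> (g i))"
    by (simp_all add: additive.zero additive.diff additive.sum)
qed

definition compatible :: "('a \<Rightarrow> 'b) \<Rightarrow> 'b dg_alg \<Rightarrow> bool" where
  "compatible \<pi> M \<longleftrightarrow> (\<forall>c x. \<pi> (scale c x) = c \<odot>\<^bsub>M\<^esub> \<pi> x) \<and> (\<forall>x. \<pi> (\<delta> x) = diff M (\<pi> x))"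

lemma coset_image:
  assumes "quotient_map \<rho> M L"
  shows "(\<rho> ` K) +>\<^bsub>M\<^esub> \<rho> x = \<rho> ` {y. y - x \<in> K}"
proof -
  note q = quotient_mapD[OF assms]
  have "{y. y - x \<in> K} = (\<lambda>k. k + x) ` K" by (auto simp: image_iff) (metis diff_add_cancel)
  then show ?thesis by (auto simp: a_r_coset_def' image_image q(3))
qed

lemma coset_eq_iff:
  assumes "quotient_map \<rho> M L" "subspace K" "L \<subseteq> K"
  shows "(\<rho> ` K) +>\<^bsub>M\<^esub> \<rho> x = (\<rho> ` K) +>\<^bsub>M\<^esub> \<rho> y \<longleftrightarrow> x - y \<in> K"
proof -
  note q = quotient_mapD[OF assms(1)]
  have mem: "\<rho> z \<in> \<rho> ` {y. y - w \<in> K} \<longleftrightarrow> z - w \<in> K" for z w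
  proof
    assume "\<rho> z \<in> \<rho> ` {y. y - w \<in> K}"
    then obtain y where y: "\<rho> z = \<rho> y" "y - w \<in> K" by auto
    then have "z - y \<in> K" using q(2) assms(3) by auto
    then have "(z - y) + (y - w) \<in> K" using y assms(2) subspace_add by blast
    then show "z - w \<in> K" by simp
  qed auto
  show ?thesis unfolding coset_image[OF assms(1)]
  proof
    assume "\<rho> ` {z. z - x \<in> K} = \<rho> ` {z. z - y \<in> K}"
    then show "x - y \<in> K" using mem[of x x] mem[of x y] subspace_0[OF assms(2)] by auto
  next
    assume xy: "x - y \<in> K"
    have "z - x \<in> K \<longleftrightarrow> z - y \<in> K" for z
      using subspace_add[OF assms(2) _ xy, of "z - x"] subspace_diff[OF assms(2) _ xy, of "z - y"] by auto
    then show "\<rho> ` {z. z - x \<in> K} = \<rho> ` {z. z - y \<in> K}" by simp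
  qed
qed

lemma coset_zero: "quotient_map \<rho> M L \<Longrightarrow> (\<rho> ` K) +>\<^bsub>M\<^esub> \<rho> 0 = \<rho> ` K"
  by (simp add: coset_image)

lemma coset_add:
  assumes "quotient_map \<rho> M L" "subspace K"
  shows "((\<rho> ` K) +>\<^bsub>M\<^esub> \<rho> x) <+>\<^bsub>M\<^esub> ((\<rho> ` K) +>\<^bsub>M\<^esub> \<rho> y) = (\<rho> ` K) +>\<^bsub>M\<^esub> \<rho> (x + y)"
proof -
  note q = quotient_mapD[OF assms(1)]
  have "\<rho> ` {z. z - x \<in> K} <+>\<^bsub>M\<^esub> \<rho> ` {z. z - y \<in> K}
      = \<rho> ` {a + b |a b. a - x \<in> K \<and> b - y \<in> K}"
    unfolding set_add_def' by (auto simp flip: q(3))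
  also have "{a + b |a b. a - x \<in> K \<and> b - y \<in> K} = {z. z - (x + y) \<in> K}"
  proof (intro equalityI subsetI)
    fix z assume "z \<in> {a + b |a b. a - x \<in> K \<and> b - y \<in> K}"
    then show "z \<in> {z. z - (x + y) \<in> K}"
      using subspace_add[OF assms(2)] by (auto simp: add_diff_add)
  next
    fix z assume "z \<in> {z. z - (x + y) \<in> K}"
    then show "z \<in> {a + b |a b. a - x \<in> K \<and> b - y \<in> K}"
      using subspace_0[OF assms(2)]
      by (intro CollectI exI[of _ "z - y"] exI[of _ y]) (simp add: algebra_simps)
  qed
  finally show ?thesis by (simp add: coset_image[OF assms(1)])
qed

text \<open>Operations on cosets are defined as unions over representatives; a union of copies of one coset is that coset.\<close>

lemma coset_union:
  assumes "quotient_map \<rho> M L" "subspace K" "L \<subseteq> K" "\<And>y. y - x \<in> K \<Longrightarrow> f (\<rho> y) = C"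
  shows "(\<Union>z\<in>(\<rho> ` K) +>\<^bsub>M\<^esub> \<rho> x. f z) = C"
  unfolding coset_image[OF assms(1)]
  by (rule UN_constant_on) (use assms(4) subspace_0[OF assms(2)] in \<open>auto intro: exI[of _ x]\<close>)

lemma coset_smult:
  assumes "quotient_map \<rho> M L" "subspace K" "L \<subseteq> K" "compatible \<rho> M"
  shows "(\<Union>z\<in>(\<rho> ` K) +>\<^bsub>M\<^esub> \<rho> x. (\<rho> ` K) +>\<^bsub>M\<^esub> (c \<odot>\<^bsub>M\<^esub> z)) = (\<rho> ` K) +>\<^bsub>M\<^esub> \<rho> (scale c x)"
proof (rule coset_union[OF assms(1-3)])
  fix y assume "y - x \<in> K"
  then have "scale c y - scale c x \<in> K"
    using subspace_scale[OF assms(2)] by (simp flip: scale_right_diff_distrib)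
  moreover have "c \<odot>\<^bsub>M\<^esub> \<rho> y = \<rho> (scale c y)" using assms(4) by (simp add: compatible_def)
  ultimately show "(\<rho> ` K) +>\<^bsub>M\<^esub> (c \<odot>\<^bsub>M\<^esub> \<rho> y) = (\<rho> ` K) +>\<^bsub>M\<^esub> \<rho> (scale c x)"
    using coset_eq_iff[OF assms(1-3)] by simp
qed

lemma quotient_map_dg_quot:
  assumes "quotient_map \<rho> M L" "subspace K" "L \<subseteq> K"
  shows "quotient_map (\<lambda>x. (\<rho> ` K) +>\<^bsub>M\<^esub> \<rho> x) (dg_quot M (\<rho> ` K)) K"
proof -
  note q = quotient_mapD[OF assms(1)]
  show ?thesis unfolding quotient_map_def
    using coset_eq_iff[OF assms] coset_add[OF assms(1,2)] coset_zero[OF assms(1)]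
    by (auto simp: dg_quot_def A_RCOSETS_def' simp flip: q(1))
qed

lemma compatible_dg_quot:
  assumes "quotient_map \<rho> M L" "subspace K" "L \<subseteq> K" "compatible \<rho> M" "\<And>x. x \<in> K \<Longrightarrow> \<delta> x \<in> K"
  shows "compatible (\<lambda>x. (\<rho> ` K) +>\<^bsub>M\<^esub> \<rho> x) (dg_quot M (\<rho> ` K))"
proof -
  have "(\<Union>z\<in>(\<rho> ` K) +>\<^bsub>M\<^esub> \<rho> x. (\<rho> ` K) +>\<^bsub>M\<^esub> diff M z) = (\<rho> ` K) +>\<^bsub>M\<^esub> \<rho> (\<delta> x)" for x
  proof (rule coset_union[OF assms(1-3)])
    fix y assume "y - x \<in> K"
    then have "\<delta> y - \<delta> x \<in> K" using assms(5) by (simp flip: diff_minus)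
    moreover have "diff M (\<rho> y) = \<rho> (\<delta> y)" using assms(4) by (simp add: compatible_def)
    ultimately show "(\<rho> ` K) +>\<^bsub>M\<^esub> diff M (\<rho> y) = (\<rho> ` K) +>\<^bsub>M\<^esub> \<rho> (\<delta> x)"
      using coset_eq_iff[OF assms(1-3)] by simp
  qed
  then show ?thesis using coset_smult[OF assms(1-4)] by (simp add: compatible_def dg_quot_def)
qed

text \<open>The products on quotients and on graded objects, and the module actions, all have this shape. The sets \<open>X\<^sub>1\<close> and
\<open>X\<^sub>2\<close> restrict the representatives to given steps of filtrations. Writing
\<open>xy - uv = (x - u) v + x (y - v)\<close> shows that the coset of the product does not depend on them.\<close>

lemma coset_action:
  assumes "quotient_map \<rho>\<^sub>1 M\<^sub>1 L\<^sub>1" "subspace K\<^sub>1" "L\<^sub>1 \<subseteq> K\<^sub>1"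
    and "quotient_map \<rho>\<^sub>2 M\<^sub>2 L\<^sub>2" "subspace K\<^sub>2" "L\<^sub>2 \<subseteq> K\<^sub>2"
    and "quotient_map \<rho>\<^sub>3 M\<^sub>3 L\<^sub>3" "subspace K\<^sub>3" "L\<^sub>3 \<subseteq> K\<^sub>3"
    and "biadditive \<mu>" "\<And>u v. act (\<rho>\<^sub>1 u) (\<rho>\<^sub>2 v) = \<rho>\<^sub>3 (\<mu> u v)"
    and "\<And>y. y \<in> K\<^sub>1 \<Longrightarrow> \<mu> y v \<in> K\<^sub>3" "\<And>x y. x - u \<in> K\<^sub>1 \<Longrightarrow> y \<in> K\<^sub>2 \<Longrightarrow> \<mu> x y \<in> K\<^sub>3"
    and "u \<in> X\<^sub>1" "v \<in> X\<^sub>2"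
  shows "(\<Union>x\<in>((\<rho>\<^sub>1 ` K\<^sub>1) +>\<^bsub>M\<^sub>1\<^esub> \<rho>\<^sub>1 u) \<inter> \<rho>\<^sub>1 ` X\<^sub>1. \<Union>y\<in>((\<rho>\<^sub>2 ` K\<^sub>2) +>\<^bsub>M\<^sub>2\<^esub> \<rho>\<^sub>2 v) \<inter> \<rho>\<^sub>2 ` X\<^sub>2.
      (\<rho>\<^sub>3 ` K\<^sub>3) +>\<^bsub>M\<^sub>3\<^esub> act x y) = (\<rho>\<^sub>3 ` K\<^sub>3) +>\<^bsub>M\<^sub>3\<^esub> \<rho>\<^sub>3 (\<mu> u v)"
proof (intro UN_constant_on)
  have "\<rho>\<^sub>1 u \<in> ((\<rho>\<^sub>1 ` K\<^sub>1) +>\<^bsub>M\<^sub>1\<^esub> \<rho>\<^sub>1 u)" "\<rho>\<^sub>2 v \<in> ((\<rho>\<^sub>2 ` K\<^sub>2) +>\<^bsub>M\<^sub>2\<^esub> \<rho>\<^sub>2 v)"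
    using assms(2,5) by (auto simp: coset_image[OF assms(1)] coset_image[OF assms(4)] subspace_0)
  then show "((\<rho>\<^sub>1 ` K\<^sub>1) +>\<^bsub>M\<^sub>1\<^esub> \<rho>\<^sub>1 u) \<inter> \<rho>\<^sub>1 ` X\<^sub>1 \<noteq> {}" "((\<rho>\<^sub>2 ` K\<^sub>2) +>\<^bsub>M\<^sub>2\<^esub> \<rho>\<^sub>2 v) \<inter> \<rho>\<^sub>2 ` X\<^sub>2 \<noteq> {}"
    using assms(14,15) by auto
next
  fix a b assume "a \<in> ((\<rho>\<^sub>1 ` K\<^sub>1) +>\<^bsub>M\<^sub>1\<^esub> \<rho>\<^sub>1 u) \<inter> \<rho>\<^sub>1 ` X\<^sub>1" "b \<in> ((\<rho>\<^sub>2 ` K\<^sub>2) +>\<^bsub>M\<^sub>2\<^esub> \<rho>\<^sub>2 v) \<inter> \<rho>\<^sub>2 ` X\<^sub>2"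
  then obtain x y where xy: "a = \<rho>\<^sub>1 x" "x - u \<in> K\<^sub>1" "b = \<rho>\<^sub>2 y" "y - v \<in> K\<^sub>2"
    by (auto simp: coset_image[OF assms(1)] coset_image[OF assms(4)])
  have "\<mu> x y - \<mu> u v = \<mu> (x - u) v + \<mu> x (y - v)"
    by (simp add: biadditiveD[OF assms(10)])
  then have "\<mu> x y - \<mu> u v \<in> K\<^sub>3"
    using assms(12)[OF xy(2)] assms(13)[OF xy(2,4)] subspace_add[OF assms(8)] by auto
  then show "(\<rho>\<^sub>3 ` K\<^sub>3) +>\<^bsub>M\<^sub>3\<^esub> act a b = (\<rho>\<^sub>3 ` K\<^sub>3) +>\<^bsub>M\<^sub>3\<^esub> \<rho>\<^sub>3 (\<mu> u v)"
    using coset_eq_iff[OF assms(7-9)] xy assms(11) by simp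
qed

lemma mult_dg_quot:
  assumes "quotient_map \<rho> M L" "subspace K" "L \<subseteq> K" "biadditive \<mu>" "ideal_for \<mu> K"
    and "\<And>u v. \<rho> u \<otimes>\<^bsub>M\<^esub> \<rho> v = \<rho> (\<mu> u v)"
  shows "((\<rho> ` K) +>\<^bsub>M\<^esub> \<rho> u) \<otimes>\<^bsub>dg_quot M (\<rho> ` K)\<^esub> ((\<rho> ` K) +>\<^bsub>M\<^esub> \<rho> v) = (\<rho> ` K) +>\<^bsub>M\<^esub> \<rho> (\<mu> u v)"
proof -
  have "((\<rho> ` K) +>\<^bsub>M\<^esub> \<rho> u) \<inter> range \<rho> = ((\<rho> ` K) +>\<^bsub>M\<^esub> \<rho> u)" for u
    by (auto simp: coset_image[OF assms(1)])
  then show ?thesis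
    using coset_action[OF assms(1-3) assms(1-3) assms(1-4), of "monoid.mult M" v u UNIV UNIV] assms(5,6)
    by (simp add: dg_quot_def rcoset_mult_def ideal_for_def)
qed

end

section \<open>Base change to a quotient algebra\<close>

context dg_space
begin

lemma kernel_subspace:
  assumes "quotient_map \<pi> M K" "compatible \<pi> M"
  shows "subspace K" and "x \<in> K \<Longrightarrow> \<delta> x \<in> K"
proof -
  note q = quotient_mapD[OF assms(1)]
  have mem: "x \<in> K \<longleftrightarrow> \<pi> x = \<pi> 0" for x using q(2)[of x 0] by simp
  have c: "\<pi> (scale c x) = c \<odot>\<^bsub>M\<^esub> \<pi> x" "\<pi> (\<delta> x) = diff M (\<pi> x)" for c x
    using assms(2) by (auto simp: compatible_def)
  show "subspace K"
  proof (rule subspaceI)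
    fix x y assume "x \<in> K" "y \<in> K"
    then show "x + y \<in> K" using q(3)[of x y] q(3)[of 0 0] by (simp add: mem)
  next
    fix a x assume "x \<in> K"
    then show "scale a x \<in> K" using c(1)[of a x] c(1)[of a 0] by (simp add: mem)
  qed (simp add: mem)
  show "x \<in> K \<Longrightarrow> \<delta> x \<in> K" using c(2)[of x] c(2)[of 0] by (simp add: mem diff_zero)
qed

lemma kernel_ideal:
  assumes "quotient_map \<pi> M K" "biadditive \<nu>" "\<And>u v. \<pi> u \<otimes>\<^bsub>M\<^esub> \<pi> v = \<pi> (\<nu> u v)"
  shows "ideal_for \<nu> K"
proof -
  note q = quotient_mapD[OF assms(1)]
  have mem: "x \<in> K \<longleftrightarrow> \<pi> x = \<pi> 0" for x using q(2)[of x 0] by simp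
  have "\<pi> (\<nu> x y) = \<pi> 0 \<and> \<pi> (\<nu> y x) = \<pi> 0" if "\<pi> x = \<pi> 0" for x y
    using assms(3)[of x y] assms(3)[of y x] assms(3)[of 0 y] assms(3)[of y 0] that
    by (simp add: biadditiveD[OF assms(2)])
  then show ?thesis by (auto simp: ideal_for_def mem)
qed

text \<open>Two quotients of the same space by the same subspace are identified by sending the class of \<open>v\<close> to the class of \<open>v\<close>;
every operation is computed on representatives.\<close>

lemma dg_module_isoI:
  assumes \<pi>: "quotient_map \<pi> M K" "compatible \<pi> M" and \<sigma>: "quotient_map \<sigma> B K" "compatible \<sigma> B"
    and h: "\<And>v. h (\<pi> v) = \<sigma> v"
    and act: "\<And>u v. act (\<sigma> u) (\<pi> v) = \<pi> (\<nu> u v)" "\<And>u v. \<sigma> u \<otimes>\<^bsub>B\<^esub> \<sigma> v = \<sigma> (\<nu> u v)"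
    and parts: "\<And>j. j \<in> J \<Longrightarrow> \<exists>S. GM j = \<pi> ` S \<and> GB j = \<sigma> ` S"
  shows "dg_module_iso J B GB M GM act h"
proof -
  note p = quotient_mapD[OF \<pi>(1)] and s = quotient_mapD[OF \<sigma>(1)]
  have c: "\<pi> (scale c x) = c \<odot>\<^bsub>M\<^esub> \<pi> x" "\<pi> (\<delta> x) = diff M (\<pi> x)"
    "\<sigma> (scale c x) = c \<odot>\<^bsub>B\<^esub> \<sigma> x" "\<sigma> (\<delta> x) = diff B (\<sigma> x)" for c x
    using \<pi>(2) \<sigma>(2) by (auto simp: compatible_def)
  have "bij_betw h (carrier M) (carrier B)"
    unfolding bij_betw_def inj_on_def p(1)[symmetric] s(1)[symmetric]
    by (simp add: image_image h p(2) s(2))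
  moreover have "\<forall>j\<in>J. h ` GM j = GB j"
  proof
    fix j assume "j \<in> J"
    then obtain S where S: "GM j = \<pi> ` S" "GB j = \<sigma> ` S" using parts[of j] by auto
    show "h ` GM j = GB j" unfolding S by (simp add: image_image h)
  qed
  moreover have "h (\<pi> x \<oplus>\<^bsub>M\<^esub> \<pi> y) = h (\<pi> x) \<oplus>\<^bsub>B\<^esub> h (\<pi> y)" for x y
    unfolding h p(3)[symmetric] s(3) ..
  moreover have "h (c \<odot>\<^bsub>M\<^esub> \<pi> x) = c \<odot>\<^bsub>B\<^esub> h (\<pi> x)" "h (diff M (\<pi> x)) = diff B (h (\<pi> x))" for c x
    unfolding h c(1,2)[symmetric] c(3,4) by (rule refl)+
  moreover have "h (act (\<sigma> x) (\<pi> y)) = \<sigma> x \<otimes>\<^bsub>B\<^esub> h (\<pi> y)" for x y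
    unfolding act h ..
  ultimately show ?thesis
    unfolding dg_module_iso_def p(1)[symmetric] s(1)[symmetric] by (simp add: image_iff ball_simps)
qed

text \<open>Since \<open>\<eta> \<circ> \<rho> = \<sigma>\<close>, the kernel of \<open>\<eta>\<close> is \<open>\<rho> ` K\<close>. It is an ideal, and multiplying it by the right unit \<open>\<rho> a\<close>
gives it back, so \<open>(Ker \<eta>) R = \<rho> ` K\<close> and the base change of \<open>R\<close> is the quotient of the original
space by \<open>K\<close>.\<close>

lemma base_change:
  fixes \<rho> :: "'a \<Rightarrow> 'a set" and B :: "'c dg_alg"
  assumes \<rho>: "quotient_map \<rho> R C" "compatible \<rho> R" "\<And>v. \<rho> v = {w. w - v \<in> C}"
    and mult: "biadditive \<nu>" "\<And>u. \<nu> u a = u" "\<And>u v. \<rho> u \<otimes>\<^bsub>R\<^esub> \<rho> v = \<rho> (\<nu> u v)"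
    and \<sigma>: "quotient_map \<sigma> B K" "compatible \<sigma> B" "\<And>u v. \<sigma> u \<otimes>\<^bsub>B\<^esub> \<sigma> v = \<sigma> (\<nu> u v)"
    and CK: "C \<subseteq> K" and \<eta>: "\<eta> = (\<lambda>r. the_elem (\<sigma> ` r))"
  defines "\<pi> \<equiv> (\<lambda>v. ker_sub R B \<eta> +>\<^bsub>R\<^esub> \<rho> v)"
  shows "quotient_map \<pi> (eta_mod R B \<eta>) K" "compatible \<pi> (eta_mod R B \<eta>)"
    "eta_act R B \<eta> (\<sigma> u) (\<pi> v) = \<pi> (\<nu> u v)" "the_elem (\<sigma> ` \<Union>(\<pi> v)) = \<sigma> v"
proof -
  note sub = kernel_subspace[OF \<sigma>(1,2)] and K = kernel_ideal[OF \<sigma>(1) mult(1) \<sigma>(3)]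
  note r = quotient_mapD[OF \<rho>(1)] and s = quotient_mapD[OF \<sigma>(1)]
  \<comment> \<open>\<open>\<sigma>\<close> is constant on every set of vectors that are congruent modulo \<open>K\<close>.\<close>
  have common: "the_elem (\<sigma> ` A) = \<sigma> v" if "v \<in> A" "\<And>w. w \<in> A \<Longrightarrow> w - v \<in> K" for A v
  proof -
    have "\<sigma> ` A = {\<sigma> v}" using that s(2) by blast
    then show ?thesis by simp
  qed
  have \<eta>_\<rho>: "\<eta> (\<rho> v) = \<sigma> v" for v
    unfolding \<eta>
  proof (rule common)
    show "v \<in> \<rho> v" using r(2)[of v v] by (simp add: \<rho>(3))
    show "w - v \<in> K" if "w \<in> \<rho> v" for w using that CK by (auto simp: \<rho>(3))
  qed
  have mem: "x \<in> K \<longleftrightarrow> \<sigma> x = \<zero>\<^bsub>B\<^esub>" for x using s(2)[of x 0] s(4) by simp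
  have kernel: "a_kernel R B \<eta> = \<rho> ` K"
    unfolding a_kernel_def' r(1)[symmetric] by (auto simp: mem \<eta>_\<rho>)
  have ker_sub: "ker_sub R B \<eta> = \<rho> ` K"
  proof
    show "ker_sub R B \<eta> \<subseteq> \<rho> ` K"
    proof
      fix x assume "x \<in> ker_sub R B \<eta>"
      then show "x \<in> \<rho> ` K" unfolding ker_sub_def kernel
      proof (induction rule: ideal_prod.induct)
        case (prod i j)
        then show ?case using K unfolding r(1)[symmetric] by (auto simp: mult(3) ideal_for_def)
      next
        case (sum s1 s2)
        then show ?case using subspace_add[OF sub(1)] by (auto simp: r(3)[symmetric])
      qed
    qed
    have "\<rho> x \<in> ker_sub R B \<eta>" if "x \<in> K" for x
      using ideal_prod.prod[of "\<rho> x" "a_kernel R B \<eta>" "\<rho> a" "carrier R" R] that r(5)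
      by (simp add: kernel mult(2,3) ker_sub_def)
    then show "\<rho> ` K \<subseteq> ker_sub R B \<eta>" by blast
  qed
  have \<pi>: "\<pi> = (\<lambda>v. (\<rho> ` K) +>\<^bsub>R\<^esub> \<rho> v)" by (simp add: \<pi>_def ker_sub)
  show "quotient_map \<pi> (eta_mod R B \<eta>) K"
    unfolding eta_mod_def ker_sub \<pi> by (rule quotient_map_dg_quot[OF \<rho>(1) sub(1) CK])
  show "compatible \<pi> (eta_mod R B \<eta>)"
    unfolding eta_mod_def ker_sub \<pi> by (rule compatible_dg_quot[OF \<rho>(1) sub(1) CK \<rho>(2) sub(2)])
  have union: "\<Union>(\<pi> v) = {w. w - v \<in> K}" for v
  proof -
    have "\<Union>(\<pi> v) = {w. \<exists>y. y - v \<in> K \<and> w - y \<in> C}"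
      unfolding \<pi> coset_image[OF \<rho>(1)] by (auto simp: \<rho>(3))
    also have "\<dots> = {w. w - v \<in> K}"
    proof (intro Collect_cong iffI)
      fix w assume "\<exists>y. y - v \<in> K \<and> w - y \<in> C"
      then obtain y where y: "y - v \<in> K" "w - y \<in> K" using CK by blast
      show "w - v \<in> K" using subspace_add[OF sub(1) y] by simp
    next
      fix w assume "w - v \<in> K"
      then show "\<exists>y. y - v \<in> K \<and> w - y \<in> C" using r(2)[of w w] by auto
    qed
    finally show ?thesis .
  qed
  show "the_elem (\<sigma> ` \<Union>(\<pi> v)) = \<sigma> v"
    by (rule common) (simp_all add: union subspace_0[OF sub(1)])
  \<comment> \<open>The elements of \<open>R\<close> acting as \<open>\<sigma> u\<close> form the coset \<open>\<pi> u\<close>.\<close>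
  have acting: "{r \<in> carrier R. \<eta> r = \<sigma> u} = \<pi> u"
    unfolding \<pi> coset_image[OF \<rho>(1)] r(1)[symmetric] by (auto simp: \<eta>_\<rho> s(2))
  have "((\<rho> ` K) +>\<^bsub>R\<^esub> \<rho> w) \<inter> range \<rho> = (\<rho> ` K) +>\<^bsub>R\<^esub> \<rho> w" for w
    by (auto simp: coset_image[OF \<rho>(1)])
  then show "eta_act R B \<eta> (\<sigma> u) (\<pi> v) = \<pi> (\<nu> u v)"
    using coset_action[OF \<rho>(1) sub(1) CK \<rho>(1) sub(1) CK \<rho>(1) sub(1) CK mult(1), of "monoid.mult R" v u UNIV UNIV]
      mult(3) K
    by (simp add: eta_act_def acting ker_sub \<pi> ideal_for_def)
qed

end

section \<open>Symbols in associated graded objects\<close>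

text \<open>A grading is given by its projections \<open>pr\<close>, indexed by a whole type and zero outside the group \<open>I\<close>
of degrees; \<open>e\<close> is the degree of the differential.\<close>

locale dg_graded_space = dg_space +
  fixes I :: "'i::ab_group_add set" and e :: 'i and pr :: "'i \<Rightarrow> 'a \<Rightarrow> 'a"
  assumes zero_index: "0 \<in> I"
    and diff_index: "i \<in> I \<Longrightarrow> j \<in> I \<Longrightarrow> i - j \<in> I"
    and e_index: "e \<in> I"
    and pr_add: "pr i (x + y) = pr i x + pr i y"
    and pr_scale: "pr i (scale c x) = scale c (pr i x)"
    and pr_pr: "pr i (pr j x) = (if i = j then pr i x else 0)"
    and pr_outside: "i \<notin> I \<Longrightarrow> pr i x = 0"
    and pr_finite: "finite {i. pr i x \<noteq> 0}"
    and pr_sum: "(\<Sum>i | pr i x \<noteq> 0. pr i x) = x"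
    and pr_diff: "pr (i + e) (\<delta> x) = \<delta> (pr i x)"
begin

lemma pr_0: "pr i 0 = 0" and pr_minus: "pr i (x - y) = pr i x - pr i y"
  and pr_sum_distrib: "pr i (sum g S) = (\<Sum>j\<in>S. pr i (g j))"
proof -
  have "additive (pr i)" by (simp add: additive_def pr_add)
  then show "pr i 0 = 0" "pr i (x - y) = pr i x - pr i y" "pr i (sum g S) = (\<Sum>j\<in>S. pr i (g j))"
    by (simp_all add: additive.zero additive.diff additive.sum)
qed

lemma index_add: "i \<in> I \<Longrightarrow> j \<in> I \<Longrightarrow> i + j \<in> I"
  using diff_index[of i "0 - j"] diff_index[OF zero_index, of j] by simp

text \<open>The linear extension of the map that sends a homogeneous vector to its class in the component of its own degree.\<close>

definition symbol :: "'b dg_alg \<Rightarrow> ('i \<Rightarrow> 'b set) \<Rightarrow> ('a \<Rightarrow> 'b) \<Rightarrow> 'a \<Rightarrow> 'i \<Rightarrow> 'b set" where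
  "symbol M N \<rho> v = (\<lambda>i\<in>I. N i +>\<^bsub>M\<^esub> \<rho> (pr i v))"

text \<open>The families \<open>H\<close> and \<open>N\<close> of subspaces of \<open>M\<close> define a graded object whose components are the images of \<open>H i\<close> in \<open>M / N i\<close>.
They are the images of families \<open>X\<close> and \<open>K\<close> on the original space, where \<open>K i\<close> is the full
preimage of \<open>N i\<close>. The condition that \<open>x - pr i x\<close> lies in \<open>K i\<close> says that modulo \<open>N i\<close> every element of \<open>H i\<close> is
represented by a vector homogeneous of degree \<open>i\<close>.\<close>

definition filtered :: "('a \<Rightarrow> 'b) \<Rightarrow> 'b dg_alg \<Rightarrow> 'a set \<Rightarrow> ('i \<Rightarrow> 'a set) \<Rightarrow> ('i \<Rightarrow> 'a set) \<Rightarrow>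
    ('i \<Rightarrow> 'b set) \<Rightarrow> ('i \<Rightarrow> 'b set) \<Rightarrow> bool" where
  "filtered \<rho> M L X K H N \<longleftrightarrow> quotient_map \<rho> M L \<and>
     (\<forall>i\<in>I. subspace (K i) \<and> L \<subseteq> K i \<and> H i = \<rho> ` X i \<and> N i = \<rho> ` K i \<and>
        range (pr i) \<subseteq> X i \<and> (\<forall>x\<in>X i. x - pr i x \<in> K i))"

definition symbol_kernel :: "('i \<Rightarrow> 'a set) \<Rightarrow> 'a set" where
  "symbol_kernel K = {v. \<forall>i\<in>I. pr i v \<in> K i}"

context
  fixes \<rho> :: "'a \<Rightarrow> 'b" and M L X K H N
  assumes filtered: "filtered \<rho> M L X K H N"
begin

lemma filteredD:
  shows "quotient_map \<rho> M L" "i \<in> I \<Longrightarrow> subspace (K i)" "i \<in> I \<Longrightarrow> L \<subseteq> K i"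
    "i \<in> I \<Longrightarrow> H i = \<rho> ` X i" "i \<in> I \<Longrightarrow> N i = \<rho> ` K i" "i \<in> I \<Longrightarrow> pr i x \<in> X i"
    "i \<in> I \<Longrightarrow> x \<in> X i \<Longrightarrow> x - pr i x \<in> K i"
  using filtered by (auto simp: filtered_def)

lemma coset_eq_pr:
  assumes "i \<in> I" "x \<in> X i"
  shows "N i +>\<^bsub>M\<^esub> \<rho> x = N i +>\<^bsub>M\<^esub> \<rho> (pr i x)"
  using assms by (simp add: filteredD(5) coset_eq_iff[OF filteredD(1-3)] filteredD(7))

lemma coset_eq_trivial:
  assumes "i \<in> I"
  shows "N i +>\<^bsub>M\<^esub> \<rho> x = N i \<longleftrightarrow> x \<in> K i"
  using coset_eq_iff[OF filteredD(1-3), OF assms assms, of x 0] assms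
  by (simp add: filteredD(5) coset_zero[OF filteredD(1)])

lemma symbol_support: "{i \<in> I. symbol M N \<rho> v i \<noteq> N i} = {i \<in> I. pr i v \<notin> K i}"
  by (auto simp: symbol_def coset_eq_trivial)

lemma symbol_support_finite: "finite {i \<in> I. pr i v \<notin> K i}"
  by (rule finite_subset[OF _ pr_finite[of v]]) (auto simp: subspace_0[OF filteredD(2)])

text \<open>A family with finite support is lifted to a vector by choosing homogeneous representatives of its finitely many
nontrivial components; the symbol of their sum is the given family.\<close>

lemma quotient_map_symbol:
  "quotient_map (symbol M N \<rho>) (gr_obj I e M H N) (symbol_kernel K)"
  unfolding quotient_map_def
proof (intro conjI allI)
  show "range (symbol M N \<rho>) = carrier (gr_obj I e M H N)"
  proof (intro equalityI subsetI)
    fix f assume "f \<in> range (symbol M N \<rho>)"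
    then obtain v where f: "f = symbol M N \<rho> v" by auto
    have "finite {i \<in> I. f i \<noteq> N i}" using symbol_support_finite symbol_support f by simp
    then show "f \<in> carrier (gr_obj I e M H N)"
      by (auto simp: f gr_obj_def symbol_def filteredD(4,6))
  next
    fix f assume "f \<in> carrier (gr_obj I e M H N)"
    then have f: "f \<in> (\<Pi>\<^sub>E i\<in>I. (\<lambda>x. N i +>\<^bsub>M\<^esub> x) ` H i)" and fin: "finite {i\<in>I. f i \<noteq> N i}"
      by (auto simp: gr_obj_def)
    have "\<exists>x. f i = N i +>\<^bsub>M\<^esub> \<rho> (pr i x)" if "i \<in> I" for i
    proof -
      have "f i \<in> (\<lambda>x. N i +>\<^bsub>M\<^esub> x) ` \<rho> ` X i" using f that filteredD(4)[OF that] by fastforce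
      then show ?thesis using coset_eq_pr[OF that] by auto
    qed
    then obtain x where x: "\<And>i. i \<in> I \<Longrightarrow> f i = N i +>\<^bsub>M\<^esub> \<rho> (pr i (x i))" by metis
    define v where "v = (\<Sum>i | i \<in> I \<and> f i \<noteq> N i. pr i (x i))"
    have "pr i v = (if f i \<noteq> N i then pr i (x i) else 0)" if "i \<in> I" for i
      using fin that by (simp add: v_def pr_sum_distrib pr_pr if_distrib sum.delta)
    then have "symbol M N \<rho> v i = f i" for i
      using f x by (cases "i \<in> I")
        (auto simp: symbol_def filteredD(5) coset_zero[OF filteredD(1)] PiE_def extensional_def)
    then show "f \<in> range (symbol M N \<rho>)" by (metis ext rangeI)
  qed
  show "symbol M N \<rho> x = symbol M N \<rho> y \<longleftrightarrow> x - y \<in> symbol_kernel K" for x y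
  proof -
    have "symbol M N \<rho> x = symbol M N \<rho> y \<longleftrightarrow> (\<forall>i\<in>I. N i +>\<^bsub>M\<^esub> \<rho> (pr i x) = N i +>\<^bsub>M\<^esub> \<rho> (pr i y))"
      by (auto simp: symbol_def fun_eq_iff restrict_def)
    also have "\<dots> \<longleftrightarrow> (\<forall>i\<in>I. pr i x - pr i y \<in> K i)"
      using coset_eq_iff[OF filteredD(1-3)] by (auto simp: filteredD(5))
    finally show ?thesis by (simp add: symbol_kernel_def pr_minus)
  qed
  show "symbol M N \<rho> (x + y) = symbol M N \<rho> x \<oplus>\<^bsub>gr_obj I e M H N\<^esub> symbol M N \<rho> y" for x y
    by (auto simp: symbol_def gr_obj_def fun_eq_iff restrict_def filteredD(5) pr_add
        coset_add[OF filteredD(1,2)])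
  show "symbol M N \<rho> 0 = \<zero>\<^bsub>gr_obj I e M H N\<^esub>"
    by (auto simp: symbol_def gr_obj_def fun_eq_iff restrict_def filteredD(5) pr_0
        coset_zero[OF filteredD(1)])
qed

lemma compatible_symbol:
  assumes "compatible \<rho> M" and "\<And>i x. i \<in> I \<Longrightarrow> x \<in> K i \<Longrightarrow> \<delta> x \<in> K (i + e)"
  shows "compatible (symbol M N \<rho>) (gr_obj I e M H N)"
proof -
  have "symbol M N \<rho> (scale c x) = c \<odot>\<^bsub>gr_obj I e M H N\<^esub> symbol M N \<rho> x" for c x
    by (auto simp: symbol_def gr_obj_def fun_eq_iff restrict_def filteredD(5) pr_scale
        coset_smult[OF filteredD(1-3) assms(1)])
  moreover have "symbol M N \<rho> (\<delta> x) = diff (gr_obj I e M H N) (symbol M N \<rho> x)" for x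
  proof
    fix i
    show "symbol M N \<rho> (\<delta> x) i = diff (gr_obj I e M H N) (symbol M N \<rho> x) i"
    proof (cases "i \<in> I")
      case True
      let ?j = "i - e"
      have j: "?j \<in> I" using True diff_index e_index by blast
      let ?S = "(N ?j +>\<^bsub>M\<^esub> \<rho> (pr ?j x)) \<inter> H ?j"
      have "(\<Union>z\<in>?S. N i +>\<^bsub>M\<^esub> diff M z) = N i +>\<^bsub>M\<^esub> \<rho> (\<delta> (pr ?j x))"
      proof (rule UN_constant_on)
        have "\<rho> (pr ?j x) \<in> ?S"
          using j filteredD(2)[OF j] by (auto simp: filteredD(4-6) coset_image[OF filteredD(1)] subspace_0)
        then show "?S \<noteq> {}" by blast
        fix z assume "z \<in> ?S"
        then obtain y where y: "z = \<rho> y" "y - pr ?j x \<in> K ?j"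
          using j by (auto simp: filteredD(5) coset_image[OF filteredD(1)])
        have "\<delta> y - \<delta> (pr ?j x) \<in> K i" using assms(2)[OF j y(2)] by (simp add: diff_minus)
        moreover have "diff M z = \<rho> (\<delta> y)" using assms(1) y(1) by (simp add: compatible_def)
        ultimately show "N i +>\<^bsub>M\<^esub> diff M z = N i +>\<^bsub>M\<^esub> \<rho> (\<delta> (pr ?j x))"
          using coset_eq_iff[OF filteredD(1-3), OF True True]
          by (simp add: filteredD(5)[OF True])
      qed
      then show ?thesis using True j pr_diff[of ?j x]
        by (simp add: symbol_def gr_obj_def)
    qed (simp add: symbol_def gr_obj_def)
  qed
  ultimately show ?thesis by (simp add: compatible_def)
qed

lemma gr_elem_symbol:
  assumes "i \<in> I" "x \<in> X i"
  shows "gr_elem I M N i (\<rho> x) = symbol M N \<rho> (pr i x)"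
  using assms coset_eq_pr[OF assms] 
  by (auto simp: gr_elem_def symbol_def fun_eq_iff restrict_def pr_pr filteredD(5) coset_zero[OF filteredD(1)])

end

lemma graded_product_pr:
  assumes "biadditive \<nu>" "\<And>i j u v. i \<in> I \<Longrightarrow> j \<in> I \<Longrightarrow> \<nu> (pr i u) (pr j v) \<in> range (pr (i + j))"
  shows "i \<in> I \<Longrightarrow> k \<in> I \<Longrightarrow> pr k (\<nu> (pr i u) v) = \<nu> (pr i u) (pr (k - i) v)"
    and "k \<in> I \<Longrightarrow> pr k (\<nu> u v) = (\<Sum>i | pr i u \<noteq> 0. \<nu> (pr i u) (pr (k - i) v))"
proof -
  note b = biadditiveD[OF assms(1)]
  show *: "pr k (\<nu> (pr i u) v) = \<nu> (pr i u) (pr (k - i) v)" if "i \<in> I" "k \<in> I" for i k u v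
  proof -
    have component: "pr k (\<nu> (pr i u) (pr j v)) = (if j = k - i then \<nu> (pr i u) (pr j v) else 0)"
      if j: "j \<in> I" for j
    proof -
      obtain w where w: "\<nu> (pr i u) (pr j v) = pr (i + j) w" using assms(2)[OF \<open>i \<in> I\<close> j] by auto
      show ?thesis by (auto simp: w pr_pr algebra_simps)
    qed
    have "{j. pr j v \<noteq> 0} \<subseteq> I" using pr_outside by auto
    then have "(\<Sum>j | pr j v \<noteq> 0. pr k (\<nu> (pr i u) (pr j v)))
        = (\<Sum>j | pr j v \<noteq> 0. if j = k - i then \<nu> (pr i u) (pr j v) else 0)"
      by (intro sum.cong) (auto simp: component)
    also have "\<dots> = \<nu> (pr i u) (pr (k - i) v)"
      using pr_finite[of v] by (auto simp: sum.delta b)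
    finally show ?thesis
      by (subst (1) pr_sum[of v, symmetric]) (simp add: b pr_sum_distrib)
  qed
  have "{j. pr j u \<noteq> 0} \<subseteq> I" using pr_outside by auto
  then have "(\<Sum>i | pr i u \<noteq> 0. pr k (\<nu> (pr i u) v)) = (\<Sum>i | pr i u \<noteq> 0. \<nu> (pr i u) (pr (k - i) v))"
    if "k \<in> I" by (intro sum.cong) (auto simp: * that)
  then show "k \<in> I \<Longrightarrow> pr k (\<nu> u v) = (\<Sum>i | pr i u \<noteq> 0. \<nu> (pr i u) (pr (k - i) v))"
    by (subst (1) pr_sum[of u, symmetric]) (simp add: b pr_sum_distrib)
qed

text \<open>The product \<open>\<mu>\<close> respects the filtration but not the grading; \<open>\<nu>\<close> is its leading term with respect to the grading,
so that in the associated graded object \<open>\<mu>\<close> and \<open>\<nu>\<close> induce the same product. The sets \<open>P i\<close> stand for the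
steps of the filtration and \<open>K i\<close> for the preceding steps.\<close>

lemma gr_bilinear_symbol:
  assumes f1: "filtered \<rho>\<^sub>1 M\<^sub>1 L\<^sub>1 X\<^sub>1 K H\<^sub>1 N\<^sub>1" and f2: "filtered \<rho>\<^sub>2 M\<^sub>2 L\<^sub>2 X\<^sub>2 K H\<^sub>2 N\<^sub>2"
    and f3: "filtered \<rho>\<^sub>3 M\<^sub>3 L\<^sub>3 X\<^sub>3 K H\<^sub>3 N\<^sub>3"
    and act: "\<And>u v. act (\<rho>\<^sub>1 u) (\<rho>\<^sub>2 v) = \<rho>\<^sub>3 (\<mu> u v)" and \<mu>: "biadditive \<mu>"
    and \<nu>: "biadditive \<nu>" "\<And>i j u v. i \<in> I \<Longrightarrow> j \<in> I \<Longrightarrow> \<nu> (pr i u) (pr j v) \<in> range (pr (i + j))"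
    and lead: "\<And>i j u v. i \<in> I \<Longrightarrow> j \<in> I \<Longrightarrow> \<mu> (pr i u) (pr j v) - \<nu> (pr i u) (pr j v) \<in> K (i + j)"
    and KP: "\<And>i. i \<in> I \<Longrightarrow> K i \<subseteq> P i" "\<And>i x. i \<in> I \<Longrightarrow> pr i x \<in> P i" "\<And>i. i \<in> I \<Longrightarrow> subspace (P i)"
    and low: "\<And>i j x y. i \<in> I \<Longrightarrow> j \<in> I \<Longrightarrow> x \<in> K i \<Longrightarrow> y \<in> P j \<Longrightarrow> \<mu> x y \<in> K (i + j)"
      "\<And>i j x y. i \<in> I \<Longrightarrow> j \<in> I \<Longrightarrow> x \<in> P i \<Longrightarrow> y \<in> K j \<Longrightarrow> \<mu> x y \<in> K (i + j)"
  shows "gr_bilinear I H\<^sub>1 N\<^sub>1 H\<^sub>2 M\<^sub>3 N\<^sub>3 act (symbol M\<^sub>1 N\<^sub>1 \<rho>\<^sub>1 u) (symbol M\<^sub>2 N\<^sub>2 \<rho>\<^sub>2 v)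
    = symbol M\<^sub>3 N\<^sub>3 \<rho>\<^sub>3 (\<nu> u v)"
proof
  fix k
  show "gr_bilinear I H\<^sub>1 N\<^sub>1 H\<^sub>2 M\<^sub>3 N\<^sub>3 act (symbol M\<^sub>1 N\<^sub>1 \<rho>\<^sub>1 u) (symbol M\<^sub>2 N\<^sub>2 \<rho>\<^sub>2 v) k
    = symbol M\<^sub>3 N\<^sub>3 \<rho>\<^sub>3 (\<nu> u v) k"
  proof (cases "k \<in> I")
    case k: True
    define S where "S = {i \<in> I. pr i u \<notin> K i}"
    define t where "t i = \<nu> (pr i u) (pr (k - i) v)" for i
    note sub = filteredD(2)[OF f3 k]
    have finS: "finite S" unfolding S_def using symbol_support_finite[OF f1] .
    have q: "quotient_map (\<lambda>x. N\<^sub>3 k +>\<^bsub>M\<^sub>3\<^esub> \<rho>\<^sub>3 x) (dg_quot M\<^sub>3 (N\<^sub>3 k)) (K k)"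
      using quotient_map_dg_quot[OF filteredD(1-3)[OF f3], OF k k] by (simp add: filteredD(5)[OF f3 k])
    have lead': "\<mu> (pr i u) (pr (k - i) v) - t i \<in> K k" if "i \<in> I" for i
      using lead[OF that diff_index[OF k that]] by (simp add: t_def)
    \<comment> \<open>The contribution of the components of degrees \<open>i\<close> and \<open>k - i\<close>.\<close>
    have inner: "(\<Union>x\<in>symbol M\<^sub>1 N\<^sub>1 \<rho>\<^sub>1 u i \<inter> H\<^sub>1 i. \<Union>y\<in>symbol M\<^sub>2 N\<^sub>2 \<rho>\<^sub>2 v (k - i) \<inter> H\<^sub>2 (k - i).
        N\<^sub>3 k +>\<^bsub>M\<^sub>3\<^esub> act x y) = N\<^sub>3 k +>\<^bsub>M\<^sub>3\<^esub> \<rho>\<^sub>3 (t i)" if i: "i \<in> I" for i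
    proof -
      have j: "k - i \<in> I" using diff_index[OF k i] .
      have x: "x \<in> P i" if "x - pr i u \<in> K i" for x
      proof -
        have "x - pr i u \<in> P i" using KP(1)[OF i] that by blast
        then show ?thesis using subspace_add[OF KP(3)[OF i] _ KP(2)[OF i, of u]] by fastforce
      qed
      have "(\<Union>x\<in>symbol M\<^sub>1 N\<^sub>1 \<rho>\<^sub>1 u i \<inter> H\<^sub>1 i. \<Union>y\<in>symbol M\<^sub>2 N\<^sub>2 \<rho>\<^sub>2 v (k - i) \<inter> H\<^sub>2 (k - i).
          N\<^sub>3 k +>\<^bsub>M\<^sub>3\<^esub> act x y) = N\<^sub>3 k +>\<^bsub>M\<^sub>3\<^esub> \<rho>\<^sub>3 (\<mu> (pr i u) (pr (k - i) v))"
        using i j k low(1)[OF i j _ KP(2)[OF j]] low(2)[OF i j x]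
        by (simp add: symbol_def filteredD(4,5)[OF f1] filteredD(4,5)[OF f2] filteredD(5)[OF f3]
            coset_action[OF filteredD(1-3)[OF f1] filteredD(1-3)[OF f2] filteredD(1-3)[OF f3] \<mu> act,
              OF i i j j k k] filteredD(6)[OF f1] filteredD(6)[OF f2])
      also have "\<dots> = N\<^sub>3 k +>\<^bsub>M\<^sub>3\<^esub> \<rho>\<^sub>3 (t i)"
        using quotient_mapD(2)[OF q] lead'[OF i] by simp
      finally show ?thesis .
    qed
    interpret Q: abelian_monoid "dg_quot M\<^sub>3 (N\<^sub>3 k)" using quotient_map_abelian_monoid[OF q] .
    have "gr_bilinear I H\<^sub>1 N\<^sub>1 H\<^sub>2 M\<^sub>3 N\<^sub>3 act (symbol M\<^sub>1 N\<^sub>1 \<rho>\<^sub>1 u) (symbol M\<^sub>2 N\<^sub>2 \<rho>\<^sub>2 v) k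
      = finsum (dg_quot M\<^sub>3 (N\<^sub>3 k)) (\<lambda>i. N\<^sub>3 k +>\<^bsub>M\<^sub>3\<^esub> \<rho>\<^sub>3 (t i)) S"
      using k unfolding gr_bilinear_def symbol_support[OF f1] S_def[symmetric]
      by (simp, intro Q.finsum_cong') (auto simp: S_def inner quotient_mapD(5)[OF q])
    also have "\<dots> = N\<^sub>3 k +>\<^bsub>M\<^sub>3\<^esub> \<rho>\<^sub>3 (\<Sum>i\<in>S. t i)"
      by (rule finsum_quotient_map[OF q finS])
    also have "\<dots> = N\<^sub>3 k +>\<^bsub>M\<^sub>3\<^esub> \<rho>\<^sub>3 (pr k (\<nu> u v))"
    proof -
      \<comment> \<open>The sum in the definition of the product omits the degrees in which the symbol of \<open>u\<close> vanishes;
      there \<open>pr i u\<close> lies in \<open>K i\<close> and contributes zero anyway.\<close>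
      let ?T = "{i. pr i u \<noteq> 0}"
      have ST: "S \<subseteq> ?T" unfolding S_def using subspace_0[OF filteredD(2)[OF f1]] by auto
      have TI: "?T \<subseteq> I" using pr_outside by auto
      have "pr k (\<nu> u v) - (\<Sum>i\<in>S. t i) = (\<Sum>i\<in>?T - S. t i)"
        using graded_product_pr(2)[OF \<nu> k, of u v] sum.subset_diff[OF ST pr_finite, of t]
        by (simp add: t_def)
      also have "\<dots> \<in> K k"
      proof (rule subspace_sum[OF sub])
        fix i assume "i \<in> ?T - S"
        then have i: "i \<in> I" "pr i u \<in> K i" using TI by (auto simp: S_def)
        have "\<mu> (pr i u) (pr (k - i) v) \<in> K k"
          using low(1)[OF i(1) diff_index[OF k i(1)] i(2) KP(2)[OF diff_index[OF k i(1)]]] by simp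
        then show "t i \<in> K k" using subspace_diff[OF sub _ lead'[OF i(1)]] by fastforce
      qed
      finally show ?thesis using quotient_mapD(2)[OF q] by metis
    qed
    finally show ?thesis using k by (simp add: symbol_def)
  qed (simp add: gr_bilinear_def symbol_def)
qed

end

context dg_graded_space
begin

text \<open>\<open>B\<close> and \<open>M\<close> are quotients by the same subspace \<open>L\<close> and carry filtrations by the images of the same subspaces.
So both associated graded objects are quotients by the same kernel, and \<^const>\<open>gr_map\<close> matches the symbols.
The bigraded parts are described through intersections \<open>\<pi> ` X \<inter> \<pi> ` Y\<close>, which a bijection respects.\<close>

lemma graded_iso:
  assumes fB: "filtered \<sigma> B L X K HB NB" "compatible \<sigma> B"
    and fM: "filtered \<pi> M L X K HM NM" "compatible \<pi> M"
    and h: "\<And>v. h (\<pi> v) = \<sigma> v"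
    and act: "\<And>u v. act (\<sigma> u) (\<pi> v) = \<pi> (\<nu> u v)" "\<And>u v. \<sigma> u \<otimes>\<^bsub>B\<^esub> \<sigma> v = \<sigma> (\<nu> u v)"
    and \<nu>: "biadditive \<nu>" "\<And>i j u v. i \<in> I \<Longrightarrow> j \<in> I \<Longrightarrow> \<nu> (pr i u) (pr j v) \<in> range (pr (i + j))"
    and \<delta>K: "\<And>i x. i \<in> I \<Longrightarrow> x \<in> K i \<Longrightarrow> \<delta> x \<in> K (i + e)"
    and KP: "\<And>i. i \<in> I \<Longrightarrow> K i \<subseteq> P i" "\<And>i x. i \<in> I \<Longrightarrow> pr i x \<in> P i" "\<And>i. i \<in> I \<Longrightarrow> subspace (P i)"
    and low: "\<And>i j x y. i \<in> I \<Longrightarrow> j \<in> I \<Longrightarrow> x \<in> K i \<Longrightarrow> y \<in> P j \<Longrightarrow> \<nu> x y \<in> K (i + j)"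
      "\<And>i j x y. i \<in> I \<Longrightarrow> j \<in> I \<Longrightarrow> x \<in> P i \<Longrightarrow> y \<in> K j \<Longrightarrow> \<nu> x y \<in> K (i + j)"
    and parts: "\<And>j. j \<in> J \<Longrightarrow> \<exists>i\<in>I. \<exists>Y. GM j = gr_elem I M NM i ` (HM i \<inter> \<pi> ` Y) \<and>
        GB j = gr_elem I B NB i ` (HB i \<inter> \<sigma> ` Y)"
  shows "dg_module_iso J (gr_obj I e B HB NB) GB (gr_obj I e M HM NM) GM
    (gr_bilinear I HB NB HM M NM act) (gr_map I B NB h)"
proof (rule dg_module_isoI)
  show "quotient_map (symbol M NM \<pi>) (gr_obj I e M HM NM) (symbol_kernel K)"
    "quotient_map (symbol B NB \<sigma>) (gr_obj I e B HB NB) (symbol_kernel K)"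
    using quotient_map_symbol fB fM by blast+
  show "compatible (symbol M NM \<pi>) (gr_obj I e M HM NM)"
    "compatible (symbol B NB \<sigma>) (gr_obj I e B HB NB)"
    using compatible_symbol[OF fM(1) fM(2) \<delta>K] compatible_symbol[OF fB(1) fB(2) \<delta>K] by blast+
  have lead: "\<nu> (pr i u) (pr j v) - \<nu> (pr i u) (pr j v) \<in> K (i + j)" if "i \<in> I" "j \<in> I" for i j u v
    using subspace_0[OF filteredD(2)[OF fM(1) index_add[OF that]]] by simp
  show "gr_bilinear I HB NB HM M NM act (symbol B NB \<sigma> u) (symbol M NM \<pi> v)
      = symbol M NM \<pi> (\<nu> u v)" for u v
    by (rule gr_bilinear_symbol[OF fB(1) fM(1) fM(1) act(1) \<nu>(1) \<nu> lead KP low])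
  have "gr_bilinear I HB NB HB B NB (monoid.mult B) (symbol B NB \<sigma> u) (symbol B NB \<sigma> v)
      = symbol B NB \<sigma> (\<nu> u v)" for u v
    by (rule gr_bilinear_symbol[OF fB(1) fB(1) fB(1) act(2) \<nu>(1) \<nu> lead KP low])
  then show "symbol B NB \<sigma> u \<otimes>\<^bsub>gr_obj I e B HB NB\<^esub> symbol B NB \<sigma> v = symbol B NB \<sigma> (\<nu> u v)" for u v
    by (simp add: gr_obj_def)
  show "gr_map I B NB h (symbol M NM \<pi> v) = symbol B NB \<sigma> v" for v
  proof
    fix i
    show "gr_map I B NB h (symbol M NM \<pi> v) i = symbol B NB \<sigma> v i"
    proof (cases "i \<in> I")
      case True
      have "(\<Union>z\<in>(\<pi> ` K i) +>\<^bsub>M\<^esub> \<pi> (pr i v). (\<sigma> ` K i) +>\<^bsub>B\<^esub> h z) = (\<sigma> ` K i) +>\<^bsub>B\<^esub> \<sigma> (pr i v)"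
        by (rule coset_union[OF filteredD(1-3)[OF fM(1)], OF True True])
          (simp add: h coset_eq_iff[OF filteredD(1-3)[OF fB(1)], OF True True])
      then show ?thesis
        using True by (simp add: gr_map_def symbol_def filteredD(5)[OF fM(1)] filteredD(5)[OF fB(1)])
    qed (simp add: gr_map_def symbol_def)
  qed
  show "\<exists>S. GM j = symbol M NM \<pi> ` S \<and> GB j = symbol B NB \<sigma> ` S" if "j \<in> J" for j
  proof -
    obtain i Y where i: "i \<in> I" and GM: "GM j = gr_elem I M NM i ` (HM i \<inter> \<pi> ` Y)"
      and GB: "GB j = gr_elem I B NB i ` (HB i \<inter> \<sigma> ` Y)" using parts[OF \<open>j \<in> J\<close>] by blast
    define Z where "Z = {x \<in> X i. \<exists>y\<in>Y. x - y \<in> L}"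
    have "\<pi> ` X i \<inter> \<pi> ` Y = \<pi> ` Z"
      unfolding Z_def quotient_mapD(2)[OF filteredD(1)[OF fM(1)], symmetric] by blast
    moreover have "\<sigma> ` X i \<inter> \<sigma> ` Y = \<sigma> ` Z"
      unfolding Z_def quotient_mapD(2)[OF filteredD(1)[OF fB(1)], symmetric] by blast
    ultimately have "HM i \<inter> \<pi> ` Y = \<pi> ` Z" "HB i \<inter> \<sigma> ` Y = \<sigma> ` Z"
      by (simp_all add: filteredD(4)[OF fM(1) i] filteredD(4)[OF fB(1) i])
    then have "GM j = (\<lambda>x. symbol M NM \<pi> (pr i x)) ` Z" "GB j = (\<lambda>x. symbol B NB \<sigma> (pr i x)) ` Z"
      unfolding GM GB using gr_elem_symbol[OF fM(1) i] gr_elem_symbol[OF fB(1) i]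
      by (auto simp: Z_def image_image)
    then show ?thesis by (intro exI[of _ "pr i ` Z"]) (simp add: image_image)
  qed
qed

end

context dg_graded_space
begin

lemma gr_elem_image:
  assumes "filtered \<rho> M L X K H N" "i \<in> I"
  shows "gr_elem I M N i ` H i = symbol M N \<rho> ` range (pr i)"
proof -
  note f = filteredD[OF assms(1)]
  have "gr_elem I M N i ` H i = (\<lambda>x. symbol M N \<rho> (pr i x)) ` X i"
    using gr_elem_symbol[OF assms] by (simp add: f(4)[OF assms(2)] image_image)
  also have "\<dots> = symbol M N \<rho> ` pr i ` X i" by (simp add: image_image)
  also have "pr i ` X i = range (pr i)"
  proof
    show "range (pr i) \<subseteq> pr i ` X i"
      using f(6)[OF assms(2)] pr_pr[of i i] by (metis (no_types, lifting) image_eqI image_subsetI)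
  qed auto
  finally show ?thesis .
qed

end

section \<open>Hasse derivatives and the series of (1 + e x)^h\<close>

text \<open>By truncation, a statement on residues holds trivially for series of sufficiently high order. Additivity then reduces
it from arbitrary Laurent series to monomials, where it is the corresponding statement on modes.\<close>

lemma fls_truncation_induct [case_names add monomial small]:
  fixes f :: "complex fls"
  assumes add: "\<And>f g. P f \<Longrightarrow> P g \<Longrightarrow> P (f + g)"
    and monomial: "\<And>m c. P (fls_shift (- m) (fls_const c))"
    and small: "\<exists>M::int. \<forall>f. (\<forall>n<M. f $$ n = 0) \<longrightarrow> P f"
  shows "P f"
proof -
  obtain M :: int where M: "\<And>f. (\<forall>n<M. f $$ n = 0) \<Longrightarrow> P f" using small by auto
  obtain N where N: "\<forall>n<N. f $$ n = 0" by (elim fls_nth_vanishes_belowE)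
  define r where "r = Abs_fls (\<lambda>n. if n < M then 0 else f $$ n)"
  have r: "r $$ n = (if n < M then 0 else f $$ n)" for n
    using N by (simp add: r_def nth_Abs_fls_lower_bound[of N])
  have sums: "P (\<Sum>n\<in>S. fls_shift (- n) (fls_const (f $$ n)))" if "finite S" for S
    using that by (induction S rule: finite_induct) (auto intro: add monomial M)
  have nth: "(\<Sum>n\<in>S. fls_shift (- n) (fls_const (f $$ n))) $$ k = (if k \<in> S then f $$ k else 0)"
    if "finite S" for S k
    using that by (induction S rule: finite_induct) auto
  have "f = (\<Sum>n\<in>{N..<M}. fls_shift (- n) (fls_const (f $$ n))) + r"
    using N by (intro fls_eqI) (auto simp: nth r)
  moreover have "P ((\<Sum>n\<in>{N..<M}. fls_shift (- n) (fls_const (f $$ n))) + r)"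
    by (intro add sums M) (auto simp: r)
  ultimately show ?thesis by simp
qed

lemma fls_mult_small:
  fixes f g :: "complex fls"
  assumes "\<And>n. n < a \<Longrightarrow> f $$ n = 0" "\<And>n. n < b \<Longrightarrow> g $$ n = 0" "n < a + b"
  shows "(f * g) $$ n = 0"
proof (cases "f = 0 \<or> g = 0")
  case False
  then have "a \<le> fls_subdegree f" "b \<le> fls_subdegree g"
    using assms(1,2) by (auto intro!: fls_subdegree_geI)
  then show ?thesis using assms(3) by (intro fls_times_nth_eq0) simp
qed auto

text \<open>The Hasse derivative \<open>f\<^bsup>(j)\<^esup> / j!\<close>, that is, the coefficient of \<open>t\<^sup>j\<close> in \<open>f (x + t)\<close>.\<close>

definition hasse :: "nat \<Rightarrow> complex fls \<Rightarrow> complex fls" where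
  "hasse j f = Abs_fls (\<lambda>n. f $$ (n + int j) * (of_int (n + int j) gchoose j))"

lemma hasse_nth [simp]: "hasse j f $$ n = f $$ (n + int j) * (of_int (n + int j) gchoose j)"
proof -
  obtain N where "\<forall>n<N. f $$ n = 0" by (elim fls_nth_vanishes_belowE)
  then show ?thesis by (simp add: hasse_def nth_Abs_fls_lower_bound[of "N - int j"])
qed

lemma hasse_add: "hasse j (f + g) = hasse j f + hasse j g"
  by (intro fls_eqI) (simp add: algebra_simps)

lemma hasse_monomial:
  "hasse j (fls_shift (- m) (fls_const c)) = fls_shift (int j - m) (fls_const (c * (of_int m gchoose j)))"
proof (rule fls_eqI)
  fix n
  show "hasse j (fls_shift (- m) (fls_const c)) $$ n
      = fls_shift (int j - m) (fls_const (c * (of_int m gchoose j))) $$ n"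
    by (cases "n = m - int j") auto
qed

text \<open>The Leibniz rule for \<open>x\<^sup>k f\<close>; on coefficients it is Vandermonde's identity.\<close>

lemma hasse_shift:
  "hasse j (fls_shift (- k) f) =
    (\<Sum>i\<le>j. fls_shift (int (j - i) - k) (fls_const (of_int k gchoose (j - i)) * hasse i f))"
proof (rule fls_eqI)
  fix n
  have coeff: "(\<Sum>i\<in>S. fls_shift (int (j - i) - k) (fls_const (of_int k gchoose (j - i)) * hasse i f)) $$ n
      = (\<Sum>i\<in>S. f $$ (n + int j - k) * ((of_int (n + int j - k) gchoose i) * (of_int k gchoose (j - i))))"
    if "finite S" "S \<subseteq> {..j}" for S
    using that by (induction S rule: finite_induct) (auto simp: algebra_simps of_nat_diff)
  have "(of_int (n + int j - k) + of_int k :: complex) = of_int (n + int j)" by simp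
  then have "(\<Sum>i\<le>j. (of_int (n + int j - k) gchoose i) * (of_int k gchoose (j - i)))
      = (of_int (n + int j) :: complex) gchoose j"
    using gbinomial_Vandermonde[of "of_int (n + int j - k) :: complex" "of_int k" j]
    by (simp only: atLeast0AtMost)
  then have "hasse j (fls_shift (- k) f) $$ n
      = (\<Sum>i\<le>j. f $$ (n + int j - k) * ((of_int (n + int j - k) gchoose i) * (of_int k gchoose (j - i))))"
    by (simp only: sum_distrib_left[symmetric]) (simp add: algebra_simps)
  then show "hasse j (fls_shift (- k) f) $$ n = (\<Sum>i\<le>j. fls_shift (int (j - i) - k)
      (fls_const (of_int k gchoose (j - i)) * hasse i f)) $$ n"
    by (simp only: coeff[OF finite_atMost subset_refl])
qed

text \<open>The series \<open>(1 + \<epsilon> x)\<^sup>h\<close>. It is \<open>1\<close> for \<open>\<epsilon> = 0\<close>.\<close>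

definition binomial_fls :: "complex \<Rightarrow> complex \<Rightarrow> complex fls" where
  "binomial_fls \<epsilon> h = fps_to_fls (Abs_fps (\<lambda>n. \<epsilon> ^ n * (h gchoose n)))"

lemma binomial_fls_nth:
  "binomial_fls \<epsilon> h $$ n = (if n < 0 then 0 else \<epsilon> ^ nat n * (h gchoose nat n))"
  by (simp add: binomial_fls_def)

lemma binomial_fls_0: "binomial_fls 0 h = 1"
  by (intro fls_eqI) (auto simp: binomial_fls_nth power_0_left)

lemma binomial_fls_mult: "binomial_fls \<epsilon> h * binomial_fls \<epsilon> k = binomial_fls \<epsilon> (h + k)"
proof -
  have "Abs_fps (\<lambda>n. \<epsilon> ^ n * (h gchoose n)) * Abs_fps (\<lambda>n. \<epsilon> ^ n * (k gchoose n))
      = Abs_fps (\<lambda>n. \<epsilon> ^ n * ((h + k) gchoose n))"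
  proof (rule fps_ext)
    fix n
    have "(\<Sum>i=0..n. \<epsilon> ^ i * (h gchoose i) * (\<epsilon> ^ (n - i) * (k gchoose (n - i))))
        = (\<Sum>i=0..n. \<epsilon> ^ n * ((h gchoose i) * (k gchoose (n - i))))"
      by (intro sum.cong) (auto simp: mult_ac simp flip: power_add)
    then show "(Abs_fps (\<lambda>n. \<epsilon> ^ n * (h gchoose n)) * Abs_fps (\<lambda>n. \<epsilon> ^ n * (k gchoose n))) $ n
        = Abs_fps (\<lambda>n. \<epsilon> ^ n * ((h + k) gchoose n)) $ n"
      by (simp add: fps_mult_nth gbinomial_Vandermonde flip: sum_distrib_left)
  qed
  then show ?thesis by (simp add: binomial_fls_def flip: fls_times_fps_to_fls)
qed

lemma binomial_fls_Suc:
  "binomial_fls \<epsilon> (h + 1) = binomial_fls \<epsilon> h + fls_const \<epsilon> * fls_shift (- 1) (binomial_fls \<epsilon> h)"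
proof (rule fls_eqI)
  fix n :: int
  consider "n < 0" | "n = 0" | k where "n = int (Suc k)" by (metis int_cases3 not_less_zero of_nat_0_less_iff
        neg_less_0_iff_less gr0_implies_Suc)
  then show "binomial_fls \<epsilon> (h + 1) $$ n
      = (binomial_fls \<epsilon> h + fls_const \<epsilon> * fls_shift (- 1) (binomial_fls \<epsilon> h)) $$ n"
    by cases (auto simp: binomial_fls_nth gbinomial_Suc_Suc algebra_simps nat_add_distrib
        gbinomial_Suc_Suc[of h, unfolded add.commute[of h 1]])
qed

lemma hasse_binomial_fls:
  "hasse j (binomial_fls \<epsilon> h) = fls_const (\<epsilon> ^ j * (h gchoose j)) * binomial_fls \<epsilon> (h - of_nat j)"
proof (rule fls_eqI)
  fix n :: int
  show "hasse j (binomial_fls \<epsilon> h) $$ n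
      = (fls_const (\<epsilon> ^ j * (h gchoose j)) * binomial_fls \<epsilon> (h - of_nat j)) $$ n"
  proof (cases "n < 0")
    case True
    show ?thesis
    proof (cases "n + int j < 0")
      case False
      then obtain m where m: "n + int j = int m" by (metis nonneg_int_cases not_less)
      have "m < j" using True m by simp
      then have "(of_nat m :: complex) gchoose j = 0" by (simp flip: binomial_gbinomial)
      then show ?thesis using True m by (simp add: binomial_fls_nth)
    qed (use True in \<open>simp add: binomial_fls_nth\<close>)
  next
    case False
    then obtain m where m: "n = int m" by (metis nonneg_int_cases not_less)
    have "(h gchoose (m + j)) * ((of_nat m + of_nat j) gchoose j) = (h gchoose j) * ((h - of_nat j) gchoose m)"
      using gbinomial_trinomial_revision[of j "m + j" h] by simp
    then show ?thesis by (simp add: m binomial_fls_nth nat_add_distrib power_add algebra_simps)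
  qed
qed

lemma fls_deriv_binomial_fls:
  "fls_deriv (binomial_fls \<epsilon> (h + 1)) = fls_const ((h + 1) * \<epsilon>) * binomial_fls \<epsilon> h"
proof (rule fls_eqI)
  fix n :: int
  show "fls_deriv (binomial_fls \<epsilon> (h + 1)) $$ n = (fls_const ((h + 1) * \<epsilon>) * binomial_fls \<epsilon> h) $$ n"
  proof (cases "n < 0")
    case True
    then consider "n = -1" | "n < -1" by linarith
    then show ?thesis using True by cases (auto simp: binomial_fls_nth)
  next
    case False
    then obtain m where m: "n = int m" by (metis nonneg_int_cases not_less)
    show ?thesis using gbinomial_absorption[of m "h + 1"]
      by (simp add: m binomial_fls_nth nat_add_distrib algebra_simps)
  qed
qed

section \<open>Degrees and weights\<close>

lemma half_ints_int [simp]: "of_int n \<in> half_ints"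
  unfolding half_ints_def by (rule image_eqI[of _ _ "2 * n"]) simp_all

lemma half_ints_simps [simp]: "0 \<in> half_ints" "1 \<in> half_ints" "2 \<in> half_ints" "of_nat m \<in> half_ints"
  using half_ints_int[of 0] half_ints_int[of 1] half_ints_int[of 2] half_ints_int[of "int m"] by simp_all

lemma half_ints_diff [simp]: "a \<in> half_ints \<Longrightarrow> b \<in> half_ints \<Longrightarrow> a - b \<in> half_ints"
  unfolding half_ints_def by (auto simp: image_iff) (metis diff_divide_distrib of_int_diff)

lemma half_ints_add [simp]: "a \<in> half_ints \<Longrightarrow> b \<in> half_ints \<Longrightarrow> a + b \<in> half_ints"
  using half_ints_diff[of a "0 - b"] half_ints_diff[of 0 b] by simp

text \<open>The step of a weight filtration that precedes weight \<open>n\<close> is the one of weight \<open>n - 1/2\<close>.\<close>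

lemma less_half_ints: "m \<in> half_ints \<Longrightarrow> n \<in> half_ints \<Longrightarrow> m \<le> n - 1/2 \<longleftrightarrow> m < n"
proof -
  assume "m \<in> half_ints" "n \<in> half_ints"
  then obtain a b :: int where ab: "m = of_int a / 2" "n = of_int b / 2" by (auto simp: half_ints_def)
  have "m \<le> n - 1/2 \<longleftrightarrow> (of_int a :: rat) \<le> of_int (b - 1)" by (simp add: ab field_simps)
  also have "\<dots> \<longleftrightarrow> a < b" unfolding of_int_le_iff by auto
  also have "\<dots> \<longleftrightarrow> m < n" by (simp add: ab field_simps)
  finally show ?thesis .
qed

lemma half_mem [simp]: "1/2 \<in> half_ints"
  unfolding half_ints_def by (rule image_eqI[of _ _ 1]) simp_all

context dg_vertex_algebra
begin

context
  fixes I :: "'i set" and X :: "'i \<Rightarrow> 'a set"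
  assumes direct: "internal_direct_sum V I X"
begin

lemma component_unique: "decomposes I X v c \<Longrightarrow> component I X i v = c i"
  using direct unfolding internal_direct_sum_def component_def by (metis the1_equality)

lemma decomposes_component: "decomposes I X v (\<lambda>i. component I X i v)"
  using direct component_unique unfolding internal_direct_sum_def by (metis ext)

lemma component_simps:
  shows component_mem: "i \<in> I \<Longrightarrow> component I X i v \<in> X i"
    and component_outside: "i \<notin> I \<Longrightarrow> component I X i v = 0"
    and component_finite: "finite {i. component I X i v \<noteq> 0}"
    and component_sum: "(\<Sum>i | component I X i v \<noteq> 0. component I X i v) = v"
  using decomposes_component[of v] by (auto simp: decomposes_def)

lemma part_subspace: "i \<in> I \<Longrightarrow> subspace (X i)"
  using direct by (auto simp: internal_direct_sum_def)

lemma decomposesI: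
  assumes "\<And>i. i \<in> I \<Longrightarrow> c i \<in> X i" "\<And>i. i \<notin> I \<Longrightarrow> c i = 0" "finite S" "\<And>i. i \<notin> S \<Longrightarrow> c i = 0" "sum c S = v"
  shows "decomposes I X v c"
proof -
  have "sum c {i. c i \<noteq> 0} = sum c S"
    using assms(3,4) by (intro sum.mono_neutral_left) auto
  moreover have "finite {i. c i \<noteq> 0}" using assms(3,4) by (metis (mono_tags) finite_subset mem_Collect_eq subsetI)
  ultimately show ?thesis using assms by (simp add: decomposes_def)
qed

lemma component_add: "component I X i (u + v) = component I X i u + component I X i v"
proof (rule component_unique, rule decomposesI)
  let ?S = "{i. component I X i u \<noteq> 0} \<union> {i. component I X i v \<noteq> 0}"
  show "finite ?S" using component_finite by simp
  have "sum (\<lambda>i. component I X i w) ?S = w" if "w \<in> {u, v}" for w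
  proof -
    have "sum (\<lambda>i. component I X i w) ?S = sum (\<lambda>i. component I X i w) {i. component I X i w \<noteq> 0}"
      by (rule sum.mono_neutral_right) (use that component_finite in auto)
    then show ?thesis by (simp add: component_sum)
  qed
  then show "(\<Sum>i\<in>?S. component I X i u + component I X i v) = u + v"
    by (simp add: sum.distrib)
qed (auto simp: component_mem component_outside intro: subspace_add[OF part_subspace])

lemma component_scale: "component I X i (scl V a u) = scl V a (component I X i u)"
proof (rule component_unique, rule decomposesI)
  show "finite {i. component I X i u \<noteq> 0}" using component_finite by simp
  show "(\<Sum>i | component I X i u \<noteq> 0. scl V a (component I X i u)) = scl V a u"
    by (simp add: component_sum flip: scale_sum_right)
qed (auto simp: component_mem component_outside intro: subspace_scale[OF part_subspace])

lemma component_of_homogeneous: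
  assumes "i \<in> I" "v \<in> X i"
  shows "component I X j v = (if j = i then v else 0)"
  by (rule component_unique[of v "\<lambda>j. if j = i then v else 0"], rule decomposesI[where S = "{i}"])
    (use assms in \<open>auto intro: subspace_0[OF part_subspace]\<close>)

lemma component_component: "component I X i (component I X j v) = (if i = j then component I X i v else 0)"
proof (cases "j \<in> I")
  case True
  show ?thesis using component_of_homogeneous[OF True component_mem[OF True, of v], of i] by auto
next
  case False
  then show ?thesis using component_outside component_scale[of i 0 0] by auto
qed

lemma component_range: "i \<in> I \<Longrightarrow> range (component I X i) = X i"
  using component_mem component_of_homogeneous[of i _ i] by (auto simp: image_iff) metis

lemma component_zero: "component I X i 0 = 0"
  using component_scale[of i 0 0] by simp

lemma homogeneous_induct:
  assumes "P 0" "\<And>i v. i \<in> I \<Longrightarrow> v \<in> X i \<Longrightarrow> P v" "\<And>x y. P x \<Longrightarrow> P y \<Longrightarrow> P (x + y)"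
  shows "P v"
proof -
  have "P (\<Sum>i\<in>S. component I X i v)" if "finite S" for S
    using that
  proof (induction S rule: finite_induct)
    case (insert i S)
    then show ?case
      by (cases "i \<in> I") (auto simp: component_outside intro!: assms component_mem)
  qed (simp add: assms)
  then show ?thesis using component_sum[of v] component_finite[of v] by metis
qed

end

text \<open>A homogeneous map permutes the components; the components of \<open>T v\<close> are found by linearity from homogeneous \<open>v\<close>.\<close>

lemma component_map:
  fixes I :: "'i::ab_group_add set"
  assumes "internal_direct_sum V I X" "additive T"
    and "\<And>i v. i \<in> I \<Longrightarrow> v \<in> X i \<Longrightarrow> T v \<in> X (i + e)" "\<And>i. i + e \<in> I \<longleftrightarrow> i \<in> I"
  shows "component I X (i + e) (T v) = T (component I X i v)"
proof (induction v rule: homogeneous_induct[OF assms(1)])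
  case 1
  show ?case by (simp add: additive.zero[OF assms(2)] component_zero[OF assms(1)])
next
  case (2 j v)
  then show ?case
    using component_of_homogeneous[OF assms(1) _ assms(3), OF _ 2] assms(4) additive.zero[OF assms(2)]
    by (simp add: component_of_homogeneous[OF assms(1) 2])
next
  case (3 x y)
  then show ?case by (simp add: additive.add[OF assms(2)] component_add[OF assms(1)])
qed

lemma mode_additive:
  "additive (\<lambda>u. mode V u n v)" "additive (mode V u n)" "additive (dV V)"
  and mode_scale: "mode V (scl V c u) n v = scl V c (mode V u n v)"
    "mode V u n (scl V c v) = scl V c (mode V u n v)"
  and d_scale: "dV V (scl V c v) = scl V c (dV V v)"
proof -
  interpret l: Vector_Spaces.linear "scl V" "scl V" "\<lambda>u. mode V u n v" by (rule mode_linear_left)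
  interpret r: Vector_Spaces.linear "scl V" "scl V" "mode V u n" by (rule mode_linear_right)
  interpret d: Vector_Spaces.linear "scl V" "scl V" "dV V" by (rule d_linear)
  show "additive (\<lambda>u. mode V u n v)" "additive (mode V u n)" "additive (dV V)"
    by (auto simp: additive_def l.add r.add d.add)
  show "mode V (scl V c u) n v = scl V c (mode V u n v)" by (rule l.scale)
  show "mode V u n (scl V c v) = scl V c (mode V u n v)" by (rule r.scale)
  show "dV V (scl V c v) = scl V c (dV V v)" by (rule d.scale)
qed

lemmas mode_simps =
  additive.add[OF mode_additive(1)] additive.add[OF mode_additive(2)]
  additive.zero[OF mode_additive(1)] additive.zero[OF mode_additive(2)]
  additive.diff[OF mode_additive(1)] additive.diff[OF mode_additive(2)]
  additive.sum[OF mode_additive(1)] additive.sum[OF mode_additive(2)]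
lemmas d_simps = additive.add[OF mode_additive(3)] additive.zero[OF mode_additive(3)]
  additive.diff[OF mode_additive(3)] additive.sum[OF mode_additive(3)]

end

context dg_vertex_operator_algebra
begin

lemma Vdeg_subspace: "subspace (Vdeg V p)" using part_subspace[OF degree_decomposition] by simp
lemma Vwt_subspace: "n \<in> half_ints \<Longrightarrow> subspace (Vwt V n)" using part_subspace[OF weight_decomposition] by simp

lemma Lop_0: "Lop V 0 = mode V (conf V) 1" and Lop_minus_1: "Lop V (-1) = mode V (conf V) 0"
  by (simp_all add: Lop_def)

text \<open>The degree and the weight gradings are compatible because \<open>L(0) = \<omega>\<^sub>1\<close> has degree \<open>4 - 2 - 2 = 0\<close>.\<close>

lemma deg_part_Vwt:
  assumes "v \<in> Vwt V n"
  shows "deg_part V p v \<in> Vwt V n"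
proof -
  have "Lop V 0 (deg_part V p v) = deg_part V p (Lop V 0 v)"
    using component_map[OF degree_decomposition mode_additive(2), of "conf V" 1 0 p v] mode_degree[OF conf_degree, of _ _ 1]
    by (simp add: Lop_0)
  then show ?thesis using assms by (simp add: Vwt_def component_scale[OF degree_decomposition])
qed

lemma deg_part_wt_part: "deg_part V p (wt_part V n v) = wt_part V n (deg_part V p v)"
proof -
  have "additive (deg_part V p)" by (simp add: additive_def component_add[OF degree_decomposition])
  from component_map[OF weight_decomposition this, of 0 n v] show ?thesis by (simp add: deg_part_Vwt)
qed

lemma d_Vwt: "v \<in> Vwt V n \<Longrightarrow> dV V v \<in> Vwt V n"
  using d_mode[OF conf_degree, of 1 v]
  by (simp add: d_conf mode_simps Vwt_def Lop_0 d_scale)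

lemma wt_part_d: "wt_part V n (dV V v) = dV V (wt_part V n v)"
  using component_map[OF weight_decomposition mode_additive(3), of 0 n v] by (simp add: d_Vwt)

lemma deg_part_d: "deg_part V (p + 1) (dV V v) = dV V (deg_part V p v)"
  by (rule component_map[OF degree_decomposition mode_additive(3)]) (simp_all add: d_degree)

lemma bihomogeneous_induct [case_names zero bi add]:
  assumes "P 0" "\<And>p n v. n \<in> half_ints \<Longrightarrow> v \<in> Vbi V p n \<Longrightarrow> P v" "\<And>x y. P x \<Longrightarrow> P y \<Longrightarrow> P (x + y)"
  shows "P v"
proof (induction v rule: homogeneous_induct[OF weight_decomposition])
  case (2 n w)
  have "w \<in> Vwt V n \<longrightarrow> P w"
  proof -
    have "P (\<Sum>p\<in>S. deg_part V p w)" if "finite S" "w \<in> Vwt V n" for S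
      using that(1)
    proof (induction S rule: finite_induct)
      case (insert p S)
      have "deg_part V p w \<in> Vbi V p n"
        using that(2) by (simp add: Vbi_def component_mem[OF degree_decomposition] deg_part_Vwt)
      then show ?case using insert assms(3) assms(2)[OF 2(1)] by simp
    qed (simp add: assms(1))
    then show ?thesis using component_sum[OF degree_decomposition, of w] component_finite[OF degree_decomposition, of w] by metis
  qed
  then show ?case using 2 by simp
qed (auto intro: assms)

text \<open>The rule \<open>Y(L(-1) v, x) = d/dx Y(v, x)\<close>. Since \<open>L(-1) v = v\<^sub>-\<^sub>2 \<one>\<close>, it is the Jacobi identity for \<open>v\<close> and the
vacuum with \<open>l = -2\<close> and \<open>m = 0\<close>.\<close>

lemma L_minus_1_mode: "mode V (Lop V (-1) v) n w = scl V (of_int (- n)) (mode V v (n - 1) w)"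
proof (induction v rule: homogeneous_induct[OF degree_decomposition])
  case (2 p v)
  define g where "g i = scl V ((-1) ^ i * (of_int (-2) gchoose i))
            (mode V v (0 + (-2) - int i) (mode V (vac V) (n + int i) w)
              - scl V ((-1) powi (-2) * (-1) powi (p * 0))
                  (mode V (vac V) (n + (-2) - int i) (mode V v (0 + int i) w)))" for i
  have coeff: "(-1) ^ i * ((-2 :: complex) gchoose i) = of_nat (i + 1)" for i
    using gbinomial_minus[of "2::complex" i] by (simp add: binomial_gbinomial[symmetric] add_ac
      flip: power_mult_distrib binomial_gbinomial of_nat_Suc)
  have "Sum_any g = Sum_any (\<lambda>i::nat. scl V (of_int 0 gchoose i)
              (mode V (mode V v (-2 + int i) (vac V)) (0 + n - int i) w))"
    unfolding g_def by (rule jacobi[OF 2(2) vac_degree])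
  also have "\<dots> = Sum_any (\<lambda>i::nat. if i = 0 then mode V (mode V v (-2) (vac V)) n w else 0)"
    by (intro Sum_any.cong) (auto simp: gbinomial_0(2) gr0_conv_Suc)
  also have "\<dots> = mode V (Lop V (-1) v) n w"
    by (simp add: L_minus_one)
  finally have "mode V (Lop V (-1) v) n w = Sum_any g" by simp
  \<comment> \<open>A mode of the vacuum is nonzero only for the index \<open>-1\<close>, so one of the two halves of one summand survives:
  the first half for \<open>n \<le> -1\<close>, the second for \<open>n \<ge> 1\<close>. For \<open>n = 0\<close> both sides vanish, because of the
  factor \<open>n\<close>.\<close>
  also have "Sum_any g = Sum_any (\<lambda>i. if i = nat (if n \<le> -1 then - 1 - n else n - 1)
      then scl V (of_int (- n)) (mode V v (n - 1) w) else 0)"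
  proof (intro Sum_any.cong)
    fix i
    show "g i = (if i = nat (if n \<le> -1 then - 1 - n else n - 1)
      then scl V (of_int (- n)) (mode V v (n - 1) w) else 0)"
      unfolding g_def using coeff[of i]
      by (auto simp: vac_mode mode_simps scale_minus_left algebra_simps)
  qed
  finally show ?case by simp
qed (simp_all add: mode_simps Lop_minus_1 scale_right_distrib)

lemma L_minus_1_degree: "v \<in> Vdeg V p \<Longrightarrow> Lop V (-1) v \<in> Vdeg V (p + 2)"
  using mode_degree[OF conf_degree, of v p 0] by (simp add: Lop_minus_1)

lemma L_minus_1_weight: "v \<in> Vwt V h \<Longrightarrow> Lop V (-1) v \<in> Vwt V (h + 1)"
proof -
  assume v: "v \<in> Vwt V h"
  obtain c where "\<And>m n v. Lop V m (Lop V n v) - Lop V n (Lop V m v) =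
          scl V (of_int (m - n)) (Lop V (m + n) v)
          + scl V (1 / 12 * of_int (m ^ 3 - m) * (if m + n = 0 then 1 else 0) * c) v"
    using virasoro by auto
  from this[of 0 "-1" v] show ?thesis
    using v by (simp add: Vwt_def Lop_minus_1 mode_scale scale_left_distrib of_rat_add algebra_simps)
qed

text \<open>The Jacobi identity with \<open>l = 0\<close> and \<open>m = 1\<close> is the commutator formula for \<open>L(0) = \<omega>\<^sub>1\<close> and \<open>v\<^sub>n\<close>. Its right hand side is
\<open>(L(-1) v)\<^bsub>n+1\<^esub> + (L(0) v)\<^sub>n\<close>.\<close>

lemma mode_weight:
  assumes "v \<in> Vwt V h" "w \<in> Vwt V k"
  shows "mode V v n w \<in> Vwt V (h + k - of_int n - 1)"
proof -
  have "Lop V 0 (mode V v n w) - mode V v n (Lop V 0 w)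
    = mode V (Lop V (-1) v) (n + 1) w + mode V (Lop V 0 v) n w" for v w
  proof (induction v rule: homogeneous_induct[OF degree_decomposition])
    case (2 q v)
    define g where "g i = scl V ((-1) ^ i * (of_int 0 gchoose i))
            (mode V (conf V) (1 + 0 - int i) (mode V v (n + int i) w)
              - scl V ((-1) powi 0 * (-1) powi (4 * q))
                  (mode V v (n + 0 - int i) (mode V (conf V) (1 + int i) w)))" for i
    define r where "r i = scl V (of_int 1 gchoose i)
              (mode V (mode V (conf V) (0 + int i) v) (1 + n - int i) w)" for i
    have sign: "((-1)::complex) powi (4 * q) = 1" by (simp add: power_int_mult)
    have "g = (\<lambda>i. if i = 0 then Lop V 0 (mode V v n w) - mode V v n (Lop V 0 w) else 0)"
      by (rule ext) (auto simp: g_def Lop_0 sign gbinomial_0(2) gr0_conv_Suc)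
    then have "Lop V 0 (mode V v n w) - mode V v n (Lop V 0 w) = Sum_any g" by simp
    also have "\<dots> = Sum_any r"
      unfolding g_def r_def by (rule jacobi[OF conf_degree 2(2)])
    also have "\<dots> = sum r {0, 1}"
    proof (rule Sum_any.expand_superset)
      have "r i = 0" if "i \<notin> {0, 1}" for i
      proof -
        have "(1 :: complex) gchoose i = 0"
          using that binomial_gbinomial[of 1 i, where 'a = complex] by (simp add: binomial_eq_0)
        then show ?thesis by (simp add: r_def)
      qed
      then show "{i. r i \<noteq> 0} \<subseteq> {0, 1}" by blast
    qed simp
    finally show ?case by (simp add: r_def Lop_0 Lop_minus_1 add.commute)
  next
    case (3 x y)
    then show ?case by (simp add: mode_simps Lop_minus_1 Lop_0 add_diff_add add_ac)
  qed (simp add: mode_simps Lop_minus_1 Lop_0)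
  from this[of v w] show ?thesis
    using assms by (simp add: Vwt_def mode_scale L_minus_1_mode of_rat_add of_rat_diff scale_left_distrib
        algebra_simps)
qed

lemma mode_Vbi:
  assumes "u \<in> Vbi V p h" "v \<in> Vbi V q k"
  shows "mode V u n v \<in> Vbi V (p + q - 2 * n - 2) (h + k - of_int n - 1)"
  using assms mode_degree[of u p v q n] mode_weight[of u h v k n] by (simp add: Vbi_def algebra_simps)

end

section \<open>The Jacobi identity for residues\<close>

context dg_vertex_algebra
begin

text \<open>The coefficient of \<open>x\<^sup>-\<^sup>1\<close> in \<open>f(x) Y(u, x) v\<close>.\<close>

definition residue :: "complex fls \<Rightarrow> 'a \<Rightarrow> 'a \<Rightarrow> 'a" where
  "residue f u v = Sum_any (\<lambda>n. scl V (f $$ n) (mode V u n v))"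

lemma residue_eq_0:
  assumes "\<And>n. f $$ n = 0 \<or> mode V u n v = 0"
  shows "residue f u v = 0"
proof -
  have "scl V (f $$ n) (mode V u n v) = 0" for n using assms[of n] by auto
  then show ?thesis unfolding residue_def by (simp only: Sum_any.neutral)
qed

lemma residue_support: "finite {n. scl V (f $$ n) (mode V u n v) \<noteq> 0}"
proof -
  obtain A where A: "\<forall>n<A. f $$ n = 0" by (elim fls_nth_vanishes_belowE)
  obtain B where B: "\<forall>n\<ge>B. mode V u n v = 0" using truncation by blast
  have "{n. scl V (f $$ n) (mode V u n v) \<noteq> 0} \<subseteq> {A..<B}"
    using A B by (force simp: not_less[symmetric])
  then show ?thesis by (rule finite_subset) simp
qed

lemma residue_add:
  "residue (f + g) u v = residue f u v + residue g u v"
  "residue f (u + u') v = residue f u v + residue f u' v"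
  "residue f u (v + v') = residue f u v + residue f u v'"
  unfolding residue_def Sum_any.distrib[OF residue_support residue_support, symmetric]
  by (simp_all add: mode_simps scale_left_distrib scale_right_distrib)

lemma residue_additive: "additive (\<lambda>f. residue f u v)" "additive (\<lambda>u. residue f u v)" "additive (residue f u)"
  by (simp_all add: additive_def residue_add)

lemmas residue_simps = residue_add
  additive.zero[OF residue_additive(1)] additive.zero[OF residue_additive(2)] additive.zero[OF residue_additive(3)]
  additive.minus[OF residue_additive(1)]
  additive.diff[OF residue_additive(1)] additive.diff[OF residue_additive(2)] additive.diff[OF residue_additive(3)]
  additive.sum[OF residue_additive(1)] additive.sum[OF residue_additive(2)] additive.sum[OF residue_additive(3)]

lemma Sum_any_scale:
  assumes "finite {n. g n \<noteq> 0}"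
  shows "Sum_any (\<lambda>n. scl V c (g n)) = scl V c (Sum_any g)"
proof -
  have "Sum_any (\<lambda>n. scl V c (g n)) = (\<Sum>n | g n \<noteq> 0. scl V c (g n))"
    using assms by (intro Sum_any.expand_superset) auto
  then show ?thesis by (simp add: Sum_any.expand_set scale_sum_right)
qed

lemma residue_scale:
  "residue (fls_const c * f) u v = scl V c (residue f u v)"
  "residue f (scl V c u) v = scl V c (residue f u v)"
  "residue f u (scl V c v) = scl V c (residue f u v)"
proof -
  show "residue (fls_const c * f) u v = scl V c (residue f u v)"
    by (simp add: residue_def Sum_any_scale[OF residue_support, symmetric])
  show "residue f (scl V c u) v = scl V c (residue f u v)" "residue f u (scl V c v) = scl V c (residue f u v)"
    by (simp_all add: residue_def mode_scale Sum_any_scale[OF residue_support, symmetric] mult.commute)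
qed

lemma residue_monomial: "residue (fls_shift (- m) (fls_const c)) u v = scl V c (mode V u m v)"
proof -
  have "residue (fls_shift (- m) (fls_const c)) u v = (\<Sum>n\<in>{m}. scl V (fls_shift (- m) (fls_const c) $$ n) (mode V u n v))"
    unfolding residue_def by (rule Sum_any.expand_superset) auto
  then show ?thesis by simp
qed

lemma residue_one: "residue (fls_shift (- m) 1) u v = mode V u m v"
  using residue_monomial[of m 1] by simp

lemma residue_mem:
  assumes "subspace W" "\<And>n. f $$ n \<noteq> 0 \<Longrightarrow> mode V u n v \<in> W"
  shows "residue f u v \<in> W"
  unfolding residue_def Sum_any.expand_set
  by (rule subspace_sum[OF assms(1)]) (use assms in \<open>auto intro: subspace_scale\<close>)

lemma d_residue:
  assumes "u \<in> Vdeg V p"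
  shows "dV V (residue f u v) = residue f (dV V u) v + scl V ((-1) powi p) (residue f u (dV V v))"
proof -
  have d_sum: "dV V (Sum_any g) = Sum_any (\<lambda>n::int. dV V (g n))" if "finite {n. g n \<noteq> 0}" for g
  proof -
    have "Sum_any (\<lambda>n. dV V (g n)) = (\<Sum>n | g n \<noteq> 0. dV V (g n))"
      using that by (intro Sum_any.expand_superset) (auto simp: d_simps)
    then show ?thesis by (simp add: Sum_any.expand_set d_simps)
  qed
  have "dV V (residue f u v) = Sum_any (\<lambda>n. dV V (scl V (f $$ n) (mode V u n v)))"
    unfolding residue_def by (rule d_sum[OF residue_support])
  also have "\<dots> = Sum_any (\<lambda>n. scl V (f $$ n) (mode V (dV V u) n v)
      + scl V ((-1) powi p) (scl V (f $$ n) (mode V u n (dV V v))))"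
    by (intro Sum_any.cong)
      (simp add: d_scale d_mode[OF assms] scale_right_diff_distrib mult.commute)
  also have "\<dots> = residue f (dV V u) v + Sum_any (\<lambda>n. scl V ((-1) powi p) (scl V (f $$ n) (mode V u n (dV V v))))"
    unfolding residue_def
    by (rule Sum_any.distrib[OF residue_support], rule finite_subset[OF _ residue_support[of f u "dV V v"]]) auto
  also have "Sum_any (\<lambda>n. scl V ((-1) powi p) (scl V (f $$ n) (mode V u n (dV V v))))
      = scl V ((-1) powi p) (residue f u (dV V v))"
    unfolding residue_def by (rule Sum_any_scale[OF residue_support])
  finally show ?thesis .
qed

lemma truncation_uniform: "\<exists>N. \<forall>i<(m::nat). \<forall>n\<ge>N. mode V (x i) n (y i) = 0"
proof (induction m)
  case (Suc m)
  then obtain N where "\<forall>i<m. \<forall>n\<ge>N. mode V (x i) n (y i) = 0" by auto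
  moreover obtain N' where "\<forall>n\<ge>N'. mode V (x m) n (y m) = 0" using truncation by blast
  ultimately have "\<forall>i<Suc m. \<forall>n\<ge>max N N'. mode V (x i) n (y i) = 0" by (auto simp: less_Suc_eq)
  then show ?case by blast
qed auto

text \<open>The inner residue vanishes for all but finitely many \<open>i\<close>, independently of \<open>f\<close>; for the remaining ones truncation gives a
common bound on the order of \<open>f\<close>.\<close>

lemma iterated_residue_small_left:
  "\<exists>M::int. \<forall>f. (\<forall>n<M. f $$ n = 0) \<longrightarrow>
     (\<forall>i. residue (fls_shift (int i - l) f) u (residue (fls_shift (- int i) g) v w) = 0)"
proof -
  obtain B where B: "\<forall>n\<ge>B. mode V v n w = 0" using truncation by blast
  obtain G where G: "\<forall>n<G. g $$ n = 0" by (elim fls_nth_vanishes_belowE)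
  define m where "m = nat (B - G)"
  have inner: "residue (fls_shift (- int i) g) v w = 0" if "i \<ge> m" for i
  proof (rule residue_eq_0)
    fix n show "fls_shift (- int i) g $$ n = 0 \<or> mode V v n w = 0"
      using B G that by (cases "n \<ge> B") (auto simp: m_def)
  qed
  obtain N where N: "\<forall>i<m. \<forall>n\<ge>N. mode V u n (residue (fls_shift (- int i) g) v w) = 0"
    using truncation_uniform[of m "\<lambda>_. u" "\<lambda>i. residue (fls_shift (- int i) g) v w"] by auto
  have "residue (fls_shift (int i - l) f) u (residue (fls_shift (- int i) g) v w) = 0"
    if f: "\<forall>n<N + int m - l. f $$ n = 0" for f i
  proof (cases "i < m")
    case True
    show ?thesis
    proof (rule residue_eq_0)
      fix n show "fls_shift (int i - l) f $$ n = 0 \<or> mode V u n (residue (fls_shift (- int i) g) v w) = 0"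
        using N f True by (cases "n \<ge> N") auto
    qed
  qed (simp add: inner residue_simps)
  then show ?thesis by blast
qed

lemma iterated_residue_small_right:
  "\<exists>M::int. \<forall>g. (\<forall>n<M. g $$ n = 0) \<longrightarrow>
     (\<forall>i. residue (fls_shift (int i - l) f) u (residue (fls_shift (- int i) g) v w) = 0)"
proof -
  obtain B where B: "\<forall>n\<ge>B. mode V v n w = 0" using truncation by blast
  have "residue (fls_shift (- int i) g) v w = 0" if "\<forall>n<B. g $$ n = 0" for g i
  proof (rule residue_eq_0)
    fix n show "fls_shift (- int i) g $$ n = 0 \<or> mode V v n w = 0"
      using B that by (cases "n \<ge> B") auto
  qed
  then show ?thesis by (metis residue_simps(6))
qed

lemma hasse_residue_small:
  "\<exists>M::int. \<forall>f. (\<forall>n<M. f $$ n = 0) \<longrightarrow> (\<forall>j. residue (hasse j f * g) (mode V u (l + int j) v) w = 0)"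
  "\<exists>M::int. \<forall>g. (\<forall>n<M. g $$ n = 0) \<longrightarrow> (\<forall>j. residue (hasse j f * g) (mode V u (l + int j) v) w = 0)"
proof -
  obtain B where B: "\<forall>n\<ge>B. mode V u n v = 0" using truncation by blast
  define m where "m = nat (B - l)"
  have large: "mode V u (l + int j) v = 0" if "j \<ge> m" for j
    using B that by (simp add: m_def)
  obtain N where N: "\<forall>j<m. \<forall>n\<ge>N. mode V (mode V u (l + int j) v) n w = 0"
    using truncation_uniform[of m "\<lambda>j. mode V u (l + int j) v" "\<lambda>_. w"] by auto
  have vanish: "residue (hasse j f * g) (mode V u (l + int j) v) w = 0"
    if "\<And>n. n < a \<Longrightarrow> f $$ n = 0" "\<And>n. n < b \<Longrightarrow> g $$ n = 0" "N \<le> a - int m + b" for f g a b j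
  proof (cases "j < m")
    case True
    show ?thesis
    proof (rule residue_eq_0)
      fix n show "(hasse j f * g) $$ n = 0 \<or> mode V (mode V u (l + int j) v) n w = 0"
      proof (cases "n \<ge> N")
        case False
        have "(hasse j f * g) $$ n = 0"
          by (rule fls_mult_small[where a = "a - int m" and b = b]) (use that True False in auto)
        then show ?thesis by simp
      qed (use N True in auto)
    qed
  qed (simp add: large residue_simps)
  obtain F where F: "\<forall>n<F. f $$ n = 0" by (elim fls_nth_vanishes_belowE)
  obtain G where G: "\<forall>n<G. g $$ n = 0" by (elim fls_nth_vanishes_belowE)
  show "\<exists>M::int. \<forall>f. (\<forall>n<M. f $$ n = 0) \<longrightarrow> (\<forall>j. residue (hasse j f * g) (mode V u (l + int j) v) w = 0)"
    using vanish[where a = "N + int m - G" and b = G and g = g] G by (intro exI[of _ "N + int m - G"]) auto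
  show "\<exists>M::int. \<forall>g. (\<forall>n<M. g $$ n = 0) \<longrightarrow> (\<forall>j. residue (hasse j f * g) (mode V u (l + int j) v) w = 0)"
    using vanish[where b = "N + int m - F" and a = F and f = f] F by (intro exI[of _ "N + int m - F"]) auto
qed

lemma eventually_Sum_any:
  fixes g :: "nat \<Rightarrow> 'a"
  assumes "finite {i. g i \<noteq> 0}"
  shows "\<forall>\<^sub>F N in sequentially. Sum_any g = sum g {..<N}"
proof -
  obtain m where "\<forall>i\<in>{i. g i \<noteq> 0}. i < m" using assms finite_nat_set_iff_bounded by blast
  then show ?thesis
    by (intro eventually_sequentiallyI[of m] Sum_any.expand_superset) (auto intro: less_le_trans)
qed

text \<open>The terms of the two sides of the Jacobi identity, weighted with the coefficients of \<open>z\<^sup>m\<close> in \<open>f\<close> and of \<open>w\<^sup>n\<close> in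
\<open>g\<close> and summed over \<open>m\<close> and \<open>n\<close>. On the left the expansions of \<open>(z - w)\<^sup>l\<close> appear, on the right the Taylor
expansion \<open>f(z) = \<Sum>\<^sub>j (z - w)\<^sup>j hasse j f (w)\<close>.\<close>

definition jacobi_left :: "int \<Rightarrow> complex \<Rightarrow> complex fls \<Rightarrow> complex fls \<Rightarrow> 'a \<Rightarrow> 'a \<Rightarrow> 'a \<Rightarrow> nat \<Rightarrow> 'a" where
  "jacobi_left l s f g u v w i = scl V ((-1) ^ i * (of_int l gchoose i))
     (residue (fls_shift (int i - l) f) u (residue (fls_shift (- int i) g) v w)
      - scl V s (residue (fls_shift (int i - l) g) v (residue (fls_shift (- int i) f) u w)))"

definition jacobi_right :: "int \<Rightarrow> complex fls \<Rightarrow> complex fls \<Rightarrow> 'a \<Rightarrow> 'a \<Rightarrow> 'a \<Rightarrow> nat \<Rightarrow> 'a" where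
  "jacobi_right l f g u v w j = residue (hasse j f * g) (mode V u (l + int j) v) w"

lemma jacobi_add:
  "jacobi_left l s (f + f') g u v w i = jacobi_left l s f g u v w i + jacobi_left l s f' g u v w i"
  "jacobi_left l s f (g + g') u v w i = jacobi_left l s f g u v w i + jacobi_left l s f g' u v w i"
  "jacobi_right l (f + f') g u v w i = jacobi_right l f g u v w i + jacobi_right l f' g u v w i"
  "jacobi_right l f (g + g') u v w i = jacobi_right l f g u v w i + jacobi_right l f g' u v w i"
  by (simp_all add: jacobi_left_def jacobi_right_def residue_simps hasse_add algebra_simps
      scale_right_distrib scale_right_diff_distrib)

text \<open>Both sums have only finitely many nonzero terms, and comparing partial sums for large \<open>N\<close> makes the identity
visibly additive in \<open>f\<close> and in \<open>g\<close>. So it follows from the Jacobi identity for modes, which is the case of monomials.\<close>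

theorem residue_jacobi:
  assumes "u \<in> Vdeg V p" "v \<in> Vdeg V q"
  shows "\<forall>\<^sub>F N in sequentially. (\<Sum>i<N. jacobi_left l ((-1) powi l * (-1) powi (p * q)) f g u v w i)
    = (\<Sum>j<N. jacobi_right l f g u v w j)"
proof -
  define s :: complex where "s = (-1) powi l * (-1) powi (p * q)"
  define J where "J f g \<longleftrightarrow> (\<forall>\<^sub>F N in sequentially. (\<Sum>i<N. jacobi_left l s f g u v w i)
    = (\<Sum>j<N. jacobi_right l f g u v w j))" for f g
  have small_left: "\<exists>M::int. \<forall>f. (\<forall>n<M. f $$ n = 0) \<longrightarrow> J f g" for g
  proof -
    obtain M1 :: int where M1: "\<forall>f. (\<forall>n<M1. f $$ n = 0) \<longrightarrow>
        (\<forall>i. residue (fls_shift (int i - l) f) u (residue (fls_shift (- int i) g) v w) = 0)"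
      using iterated_residue_small_left by blast
    obtain M2 :: int where M2: "\<forall>f. (\<forall>n<M2. f $$ n = 0) \<longrightarrow>
        (\<forall>i. residue (fls_shift (int i - l) g) v (residue (fls_shift (- int i) f) u w) = 0)"
      using iterated_residue_small_right by blast
    obtain M3 :: int where M3: "\<forall>f. (\<forall>n<M3. f $$ n = 0) \<longrightarrow>
        (\<forall>j. residue (hasse j f * g) (mode V u (l + int j) v) w = 0)"
      using hasse_residue_small(1) by blast
    have "J f g" if "\<forall>n<max M1 (max M2 M3). f $$ n = 0" for f
      using M1 M2 M3 that by (simp add: J_def jacobi_left_def jacobi_right_def)
    then show ?thesis by blast
  qed
  have small_right: "\<exists>M::int. \<forall>g. (\<forall>n<M. g $$ n = 0) \<longrightarrow> J f g" for f
  proof -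
    obtain M1 :: int where M1: "\<forall>g. (\<forall>n<M1. g $$ n = 0) \<longrightarrow>
        (\<forall>i. residue (fls_shift (int i - l) f) u (residue (fls_shift (- int i) g) v w) = 0)"
      using iterated_residue_small_right by blast
    obtain M2 :: int where M2: "\<forall>g. (\<forall>n<M2. g $$ n = 0) \<longrightarrow>
        (\<forall>i. residue (fls_shift (int i - l) g) v (residue (fls_shift (- int i) f) u w) = 0)"
      using iterated_residue_small_left by blast
    obtain M3 :: int where M3: "\<forall>g. (\<forall>n<M3. g $$ n = 0) \<longrightarrow>
        (\<forall>j. residue (hasse j f * g) (mode V u (l + int j) v) w = 0)"
      using hasse_residue_small(2) by blast
    have "J f g" if "\<forall>n<max M1 (max M2 M3). g $$ n = 0" for g
      using M1 M2 M3 that by (simp add: J_def jacobi_left_def jacobi_right_def)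
    then show ?thesis by blast
  qed
  have monomials: "J (fls_shift (- m) (fls_const c)) (fls_shift (- n) (fls_const c'))" for m n c c'
  proof -
    define L where "L i = scl V ((-1) ^ i * (of_int l gchoose i))
            (mode V u (m + l - int i) (mode V v (n + int i) w)
              - scl V s (mode V v (n + l - int i) (mode V u (m + int i) w)))" for i
    define R where "R i = scl V (of_int m gchoose i)
              (mode V (mode V u (l + int i) v) (m + n - int i) w)" for i
    obtain B where B: "\<forall>k\<ge>B. mode V v k w = 0" using truncation by blast
    obtain B' where B': "\<forall>k\<ge>B'. mode V u k w = 0" using truncation by blast
    obtain B'' where B'': "\<forall>k\<ge>B''. mode V u k v = 0" using truncation by blast
    have "L i = 0" if "i \<ge> nat (max (B - n) (B' - m))" for i
      using that B B' by (simp add: L_def mode_simps)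
    then have "{i. L i \<noteq> 0} \<subseteq> {..<nat (max (B - n) (B' - m))}"
      by (metis (mono_tags, lifting) lessThan_iff mem_Collect_eq not_le subsetI)
    then have "finite {i. L i \<noteq> 0}" by (rule finite_subset) simp
    note evL = eventually_Sum_any[OF this]
    have "R i = 0" if "i \<ge> nat (B'' - l)" for i
      using that B'' by (simp add: R_def mode_simps)
    then have "{i. R i \<noteq> 0} \<subseteq> {..<nat (B'' - l)}"
      by (metis (mono_tags, lifting) lessThan_iff mem_Collect_eq not_le subsetI)
    then have "finite {i. R i \<noteq> 0}" by (rule finite_subset) simp
    note evR = eventually_Sum_any[OF this]
    have LR: "Sum_any L = Sum_any R"
      unfolding L_def R_def s_def by (rule jacobi[OF assms])
    have left: "jacobi_left l s (fls_shift (- m) (fls_const c)) (fls_shift (- n) (fls_const c')) u v w i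
        = scl V (c * c') (L i)" for i
    proof -
      have sh: "fls_shift (int i - l) (fls_shift (- m) (fls_const c)) = fls_shift (- (m + l - int i)) (fls_const c)"
        "fls_shift (- int i) (fls_shift (- m) (fls_const c)) = fls_shift (- (m + int i)) (fls_const c)" for m c
        by (simp_all add: algebra_simps)
      show ?thesis
        by (simp only: jacobi_left_def sh residue_monomial L_def mode_scale)
          (simp add: algebra_simps scale_right_diff_distrib)
    qed
    have right: "jacobi_right l (fls_shift (- m) (fls_const c)) (fls_shift (- n) (fls_const c')) u v w i
        = scl V (c * c') (R i)" for i
    proof -
      have "hasse i (fls_shift (- m) (fls_const c)) * fls_shift (- n) (fls_const c')
          = fls_shift (- (m + n - int i)) (fls_const (c * c' * (of_int m gchoose i)))"
        by (simp add: hasse_monomial fls_times_both_shifted_simp algebra_simps)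
      then show ?thesis by (simp only: jacobi_right_def residue_monomial R_def) simp
    qed
    show ?thesis
      unfolding J_def left right scale_sum_right[symmetric]
      using evL evR by eventually_elim (simp add: LR[symmetric])
  qed
  have "J f g"
  proof (induction f rule: fls_truncation_induct)
    case (add f f')
    show ?case using add unfolding J_def
      by eventually_elim (simp add: jacobi_add sum.distrib)
  next
    case (monomial m c)
    show ?case
    proof (induction g rule: fls_truncation_induct)
      case (add g g')
      show ?case using add unfolding J_def
        by eventually_elim (simp add: jacobi_add sum.distrib)
    next
      case (monomial n c')
      show ?case by (rule monomials)
    next
      case small
      show ?case by (rule small_right)
    qed
  next
    case small
    show ?case by (rule small_left)
  qed
  then show ?thesis unfolding J_def s_def .
qed

end

context dg_vertex_algebra
begin

text \<open>Integration by parts: the residue of a derivative is zero.\<close>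

lemma residue_L_minus_1:
  assumes "\<And>n. mode V u' n v = scl V (of_int (- n)) (mode V u (n - 1) v)"
  shows "residue f u' v = - residue (fls_deriv f) u v"
proof -
  have "residue f u' v = Sum_any (\<lambda>n. scl V ((- fls_deriv f) $$ n) (mode V u n v))"
    unfolding residue_def
  proof (rule Sum_any.reindex_cong)
    show "bij (\<lambda>n::int. n + 1)" by (rule o_bij[of "\<lambda>n. n - 1"]) auto
    show "(\<lambda>n. scl V (f $$ n) (mode V u' n v)) \<circ> (\<lambda>n. n + 1)
        = (\<lambda>n. scl V ((- fls_deriv f) $$ n) (mode V u n v))"
      by (rule ext) (simp add: assms algebra_simps)
  qed
  also have "\<dots> = - residue (fls_deriv f) u v"
    unfolding residue_def[symmetric] by (simp only: residue_simps)
  finally show ?thesis .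
qed

lemma residue_binomial_fls:
  "residue (fls_shift (- k) (binomial_fls \<epsilon> c)) u v
    = Sum_any (\<lambda>n::nat. scl V (\<epsilon> ^ n * (c gchoose n)) (mode V u (int n + k) v))"
  unfolding residue_def Sum_any.expand_set
  by (rule sum.reindex_bij_witness[of _ "\<lambda>n. int n + k" "\<lambda>m. nat (m - k)"])
    (auto simp: binomial_fls_nth split: if_splits)

lemma residue_binomial_support:
  "finite {n::nat. scl V (\<epsilon> ^ n * (c gchoose n)) (mode V u (int n + k) v) \<noteq> 0}"
proof -
  obtain B where B: "\<forall>n\<ge>B. mode V u n v = 0" using truncation by blast
  have "scl V (\<epsilon> ^ n * (c gchoose n)) (mode V u (int n + k) v) = 0" if "n \<ge> nat (B - k)" for n
    using B that by simp
  then have "{n. scl V (\<epsilon> ^ n * (c gchoose n)) (mode V u (int n + k) v) \<noteq> 0} \<subseteq> {..<nat (B - k)}"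
    by (metis (mono_tags, lifting) lessThan_iff mem_Collect_eq not_le subsetI)
  then show ?thesis by (rule finite_subset) simp
qed

end

section \<open>The deformed products and their two-sided ideals\<close>

context dg_vertex_operator_algebra
begin

text \<open>The residue of \<open>x\<^sup>k (1 + \<epsilon> x)\<^bsup>wt u\<^esup> Y(u, x) v\<close>, extended linearly from weight homogeneous \<open>u\<close>. For \<open>\<epsilon> = 0\<close> it is \<open>u\<^sub>k v\<close>. For
\<open>\<epsilon> = 1\<close> it is \<open>u \<ast> v\<close> if \<open>k = -1\<close>, and \<open>u \<circ> v\<close> if \<open>k = -2\<close>. Every \<open>\<epsilon>\<close> is admitted so that one proof covers
\<open>C\<^sub>2\<close> and \<open>O\<close>.\<close>

definition zhu_mode :: "complex \<Rightarrow> int \<Rightarrow> 'a \<Rightarrow> 'a \<Rightarrow> 'a" where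
  "zhu_mode \<epsilon> k u v = (\<Sum>h | h \<in> half_ints \<and> wt_part V h u \<noteq> 0.
     residue (fls_shift (- k) (binomial_fls \<epsilon> (of_rat h))) (wt_part V h u) v)"

definition zhu_ideal :: "complex \<Rightarrow> 'a set" where
  "zhu_ideal \<epsilon> = span {zhu_mode \<epsilon> (-2) u v |u v. True}"

lemma zhu_mode_eq_sum:
  assumes "finite S" "{h. wt_part V h u \<noteq> 0} \<subseteq> S"
  shows "zhu_mode \<epsilon> k u v
    = (\<Sum>h\<in>S. residue (fls_shift (- k) (binomial_fls \<epsilon> (of_rat h))) (wt_part V h u) v)"
  unfolding zhu_mode_def
proof (rule sum.mono_neutral_left[OF assms(1)])
  show "{h \<in> half_ints. wt_part V h u \<noteq> 0} \<subseteq> S" using assms(2) by blast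
  show "\<forall>h\<in>S - {h \<in> half_ints. wt_part V h u \<noteq> 0}.
      residue (fls_shift (- k) (binomial_fls \<epsilon> (of_rat h))) (wt_part V h u) v = 0"
  proof
    fix h assume "h \<in> S - {h \<in> half_ints. wt_part V h u \<noteq> 0}"
    then have "wt_part V h u = 0" using component_outside[OF weight_decomposition, of h u] by blast
    then show "residue (fls_shift (- k) (binomial_fls \<epsilon> (of_rat h))) (wt_part V h u) v = 0"
      by (simp add: residue_simps)
  qed
qed

lemma zhu_mode_homogeneous:
  assumes "h \<in> half_ints" "u \<in> Vwt V h"
  shows "zhu_mode \<epsilon> k u v = residue (fls_shift (- k) (binomial_fls \<epsilon> (of_rat h))) u v"
proof -
  have "{i. wt_part V i u \<noteq> 0} \<subseteq> {h}"
    using component_of_homogeneous[OF weight_decomposition assms] by auto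
  from zhu_mode_eq_sum[OF _ this] show ?thesis
    by (simp add: component_of_homogeneous[OF weight_decomposition assms])
qed

lemma zhu_mode_add:
  "zhu_mode \<epsilon> k (u + u') v = zhu_mode \<epsilon> k u v + zhu_mode \<epsilon> k u' v"
  "zhu_mode \<epsilon> k u (v + v') = zhu_mode \<epsilon> k u v + zhu_mode \<epsilon> k u v'"
proof -
  let ?S = "{h. wt_part V h u \<noteq> 0} \<union> {h. wt_part V h u' \<noteq> 0}"
  have fin: "finite ?S" using component_finite[OF weight_decomposition] by simp
  have "{h. wt_part V h (u + u') \<noteq> 0} \<subseteq> ?S" by (auto simp: component_add[OF weight_decomposition])
  from zhu_mode_eq_sum[OF fin this] zhu_mode_eq_sum[OF fin, of u] zhu_mode_eq_sum[OF fin, of u']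
  show "zhu_mode \<epsilon> k (u + u') v = zhu_mode \<epsilon> k u v + zhu_mode \<epsilon> k u' v"
    by (simp add: component_add[OF weight_decomposition] residue_simps sum.distrib)
  show "zhu_mode \<epsilon> k u (v + v') = zhu_mode \<epsilon> k u v + zhu_mode \<epsilon> k u v'"
    by (simp add: zhu_mode_def residue_simps sum.distrib)
qed

lemma zhu_mode_scale:
  "zhu_mode \<epsilon> k (scl V c u) v = scl V c (zhu_mode \<epsilon> k u v)"
  "zhu_mode \<epsilon> k u (scl V c v) = scl V c (zhu_mode \<epsilon> k u v)"
proof -
  have fin: "finite {h. wt_part V h u \<noteq> 0}" using component_finite[OF weight_decomposition] .
  have "{h. wt_part V h (scl V c u) \<noteq> 0} \<subseteq> {h. wt_part V h u \<noteq> 0}"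
    by (auto simp: component_scale[OF weight_decomposition])
  from zhu_mode_eq_sum[OF fin this] zhu_mode_eq_sum[OF fin, of u]
  show "zhu_mode \<epsilon> k (scl V c u) v = scl V c (zhu_mode \<epsilon> k u v)"
    by (simp add: component_scale[OF weight_decomposition] residue_scale scale_sum_right)
  show "zhu_mode \<epsilon> k u (scl V c v) = scl V c (zhu_mode \<epsilon> k u v)"
    by (simp add: zhu_mode_def residue_scale scale_sum_right)
qed

lemma zhu_mode_zero: "zhu_mode \<epsilon> k 0 v = 0" "zhu_mode \<epsilon> k u 0 = 0"
  using zhu_mode_scale[where c = 0] by simp_all

lemma zhu_mode_0: "zhu_mode 0 k u v = mode V u k v"
proof -
  have "zhu_mode 0 k u v = (\<Sum>h | wt_part V h u \<noteq> 0. mode V (wt_part V h u) k v)"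
    by (subst zhu_mode_eq_sum[OF component_finite[OF weight_decomposition] subset_refl])
      (simp add: binomial_fls_0 residue_one)
  then show ?thesis by (simp add: component_sum[OF weight_decomposition] flip: mode_simps(7))
qed

lemma zhu_mode_1: "zhu_mode 1 k u v = zhu_product V k u v"
  unfolding zhu_mode_def zhu_product_def residue_binomial_fls by simp

text \<open>The \<open>n\<close>-th term of the series \<open>(1 + \<epsilon> x)\<^sup>h\<close> lowers the degree by \<open>2 n\<close> and the weight by \<open>n\<close>.\<close>

lemma zhu_mode_Vbi:
  assumes "subspace W" "h \<in> half_ints" "u \<in> Vbi V p h" "v \<in> Vbi V q l"
    and "\<And>n::nat. Vbi V (p + q - 2 * k - 2 - 2 * int n) (h + l - of_int k - 1 - of_nat n) \<subseteq> W"
  shows "zhu_mode \<epsilon> k u v \<in> W"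
proof -
  have "residue (fls_shift (- k) (binomial_fls \<epsilon> (of_rat h))) u v \<in> W"
  proof (rule residue_mem[OF assms(1)])
    fix m assume "fls_shift (- k) (binomial_fls \<epsilon> (of_rat h)) $$ m \<noteq> 0"
    then have "m = k + int (nat (m - k))" by (simp add: binomial_fls_nth split: if_splits)
    then obtain n where m: "m = k + int n" by blast
    show "mode V u m v \<in> W"
      using mode_Vbi[OF assms(3,4), of m] assms(5)[of n] by (auto simp: m algebra_simps)
  qed
  then show ?thesis using assms(2,3) by (simp add: zhu_mode_homogeneous Vbi_def)
qed

text \<open>Only the constant term of \<open>(1 + \<epsilon> x)\<^sup>h\<close> keeps degree and weight; all others lower both strictly.\<close>

lemma zhu_mode_leading:
  assumes "subspace W" "h \<in> half_ints" "u \<in> Vbi V p h" "v \<in> Vbi V q l"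
    and "\<And>n::nat. n > 0 \<Longrightarrow> Vbi V (p + q - 2 * k - 2 - 2 * int n) (h + l - of_int k - 1 - of_nat n) \<subseteq> W"
  shows "zhu_mode \<epsilon> k u v - mode V u k v \<in> W"
proof -
  have "residue (fls_shift (- k) (binomial_fls \<epsilon> (of_rat h) - 1)) u v \<in> W"
  proof (rule residue_mem[OF assms(1)])
    fix m assume "fls_shift (- k) (binomial_fls \<epsilon> (of_rat h) - 1) $$ m \<noteq> 0"
    then have "m = k + int (nat (m - k))" "nat (m - k) > 0"
      by (auto simp: binomial_fls_nth split: if_splits)
    then obtain n where m: "m = k + int n" "n > 0" by blast
    show "mode V u m v \<in> W"
      using mode_Vbi[OF assms(3,4), of m] assms(5)[of n] m(2) by (auto simp: m algebra_simps)
  qed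
  then show ?thesis using assms(2,3) by (simp add: zhu_mode_homogeneous Vbi_def residue_simps residue_one)
qed

lemma zhu_ideal_subspace: "subspace (zhu_ideal \<epsilon>)"
  by (simp add: zhu_ideal_def)

lemma zhu_ideal_generator:
  assumes "h \<in> half_ints" "u \<in> Vbi V p h"
  shows "residue (fls_shift 2 (binomial_fls \<epsilon> (of_rat h))) u v \<in> zhu_ideal \<epsilon>"
proof -
  have "zhu_mode \<epsilon> (-2) u v \<in> zhu_ideal \<epsilon>" unfolding zhu_ideal_def by (rule span_base) blast
  then show ?thesis using assms by (simp add: zhu_mode_homogeneous Vbi_def)
qed

lemma zhu_ideal_induct [consumes 1, case_names subspace generator]:
  assumes "x \<in> zhu_ideal \<epsilon>" "subspace (Collect P)"
    and "\<And>p h u q l v. h \<in> half_ints \<Longrightarrow> u \<in> Vbi V p h \<Longrightarrow> l \<in> half_ints \<Longrightarrow> v \<in> Vbi V q l \<Longrightarrow>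
      P (residue (fls_shift 2 (binomial_fls \<epsilon> (of_rat h))) u v)"
  shows "P x"
proof -
  have P: "P 0" "P x \<Longrightarrow> P y \<Longrightarrow> P (x + y)" for x y
    using subspace_0[OF assms(2)] subspace_add[OF assms(2)] by auto
  have "P (zhu_mode \<epsilon> (-2) u v)" for u v
  proof (induction u rule: bihomogeneous_induct)
    case (bi p h u)
    show ?case
    proof (induction v rule: bihomogeneous_induct)
      case (bi q l v)
      then show ?case using assms(3)[OF \<open>h \<in> half_ints\<close> \<open>u \<in> Vbi V p h\<close> bi] \<open>h \<in> half_ints\<close> \<open>u \<in> Vbi V p h\<close>
        by (simp add: zhu_mode_homogeneous Vbi_def)
    qed (auto simp: zhu_mode_add zhu_mode_zero P)
  qed (auto simp: zhu_mode_add zhu_mode_zero P)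
  then have "zhu_ideal \<epsilon> \<subseteq> Collect P"
    unfolding zhu_ideal_def by (intro span_minimal[OF _ assms(2)]) auto
  then show ?thesis using assms(1) by blast
qed

text \<open>Induction on \<open>m\<close> via \<open>L(-1) u\<close>, which has weight \<open>h + 1\<close>: the derivative of \<open>x\<^bsup>-2-m\<^esup> (1 + \<epsilon> x)\<^bsup>h+1\<^esup>\<close> is
\<open>-(m + 2) x\<^bsup>-3-m\<^esup> (1 + \<epsilon> x)\<^sup>h\<close> plus a multiple of \<open>x\<^bsup>-2-m\<^esup> (1 + \<epsilon> x)\<^sup>h\<close>, and \<open>m + 2\<close> is invertible.\<close>

lemma zhu_ideal_high_pole:
  assumes "h \<in> half_ints" "u \<in> Vbi V p h"
  shows "residue (fls_shift (2 + int m) (binomial_fls \<epsilon> (of_rat h))) u v \<in> zhu_ideal \<epsilon>"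
  using assms
proof (induction m arbitrary: p h u)
  case 0
  then show ?case using zhu_ideal_generator by simp
next
  case (Suc m)
  let ?c = "of_rat h :: complex" and ?d = "of_nat (m + 2) :: complex"
  let ?Q = "residue (fls_shift (2 + int m) (binomial_fls \<epsilon> ?c)) u v"
  let ?R = "residue (fls_shift (2 + int (Suc m)) (binomial_fls \<epsilon> ?c)) u v"
  let ?f = "fls_shift (2 + int m) (binomial_fls \<epsilon> (?c + 1))"
  have "Lop V (-1) u \<in> Vbi V (p + 2) (h + 1)"
    using Suc.prems by (simp add: Vbi_def L_minus_1_degree L_minus_1_weight)
  from Suc.IH[OF _ this] have 1: "residue ?f (Lop V (-1) u) v \<in> zhu_ideal \<epsilon>"
    using Suc.prems by (simp add: of_rat_add)
  have "fls_deriv ?f = fls_const ((?c + 1) * \<epsilon> - ?d * \<epsilon>) * fls_shift (2 + int m) (binomial_fls \<epsilon> ?c)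
      + fls_const (- ?d) * fls_shift (2 + int (Suc m)) (binomial_fls \<epsilon> ?c)"
    unfolding fls_deriv_shift fls_deriv_binomial_fls
    unfolding binomial_fls_Suc by (rule fls_eqI) (simp add: fls_of_int algebra_simps)
  then have "residue ?f (Lop V (-1) u) v = scl V ?d ?R - scl V ((?c + 1) * \<epsilon> - ?d * \<epsilon>) ?Q"
    by (simp only: residue_L_minus_1[OF L_minus_1_mode] residue_add residue_scale scale_minus_left) simp
  moreover have "?d \<noteq> 0" by (simp only: of_nat_eq_0_iff)
  ultimately have "?R = scl V (1 / ?d) (residue ?f (Lop V (-1) u) v + scl V ((?c + 1) * \<epsilon> - ?d * \<epsilon>) ?Q)"
    by (simp del: of_nat_add of_nat_Suc)
  then show ?case
    using 1 Suc.IH[OF Suc.prems] by (metis subspace_add subspace_scale zhu_ideal_subspace)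
qed

text \<open>Each extra factor \<open>1 + \<epsilon> x\<close> lowers the order of the pole by at most one.\<close>

lemma zhu_ideal_higher_pole:
  assumes "h \<in> half_ints" "u \<in> Vbi V p h" "n \<le> m"
  shows "residue (fls_shift (2 + int m) (binomial_fls \<epsilon> (of_rat h + of_nat n))) u v \<in> zhu_ideal \<epsilon>"
  using assms(3)
proof (induction n arbitrary: m)
  case 0
  then show ?case using zhu_ideal_high_pole[OF assms(1,2)] by simp
next
  case (Suc n)
  then obtain m' where m: "m = Suc m'" "n \<le> m'" by (cases m) auto
  have "fls_shift (2 + int m) (binomial_fls \<epsilon> (of_rat h + of_nat (Suc n)))
      = fls_shift (2 + int m) (binomial_fls \<epsilon> (of_rat h + of_nat n))
        + fls_const \<epsilon> * fls_shift (2 + int m') (binomial_fls \<epsilon> (of_rat h + of_nat n))"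
    using binomial_fls_Suc[of \<epsilon> "of_rat h + of_nat n"]
    by (intro fls_eqI) (simp add: m add_ac)
  then show ?case
    using Suc.IH[of m] Suc.IH[of m'] m
    by (simp only: residue_add residue_scale)
      (intro subspace_add[OF zhu_ideal_subspace] subspace_scale[OF zhu_ideal_subspace], auto)
qed

lemma obtain_residue_jacobi:
  assumes "u \<in> Vdeg V p" "v \<in> Vdeg V q" "\<forall>\<^sub>F N in sequentially. P N"
  obtains N where "(\<Sum>i<N. jacobi_left l ((-1) powi l * (-1) powi (p * q)) f g u v w i)
    = (\<Sum>j<N. jacobi_right l f g u v w j)" "P N"
proof -
  have "\<forall>\<^sub>F N in sequentially. (\<Sum>i<N. jacobi_left l ((-1) powi l * (-1) powi (p * q)) f g u v w i)
    = (\<Sum>j<N. jacobi_right l f g u v w j) \<and> P N"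
    using residue_jacobi[OF assms(1,2)] assms(3) by eventually_elim simp
  then show ?thesis using that eventually_happens by fastforce
qed

text \<open>For a generator \<open>x\<close> made from \<open>b\<close> and \<open>c\<close>, the Jacobi identity with \<open>l = 0\<close> expresses the commutator of the product with
\<open>a\<close> and the residue that defines the generator. The reordered term is a generator, and the terms \<open>a\<^sub>j b\<close> of the commutator
come with poles high enough for \<open>zhu_ideal_higher_pole\<close>.\<close>

lemma zhu_ideal_left:
  assumes "x \<in> zhu_ideal \<epsilon>"
  shows "zhu_mode \<epsilon> (-1) y x \<in> zhu_ideal \<epsilon>"
proof (induction y rule: bihomogeneous_induct)
  case (bi p h a)
  let ?f = "fls_shift 1 (binomial_fls \<epsilon> (of_rat h))"
  have "residue ?f a x \<in> zhu_ideal \<epsilon>"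
    using assms
  proof (induction x rule: zhu_ideal_induct)
    case subspace
    show ?case
      by (rule subspaceI) (auto simp: residue_simps residue_scale
          intro: subspace_0[OF zhu_ideal_subspace] subspace_add[OF zhu_ideal_subspace] subspace_scale[OF zhu_ideal_subspace])
  next
    case (generator q k b r l c)
    let ?g = "fls_shift 2 (binomial_fls \<epsilon> (of_rat k))"
    define s :: complex where "s = (-1) powi 0 * (-1) powi (p * q)"
    have ab: "a \<in> Vdeg V p" "b \<in> Vdeg V q" using bi generator by (auto simp: Vbi_def)
    obtain N where N: "(\<Sum>i<N. jacobi_left 0 s ?f ?g a b c i) = (\<Sum>j<N. jacobi_right 0 ?f ?g a b c j)" "N > 0"
      unfolding s_def using obtain_residue_jacobi[OF ab eventually_gt_at_top] by blast
    have "jacobi_left 0 s ?f ?g a b c i =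
        (if i = 0 then residue ?f a (residue ?g b c) - scl V s (residue ?g b (residue ?f a c)) else 0)" for i
      by (cases i) (auto simp: jacobi_left_def gbinomial_0(2))
    then have left: "(\<Sum>i<N. jacobi_left 0 s ?f ?g a b c i)
        = residue ?f a (residue ?g b c) - scl V s (residue ?g b (residue ?f a c))"
      using N(2) by (simp add: sum.delta)
    have "jacobi_right 0 ?f ?g a b c j \<in> zhu_ideal \<epsilon>" for j
    proof -
      \<comment> \<open>The weight of \<open>a\<^sub>j b\<close>. In the \<open>i\<close>-th term of the Leibniz rule the exponent exceeds it by \<open>j - i + 1\<close>, and the
      order of the pole exceeds \<open>2\<close> by the same amount.\<close>
      define w where "w = h + k - of_nat j - 1"
      have w: "w \<in> half_ints" "mode V a (int j) b \<in> Vbi V (p + q - 2 * int j - 2) w"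
        using bi generator mode_Vbi[of a p h b q k "int j"] by (auto simp: w_def)
      have hasse: "hasse j ?f * ?g = (\<Sum>i\<le>j. fls_const ((of_int (-1) gchoose (j - i)) * (\<epsilon> ^ i * (of_rat h gchoose i)))
          * fls_shift (2 + int (j - i + 1)) (binomial_fls \<epsilon> (of_rat w + of_nat (j - i + 1))))"
      proof -
        have "of_rat h - of_nat i + of_rat k = (of_rat w + of_nat (j - i + 1) :: complex)" if "i \<le> j" for i
          using that by (simp add: w_def of_rat_add of_rat_diff of_nat_diff)
        then have E: "binomial_fls \<epsilon> (of_rat w + of_nat (j - i + 1))
            = binomial_fls \<epsilon> (of_rat h - of_nat i) * binomial_fls \<epsilon> (of_rat k)" if "i \<le> j" for i
          using that by (simp only: binomial_fls_mult)
        have "fls_shift (int (j - i) - (-1)) (fls_const (of_int (-1) gchoose (j - i)) * hasse i (binomial_fls \<epsilon> (of_rat h))) * ?g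
            = fls_const ((of_int (-1) gchoose (j - i)) * (\<epsilon> ^ i * (of_rat h gchoose i)))
          * fls_shift (2 + int (j - i + 1)) (binomial_fls \<epsilon> (of_rat w + of_nat (j - i + 1)))" if "i \<le> j" for i
          unfolding E[OF that]
          by (simp add: hasse_binomial_fls fls_times_both_shifted_simp fls_shifted_times_simps mult.assoc
              flip: fls_const_mult_const)
        then show ?thesis
          using hasse_shift[of j "-1" "binomial_fls \<epsilon> (of_rat h)"]
          by (simp add: sum_distrib_right)
      qed
      show ?thesis
        unfolding jacobi_right_def hasse residue_simps residue_scale
        by (intro subspace_sum[OF zhu_ideal_subspace] subspace_scale[OF zhu_ideal_subspace]
            zhu_ideal_higher_pole[where p = "p + q - 2 * int j - 2"]) (use w in auto)
    qed
    then have "residue ?f a (residue ?g b c) - scl V s (residue ?g b (residue ?f a c)) \<in> zhu_ideal \<epsilon>"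
      using N(1) left by (metis subspace_sum[OF zhu_ideal_subspace])
    moreover have "scl V s (residue ?g b (residue ?f a c)) \<in> zhu_ideal \<epsilon>"
      using generator by (intro subspace_scale[OF zhu_ideal_subspace] zhu_ideal_generator)
    ultimately show ?case using subspace_add[OF zhu_ideal_subspace] by fastforce
  qed
  then show ?case using bi by (simp add: zhu_mode_homogeneous Vbi_def)
qed (auto simp: zhu_mode_add zhu_mode_zero intro: subspace_0[OF zhu_ideal_subspace] subspace_add[OF zhu_ideal_subspace])

text \<open>For a generator made from \<open>a\<close> and \<open>b\<close>, its product with \<open>c\<close> is the right hand side of the Jacobi identity with \<open>l = -2\<close>: the
Taylor coefficients of \<open>(1 + \<epsilon> z)\<^sup>h\<close> at \<open>w\<close> supply exactly the exponents \<open>wt (a\<^bsub>j-2\<^esub> b)\<close>. On the left hand side the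
expansions of \<open>(z - w)\<^sup>-\<^sup>2\<close> give high poles in \<open>z\<close> and in \<open>w\<close>, respectively.\<close>

lemma zhu_ideal_right:
  assumes "x \<in> zhu_ideal \<epsilon>"
  shows "zhu_mode \<epsilon> (-1) x c \<in> zhu_ideal \<epsilon>"
  using assms
proof (induction x rule: zhu_ideal_induct)
  case subspace
  show ?case
    by (rule subspaceI) (auto simp: zhu_mode_add zhu_mode_zero zhu_mode_scale
        intro: subspace_0[OF zhu_ideal_subspace] subspace_add[OF zhu_ideal_subspace] subspace_scale[OF zhu_ideal_subspace])
next
  case (generator p h a q k b)
  let ?f = "binomial_fls \<epsilon> (of_rat h)" and ?g = "fls_shift 1 (binomial_fls \<epsilon> (of_rat k + 1))"
  define s :: complex where "s = (-1) powi (-2) * (-1) powi (p * q)"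
  define t where "t n = scl V (\<epsilon> ^ n * (of_rat h gchoose n)) (mode V a (int n + -2) b)" for n
  have ab: "a \<in> Vdeg V p" "b \<in> Vdeg V q" using generator by (auto simp: Vbi_def)
  have "\<forall>\<^sub>F N in sequentially. Sum_any t = sum t {..<N}"
    unfolding t_def by (rule eventually_Sum_any[OF residue_binomial_support])
  then obtain N where N: "(\<Sum>i<N. jacobi_left (-2) s ?f ?g a b c i) = (\<Sum>j<N. jacobi_right (-2) ?f ?g a b c j)"
      "Sum_any t = sum t {..<N}"
    unfolding s_def using obtain_residue_jacobi[OF ab] by blast
  have right: "zhu_mode \<epsilon> (-1) (t j) c = jacobi_right (-2) ?f ?g a b c j" for j
  proof -
    have "h + k - of_int (int j - 2) - 1 \<in> half_ints" "mode V a (int j - 2) b \<in> Vwt V (h + k - of_int (int j - 2) - 1)"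
      using generator mode_weight[of a h b k "int j - 2"] by (auto simp: Vbi_def)
    moreover have "of_rat (h + k - of_int (int j - 2) - 1) = (of_rat h - of_nat j + (of_rat k + 1) :: complex)"
      by (simp add: of_rat_add of_rat_diff)
    moreover have "hasse j ?f * ?g = fls_const (\<epsilon> ^ j * (of_rat h gchoose j))
        * fls_shift 1 (binomial_fls \<epsilon> (of_rat h - of_nat j + (of_rat k + 1)))"
      by (simp add: hasse_binomial_fls fls_shifted_times_simps mult.assoc binomial_fls_mult)
    ultimately show ?thesis
      by (simp add: jacobi_right_def t_def zhu_mode_scale zhu_mode_homogeneous residue_scale)
  qed
  have "jacobi_left (-2) s ?f ?g a b c i \<in> zhu_ideal \<epsilon>" for i
  proof -
    have "residue (fls_shift (2 + int i) ?f) a y \<in> zhu_ideal \<epsilon>" for y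
      using generator by (intro zhu_ideal_high_pole)
    moreover have "residue (fls_shift (2 + int (i + 1)) (binomial_fls \<epsilon> (of_rat k + of_nat 1))) b y \<in> zhu_ideal \<epsilon>" for y
      using generator by (intro zhu_ideal_higher_pole) auto
    ultimately show ?thesis
      unfolding jacobi_left_def
      by (intro subspace_diff[OF zhu_ideal_subspace] subspace_scale[OF zhu_ideal_subspace])
        (simp_all add: add_ac)
  qed
  then have "(\<Sum>j<N. zhu_mode \<epsilon> (-1) (t j) c) \<in> zhu_ideal \<epsilon>"
    unfolding right N(1)[symmetric] by (rule subspace_sum[OF zhu_ideal_subspace])
  moreover have "zhu_mode \<epsilon> (-1) (sum t {..<N}) c = (\<Sum>j<N. zhu_mode \<epsilon> (-1) (t j) c)"
    by (induction N) (auto simp: zhu_mode_add zhu_mode_zero)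
  moreover have "residue (fls_shift 2 ?f) a b = Sum_any t"
    using residue_binomial_fls[of "-2" \<epsilon> "of_rat h" a b] by (simp add: t_def)
  ultimately show ?case by (simp add: N(2))
qed

lemma zhu_ideal_d:
  assumes "x \<in> zhu_ideal \<epsilon>"
  shows "dV V x \<in> zhu_ideal \<epsilon>"
  using assms
proof (induction x rule: zhu_ideal_induct)
  case subspace
  show ?case
    by (rule subspaceI) (auto simp: d_simps d_scale
        intro: subspace_0[OF zhu_ideal_subspace] subspace_add[OF zhu_ideal_subspace] subspace_scale[OF zhu_ideal_subspace])
next
  case (generator p h u q l v)
  have "u \<in> Vdeg V p" "dV V u \<in> Vbi V (p + 1) h"
    using generator by (auto simp: Vbi_def d_degree d_Vwt)
  then show ?case
    using generator by (simp add: d_residue)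
      (intro subspace_add[OF zhu_ideal_subspace] subspace_scale[OF zhu_ideal_subspace] zhu_ideal_generator)
qed

end

section \<open>The bigrading and subspaces spanned by bidegrees\<close>

context dg_vertex_operator_algebra
begin

sublocale complex: dg_space "scl V" "dV V"
  by unfold_locales (rule d_simps)

definition bi_part :: "int \<times> rat \<Rightarrow> 'a \<Rightarrow> 'a" where
  "bi_part i v = deg_part V (fst i) (wt_part V (snd i) v)"

lemma bi_part_outside: "i \<notin> bidegrees \<Longrightarrow> bi_part i v = 0"
  by (cases i) (auto simp: bi_part_def bidegrees_def component_outside[OF weight_decomposition] component_zero[OF degree_decomposition])

lemma bi_part_support: "finite {i. bi_part i v \<noteq> 0}" and bi_part_sum: "(\<Sum>i | bi_part i v \<noteq> 0. bi_part i v) = v"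
proof -
  define S where "S = {n. wt_part V n v \<noteq> 0}"
  define T where "T = (\<Union>n\<in>S. {p. deg_part V p (wt_part V n v) \<noteq> 0})"
  have fin: "finite S" "finite T"
    using component_finite[OF weight_decomposition] component_finite[OF degree_decomposition] by (auto simp: S_def T_def)
  have sub: "{i. bi_part i v \<noteq> 0} \<subseteq> T \<times> S"
    using component_zero[OF degree_decomposition] by (force simp: S_def T_def bi_part_def)
  show "finite {i. bi_part i v \<noteq> 0}" using sub fin by (simp add: finite_subset)
  have "(\<Sum>i | bi_part i v \<noteq> 0. bi_part i v) = (\<Sum>i\<in>T \<times> S. bi_part i v)"
    using sub fin by (intro sum.mono_neutral_left) auto
  also have "\<dots> = (\<Sum>p\<in>T. \<Sum>n\<in>S. deg_part V p (wt_part V n v))"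
    by (simp add: bi_part_def sum.cartesian_product split_def)
  also have "\<dots> = (\<Sum>n\<in>S. \<Sum>p\<in>T. deg_part V p (wt_part V n v))"
    by (rule sum.swap)
  also have "\<dots> = (\<Sum>n\<in>S. wt_part V n v)"
  proof (rule sum.cong[OF refl])
    fix n assume "n \<in> S"
    then have "(\<Sum>p\<in>T. deg_part V p (wt_part V n v))
        = (\<Sum>p | deg_part V p (wt_part V n v) \<noteq> 0. deg_part V p (wt_part V n v))"
      using fin by (intro sum.mono_neutral_right) (auto simp: T_def)
    then show "(\<Sum>p\<in>T. deg_part V p (wt_part V n v)) = wt_part V n v"
      by (simp add: component_sum[OF degree_decomposition])
  qed
  also have "\<dots> = v" by (simp add: S_def component_sum[OF weight_decomposition])
  finally show "(\<Sum>i | bi_part i v \<noteq> 0. bi_part i v) = v" .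
qed

sublocale deg: dg_graded_space "scl V" "dV V" UNIV 1 "deg_part V"
  by unfold_locales (simp_all add: component_add[OF degree_decomposition] component_scale[OF degree_decomposition]
      component_component[OF degree_decomposition] component_finite[OF degree_decomposition] component_sum[OF degree_decomposition] deg_part_d)

sublocale wt: dg_graded_space "scl V" "dV V" half_ints 0 "wt_part V"
  by unfold_locales (simp_all add: component_add[OF weight_decomposition] component_scale[OF weight_decomposition]
      component_component[OF weight_decomposition] component_finite[OF weight_decomposition] component_sum[OF weight_decomposition]
      component_outside[OF weight_decomposition] wt_part_d)

sublocale bi: dg_graded_space "scl V" "dV V" bidegrees "(1, 0)" bi_part
proof unfold_locales
  show "bi_part i (bi_part j x) = (if i = j then bi_part i x else 0)" for i j x
    by (cases i; cases j) (auto simp: bi_part_def deg_part_wt_part component_component[OF weight_decomposition]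
        component_component[OF degree_decomposition] component_zero[OF weight_decomposition] component_zero[OF degree_decomposition])
  show "bi_part (i + (1, 0)) (dV V x) = dV V (bi_part i x)" for i x
    by (cases i) (simp add: bi_part_def wt_part_d deg_part_d)
qed (auto simp: bidegrees_def zero_prod_def bi_part_outside[unfolded bidegrees_def] bi_part_support bi_part_sum,
    auto simp: bi_part_def component_add[OF weight_decomposition] component_add[OF degree_decomposition]
      component_scale[OF weight_decomposition] component_scale[OF degree_decomposition])

text \<open>The steps of the filtrations of \<open>V\<close>, and the preimages in \<open>V\<close> of filtration steps of its quotients, have this form: \<open>D\<close> is
the set of bidegrees allowed in the step, and \<open>L\<close> is empty or the subspace by which the quotient is taken.\<close>

definition below :: "'a set \<Rightarrow> (int \<times> rat) set \<Rightarrow> 'a set" where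
  "below L D = span (L \<union> (\<Union>(p, n)\<in>D \<inter> bidegrees. Vbi V p n))"

lemma below_subspace [simp]: "subspace (below L D)"
  by (simp add: below_def)

lemma below_superset: "L \<subseteq> below L D"
  unfolding below_def using span_superset by blast

lemma Vbi_below: "n \<in> half_ints \<Longrightarrow> (p, n) \<in> D \<Longrightarrow> Vbi V p n \<subseteq> below L D"
  unfolding below_def by (intro subsetI span_base) (auto simp: bidegrees_def)

lemma below_mono: "L \<subseteq> L' \<Longrightarrow> D \<inter> bidegrees \<subseteq> D' \<Longrightarrow> below L D \<subseteq> below L' D'"
  unfolding below_def by (intro span_mono) blast

lemma below_minimal:
  assumes "subspace W" "L \<subseteq> W" "\<And>p n. n \<in> half_ints \<Longrightarrow> (p, n) \<in> D \<Longrightarrow> Vbi V p n \<subseteq> W"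
  shows "below L D \<subseteq> W"
  unfolding below_def by (intro span_minimal assms(1)) (use assms(2,3) in \<open>auto simp: bidegrees_def\<close>)

lemma bi_part_mem: "n \<in> half_ints \<Longrightarrow> bi_part (p, n) v \<in> Vbi V p n"
  by (simp add: bi_part_def Vbi_def component_mem[OF degree_decomposition] deg_part_Vwt component_mem[OF weight_decomposition])

lemma bi_part_homogeneous:
  assumes "n \<in> half_ints" "v \<in> Vbi V p n"
  shows "bi_part i v = (if i = (p, n) then v else 0)"
  using assms component_of_homogeneous[OF weight_decomposition, of n v] component_of_homogeneous[OF degree_decomposition, of p v]
  by (cases i) (auto simp: bi_part_def Vbi_def component_zero[OF degree_decomposition])

text \<open>Membership in such a span is a condition on components, which turns the inclusions between filtration
steps into inclusions of sets of bidegrees.\<close>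

lemma below_empty_iff: "v \<in> below {} D \<longleftrightarrow> (\<forall>i. bi_part i v \<noteq> 0 \<longrightarrow> i \<in> D)"
proof
  assume v: "\<forall>i. bi_part i v \<noteq> 0 \<longrightarrow> i \<in> D"
  have "(\<Sum>i | bi_part i v \<noteq> 0. bi_part i v) \<in> below {} D"
  proof (rule subspace_sum[OF below_subspace])
    fix i assume i: "i \<in> {i. bi_part i v \<noteq> 0}"
    obtain p n where pn: "i = (p, n)" by (cases i)
    have "i \<in> bidegrees" using i bi_part_outside[of i v] by blast
    then have "n \<in> half_ints" "(p, n) \<in> D" using i v by (auto simp: pn bidegrees_def)
    then show "bi_part i v \<in> below {} D"
      unfolding pn using Vbi_below[of n p D "{}"] bi_part_mem[of n p v] by blast
  qed
  then show "v \<in> below {} D" by (simp add: bi_part_sum)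
next
  assume v: "v \<in> below {} D"
  have "below {} D \<subseteq> {v. \<forall>i. bi_part i v \<noteq> 0 \<longrightarrow> i \<in> D}"
  proof (rule below_minimal)
    show "subspace {v. \<forall>i. bi_part i v \<noteq> 0 \<longrightarrow> i \<in> D}"
      by (rule subspaceI) (auto simp: bi.pr_add bi.pr_scale bi.pr_0, metis add.right_neutral)
    show "Vbi V p n \<subseteq> {v. \<forall>i. bi_part i v \<noteq> 0 \<longrightarrow> i \<in> D}" if "n \<in> half_ints" "(p, n) \<in> D" for p n
      using that by (auto simp: bi_part_homogeneous split: if_splits)
  qed auto
  then show "\<forall>i. bi_part i v \<noteq> 0 \<longrightarrow> i \<in> D" using v by blast
qed

lemma Vdeg_below: "Vdeg V p = below {} {i. fst i = p}"
proof
  show "Vdeg V p \<subseteq> below {} {i. fst i = p}"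
  proof
    fix v assume "v \<in> Vdeg V p"
    then have "bi_part i v = (if fst i = p then wt_part V (snd i) v else 0)" for i
      using component_of_homogeneous[OF degree_decomposition, of p v "fst i"]
      by (simp add: bi_part_def deg_part_wt_part component_zero[OF weight_decomposition])
    then show "v \<in> below {} {i. fst i = p}" by (auto simp: below_empty_iff)
  qed
  show "below {} {i. fst i = p} \<subseteq> Vdeg V p"
    by (rule below_minimal[OF Vdeg_subspace]) (auto simp: Vbi_def)
qed

lemma Vwt_below: "n \<in> half_ints \<Longrightarrow> Vwt V n = below {} {i. snd i = n}"
proof
  assume n: "n \<in> half_ints"
  show "Vwt V n \<subseteq> below {} {i. snd i = n}"
  proof
    fix v assume "v \<in> Vwt V n"
    then have "bi_part i v = (if snd i = n then deg_part V (fst i) v else 0)" for i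
      using component_of_homogeneous[OF weight_decomposition n, of v "snd i"]
      by (simp add: bi_part_def component_zero[OF degree_decomposition])
    then show "v \<in> below {} {i. snd i = n}" by (auto simp: below_empty_iff)
  qed
  show "below {} {i. snd i = n} \<subseteq> Vwt V n"
    by (rule below_minimal[OF Vwt_subspace[OF n]]) (auto simp: Vbi_def)
qed

lemma deg_le_below: "deg_le V p = below {} {i. fst i \<le> p}"
proof
  show "deg_le V p \<subseteq> below {} {i. fst i \<le> p}"
    unfolding deg_le_def Vdeg_below by (intro span_minimal UN_least below_mono below_subspace) auto
  show "below {} {i. fst i \<le> p} \<subseteq> deg_le V p"
    unfolding deg_le_def by (rule below_minimal) (auto intro!: span_base simp: Vbi_def)
qed

lemma wt_le_below: "wt_le V n = below {} {i. snd i \<le> n}"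
proof
  show "wt_le V n \<subseteq> below {} {i. snd i \<le> n}"
    unfolding wt_le_def
  proof (intro span_minimal UN_least below_subspace)
    fix m assume "m \<in> half_ints \<inter> {..n}"
    then show "Vwt V m \<subseteq> below {} {i. snd i \<le> n}"
      by (simp add: Vwt_below) (rule below_mono, auto)
  qed
  show "below {} {i. snd i \<le> n} \<subseteq> wt_le V n"
    unfolding wt_le_def by (rule below_minimal) (auto intro!: span_base simp: Vbi_def)
qed

lemma below_add: "subspace L \<Longrightarrow> below L D = {l + w |l w. l \<in> L \<and> w \<in> below {} D}"
  unfolding below_def span_Un Un_empty_left by (metis span_eq_iff)

lemma quotient_image_below:
  assumes "quotient_map \<rho> M L" "subspace L"
  shows "\<rho> ` below L D = \<rho> ` below {} D"
proof
  show "\<rho> ` below L D \<subseteq> \<rho> ` below {} D"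
  proof
    fix z assume "z \<in> \<rho> ` below L D"
    then obtain l w where lw: "l \<in> L" "w \<in> below {} D" "z = \<rho> (l + w)" by (auto simp: below_add[OF assms(2)])
    have "\<rho> (l + w) = \<rho> w" using lw(1) by (simp add: quotient_mapD(2)[OF assms(1)])
    then show "z \<in> \<rho> ` below {} D" using lw by auto
  qed
qed (intro image_mono below_mono, auto)

lemma below_d:
  assumes "x \<in> below L D" "\<And>x. x \<in> L \<Longrightarrow> dV V x \<in> L" "\<And>p n. (p, n) \<in> D \<Longrightarrow> (p + 1, n) \<in> D'"
  shows "dV V x \<in> below L D'"
proof -
  have "below L D \<subseteq> {x. dV V x \<in> below L D'}"
  proof (rule below_minimal)
    show "subspace {x. dV V x \<in> below L D'}"
      by (rule subspaceI) (auto simp: d_simps d_scale subspace_0 subspace_add subspace_scale)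
    show "L \<subseteq> {x. dV V x \<in> below L D'}" using assms(2) below_superset by blast
    show "Vbi V p n \<subseteq> {x. dV V x \<in> below L D'}" if "n \<in> half_ints" "(p, n) \<in> D" for p n
    proof
      fix x assume "x \<in> Vbi V p n"
      then have "dV V x \<in> Vbi V (p + 1) n" by (simp add: Vbi_def d_degree d_Vwt)
      then show "x \<in> {x. dV V x \<in> below L D'}" using Vbi_below[OF that(1) assms(3)[OF that(2)]] by blast
    qed
  qed
  then show ?thesis using assms(1) by blast
qed

lemma below_bilinear:
  assumes \<mu>: "biadditive \<mu>" "\<And>c x y. \<mu> (scl V c x) y = scl V c (\<mu> x y)" "\<And>c x y. \<mu> x (scl V c y) = scl V c (\<mu> x y)"
    and W: "subspace W" "\<And>x y. x \<in> L \<Longrightarrow> \<mu> x y \<in> W" "\<And>x y. y \<in> L \<Longrightarrow> \<mu> x y \<in> W"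
    and bi: "\<And>p n u q m v. n \<in> half_ints \<Longrightarrow> (p, n) \<in> D \<Longrightarrow> u \<in> Vbi V p n \<Longrightarrow>
      m \<in> half_ints \<Longrightarrow> (q, m) \<in> D' \<Longrightarrow> v \<in> Vbi V q m \<Longrightarrow> \<mu> u v \<in> W"
    and xy: "x \<in> below L D" "y \<in> below L D'"
  shows "\<mu> x y \<in> W"
proof -
  have subspaces: "subspace {x. \<mu> x y \<in> W}" "subspace {y. \<mu> x y \<in> W}" for x y
    by (auto intro!: subspaceI simp: biadditiveD[OF \<mu>(1)] \<mu>(2,3)
        intro: subspace_0[OF W(1)] subspace_add[OF W(1)] subspace_scale[OF W(1)])
  have "below L D \<subseteq> {x. \<mu> x y \<in> W}"
  proof (rule below_minimal[OF subspaces(1)])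
    show "L \<subseteq> {x. \<mu> x y \<in> W}" using W(2) by blast
    show "Vbi V p n \<subseteq> {x. \<mu> x y \<in> W}" if n: "n \<in> half_ints" "(p, n) \<in> D" for p n
    proof
      fix u assume u: "u \<in> Vbi V p n"
      have "below L D' \<subseteq> {y. \<mu> u y \<in> W}"
        by (rule below_minimal[OF subspaces(2)]) (use W(3) bi[OF n u] in auto)
      then show "u \<in> {x. \<mu> x y \<in> W}" using xy(2) by blast
    qed
  qed
  then show ?thesis using xy(1) by blast
qed

lemma biadditive_zhu_mode: "biadditive (zhu_mode \<epsilon> k)"
  by (auto simp: biadditive_def zhu_mode_add)

lemma zhu_mode_below:
  assumes "x \<in> below L D" "y \<in> below L D'" "ideal_for (zhu_mode \<epsilon> (-1)) L"
    and "\<And>p n q m k. (p, n) \<in> D \<Longrightarrow> (q, m) \<in> D' \<Longrightarrow> (p + q - 2 * int k, n + m - of_nat k) \<in> D''"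
  shows "zhu_mode \<epsilon> (-1) x y \<in> below L D''"
proof (rule below_bilinear[OF biadditive_zhu_mode zhu_mode_scale below_subspace _ _ _ assms(1,2)])
  show "zhu_mode \<epsilon> (-1) x y \<in> below L D''" if "x \<in> L" for x y
    using assms(3) that below_superset[of L D''] unfolding ideal_for_def by blast
  show "zhu_mode \<epsilon> (-1) x y \<in> below L D''" if "y \<in> L" for x y
    using assms(3) that below_superset[of L D''] unfolding ideal_for_def by blast
  show "zhu_mode \<epsilon> (-1) u v \<in> below L D''"
    if "n \<in> half_ints" "(p, n) \<in> D" "u \<in> Vbi V p n" "m \<in> half_ints" "(q, m) \<in> D'" "v \<in> Vbi V q m" for p n u q m v
  proof (rule zhu_mode_Vbi[OF below_subspace that(1,3,6)])
    fix k
    have "Vbi V (p + q - 2 * int k) (n + m - of_nat k) \<subseteq> below L D''"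
      by (rule Vbi_below) (use that assms(4)[OF that(2,5)] in simp_all)
    then show "Vbi V (p + q - 2 * - 1 - 2 - 2 * int k) (n + m - of_int (- 1) - 1 - of_nat k) \<subseteq> below L D''"
      by simp
  qed
qed

lemma zhu_mode_leading_below:
  assumes "x \<in> below {} D" "y \<in> below {} D'"
    and "\<And>p n q m k. (p, n) \<in> D \<Longrightarrow> (q, m) \<in> D' \<Longrightarrow> k > 0 \<Longrightarrow> (p + q - 2 * int k, n + m - of_nat k) \<in> D''"
  shows "zhu_mode \<epsilon> (-1) x y - mode V x (-1) y \<in> below L D''"
proof (rule below_bilinear[where \<mu> = "\<lambda>x y. zhu_mode \<epsilon> (-1) x y - mode V x (-1) y", OF _ _ _ below_subspace _ _ _ assms(1,2)])
  show "zhu_mode \<epsilon> (-1) u v - mode V u (-1) v \<in> below L D''"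
    if "n \<in> half_ints" "(p, n) \<in> D" "u \<in> Vbi V p n" "m \<in> half_ints" "(q, m) \<in> D'" "v \<in> Vbi V q m" for p n u q m v
  proof (rule zhu_mode_leading[OF below_subspace that(1,3,6)])
    fix k :: nat assume "k > 0"
    then have "Vbi V (p + q - 2 * int k) (n + m - of_nat k) \<subseteq> below L D''"
      by (intro Vbi_below) (use that assms(3)[OF that(2,5)] in simp_all)
    then show "Vbi V (p + q - 2 * - 1 - 2 - 2 * int k) (n + m - of_int (- 1) - 1 - of_nat k) \<subseteq> below L D''"
      by simp
  qed
qed (auto simp: biadditive_def zhu_mode_add mode_simps zhu_mode_scale mode_scale scale_right_diff_distrib)

end

section \<open>The filtrations as subspaces of V\<close>

context dg_vertex_operator_algebra
begin

lemma mode_eq: "(\<lambda>u. mode V u k) = zhu_mode 0 k"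
  by (intro ext) (simp add: zhu_mode_0)

lemma star_eq: "star V = zhu_mode 1 (-1)"
  by (intro ext) (simp add: star_def zhu_mode_1)

lemma O_sub_eq: "O_sub V = zhu_ideal 1"
  by (simp add: O_sub_def zhu_ideal_def circ_def zhu_mode_1)

lemma C2_eq: "C2 V = zhu_ideal 0"
  by (simp add: C2_def zhu_ideal_def zhu_mode_0)

lemma zhu_ideal_ideal: "ideal_for (zhu_mode \<epsilon> (-1)) (zhu_ideal \<epsilon>)"
  by (simp add: ideal_for_def zhu_ideal_left zhu_ideal_right)

lemma zhu_ideal_d_subset: "dV V ` zhu_ideal \<epsilon> \<subseteq> zhu_ideal \<epsilon>"
  using zhu_ideal_d by blast

lemma quotient_map_alg_on: "quotient_map (\<lambda>x. x) (alg_on V \<mu>) {0}"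
  and compatible_alg_on: "complex.compatible (\<lambda>x. x) (alg_on V \<mu>)"
  by (auto simp: quotient_map_def alg_on_def complex.compatible_def)

text \<open>For \<open>\<mu> u v = u\<^sub>-\<^sub>1 v\<close> and \<open>N = C\<^sub>2\<close> this is \<open>R\<close>; for \<open>\<mu> = \<ast>\<close> and \<open>N = O\<close> it is \<open>A\<close>.\<close>

lemma alg_quotient:
  assumes "subspace N" "biadditive \<mu>" "ideal_for \<mu> N" "dV V ` N \<subseteq> N"
  defines "\<pi> \<equiv> (\<lambda>v. N +>\<^bsub>alg_on V \<mu>\<^esub> v)"
  shows "quotient_map \<pi> (dg_quot (alg_on V \<mu>) N) N"
    "complex.compatible \<pi> (dg_quot (alg_on V \<mu>) N)"
    "\<pi> u \<otimes>\<^bsub>dg_quot (alg_on V \<mu>) N\<^esub> \<pi> v = \<pi> (\<mu> u v)"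
    "\<pi> v = {w. w - v \<in> N}"
proof -
  have N: "{0} \<subseteq> N" using subspace_0[OF assms(1)] by simp
  note q = quotient_map_alg_on[of \<mu>]
  show "quotient_map \<pi> (dg_quot (alg_on V \<mu>) N) N"
    using complex.quotient_map_dg_quot[OF q assms(1) N] by (simp add: \<pi>_def)
  show "complex.compatible \<pi> (dg_quot (alg_on V \<mu>) N)"
    using complex.compatible_dg_quot[OF q assms(1) N compatible_alg_on] assms(4) by (auto simp: \<pi>_def)
  have "u \<otimes>\<^bsub>alg_on V \<mu>\<^esub> v = \<mu> u v" for u v by (simp add: alg_on_def)
  then show "\<pi> u \<otimes>\<^bsub>dg_quot (alg_on V \<mu>) N\<^esub> \<pi> v = \<pi> (\<mu> u v)"
    using complex.mult_dg_quot[OF q assms(1) N assms(2,3)] by (simp add: \<pi>_def)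
  show "\<pi> v = {w. w - v \<in> N}"
    using complex.coset_image[OF q, of N v] by (simp add: \<pi>_def)
qed

lemma R_alg_eq: "R_alg V = dg_quot (alg_on V (zhu_mode 0 (-1))) (zhu_ideal 0)"
  and V_C2_eq: "V_C2 V = alg_on V (zhu_mode 0 (-1))"
  and A_alg_eq: "A_alg V = dg_quot (alg_on V (zhu_mode 1 (-1))) (zhu_ideal 1)"
  and A_class_eq: "A_class V = (\<lambda>v. zhu_ideal 1 +>\<^bsub>alg_on V (zhu_mode 1 (-1))\<^esub> v)"
  and V_zhu_eq: "V_zhu V = alg_on V (zhu_mode 1 (-1))"
  by (simp_all add: R_alg_def V_C2_def C2_eq mode_eq A_alg_def V_zhu_def star_eq O_sub_eq A_class_def fun_eq_iff)

lemmas A_quotient = alg_quotient[OF zhu_ideal_subspace biadditive_zhu_mode zhu_ideal_ideal zhu_ideal_d_subset,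
    of 1, folded A_alg_eq A_class_eq]

text \<open>The case \<open>a = \<one>\<close> of \<open>base_change\<close>: the vacuum is a right unit because \<open>u\<^sub>-\<^sub>1 \<one> = u\<close>.\<close>

lemma eta_quotient:
  assumes \<sigma>: "quotient_map \<sigma> B K" "complex.compatible \<sigma> B"
      "\<And>u v. \<sigma> u \<otimes>\<^bsub>B\<^esub> \<sigma> v = \<sigma> (zhu_mode 0 (-1) u v)"
    and K: "zhu_ideal 0 \<subseteq> K" and \<eta>: "\<eta> = (\<lambda>r. the_elem (\<sigma> ` r))"
  shows "quotient_map (eta_class V B \<eta>) (eta_mod (R_alg V) B \<eta>) K"
    "complex.compatible (eta_class V B \<eta>) (eta_mod (R_alg V) B \<eta>)"
    "eta_act (R_alg V) B \<eta> (\<sigma> u) (eta_class V B \<eta> v) = eta_class V B \<eta> (zhu_mode 0 (-1) u v)"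
    "the_elem (\<sigma> ` \<Union>(eta_class V B \<eta> v)) = \<sigma> v"
proof -
  note R = alg_quotient[OF zhu_ideal_subspace biadditive_zhu_mode zhu_ideal_ideal zhu_ideal_d_subset,
    of 0, folded R_alg_eq]
  have one: "zhu_mode 0 (-1) u (vac V) = u" for u by (simp add: zhu_mode_0 creation_constant)
  have cl: "eta_class V B \<eta> = (\<lambda>v. ker_sub (R_alg V) B \<eta> +>\<^bsub>R_alg V\<^esub> (zhu_ideal 0 +>\<^bsub>alg_on V (zhu_mode 0 (-1))\<^esub> v))"
    by (intro ext) (simp add: eta_class_def C2_eq V_C2_eq)
  note b = complex.base_change[OF R(1,2,4) biadditive_zhu_mode one R(3) \<sigma> K \<eta>]
  show "quotient_map (eta_class V B \<eta>) (eta_mod (R_alg V) B \<eta>) K" unfolding cl by (rule b(1))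
  show "complex.compatible (eta_class V B \<eta>) (eta_mod (R_alg V) B \<eta>)" unfolding cl by (rule b(2))
  show "eta_act (R_alg V) B \<eta> (\<sigma> u) (eta_class V B \<eta> v) = eta_class V B \<eta> (zhu_mode 0 (-1) u v)"
    unfolding cl by (rule b(3))
  show "the_elem (\<sigma> ` \<Union>(eta_class V B \<eta> v)) = \<sigma> v" unfolding cl by (rule b(4))
qed

lemma deg_filtered:
  assumes "quotient_map \<rho> M L" "subspace L" "\<And>p. H p = \<rho> ` deg_le V p"
  shows "deg.filtered \<rho> M L (deg_le V) (\<lambda>p. below L {i. fst i < p}) H (below_deg H)"
  unfolding deg.filtered_def
proof (intro conjI ballI subsetI)
  fix p
  have "{i. fst i \<le> p - 1} = {i :: int \<times> rat. fst i < p}" by auto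
  then show "below_deg H p = \<rho> ` below L {i. fst i < p}"
    using quotient_image_below[OF assms(1,2)] by (simp add: below_deg_def assms(3) deg_le_below)
  show "x \<in> deg_le V p" if "x \<in> range (deg_part V p)" for x
  proof -
    have "x \<in> Vdeg V p" using that component_range[OF degree_decomposition] by auto
    then show ?thesis unfolding deg_le_def by (intro span_base) auto
  qed
  show "x - deg_part V p x \<in> below L {i. fst i < p}" if "x \<in> deg_le V p" for x
  proof -
    have "bi_part i (x - deg_part V p x) = (if fst i = p then 0 else bi_part i x)" for i
      by (simp add: bi.pr_minus) (simp add: bi_part_def deg_part_wt_part component_component[OF degree_decomposition] component_zero[OF weight_decomposition])
    then have "x - deg_part V p x \<in> below {} {i. fst i < p}"
      using that by (auto simp: deg_le_below below_empty_iff)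
    then show ?thesis using below_mono[of "{}" L] by auto
  qed
qed (use assms in \<open>auto intro: subsetD[OF below_superset]\<close>)

lemma wt_filtered:
  assumes "quotient_map \<rho> M L" "subspace L" "\<And>n. H n = \<rho> ` wt_le V n"
  shows "wt.filtered \<rho> M L (wt_le V) (\<lambda>n. below L {i. snd i < n}) H (below_wt H)"
  unfolding wt.filtered_def
proof (intro conjI ballI subsetI)
  fix n :: rat assume n: "n \<in> half_ints"
  have "below_wt H n = H (n - 1/2)"
  proof
    show "below_wt H n \<subseteq> H (n - 1/2)"
      unfolding below_wt_def assms(3) wt_le_below
      by (intro UN_least image_mono below_mono) (use n in \<open>auto simp: less_half_ints bidegrees_def\<close>)
    show "H (n - 1/2) \<subseteq> below_wt H n"
      unfolding below_wt_def using n by (intro UN_upper) auto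
  qed
  moreover have "below {} {i. snd i \<le> n - 1/2} = below {} {i. snd i < n}"
    by (intro equalityI below_mono) (use n less_half_ints in \<open>auto simp: bidegrees_def\<close>)
  ultimately show "below_wt H n = \<rho> ` below L {i. snd i < n}"
    using quotient_image_below[OF assms(1,2)] by (simp add: assms(3) wt_le_below)
  show "x \<in> wt_le V n" if "x \<in> range (wt_part V n)" for x
  proof -
    have "x \<in> Vwt V n" using that n component_range[OF weight_decomposition] by auto
    then show ?thesis unfolding wt_le_def using n by (intro span_base) auto
  qed
  show "x - wt_part V n x \<in> below L {i. snd i < n}" if "x \<in> wt_le V n" for x
  proof -
    have "bi_part i (x - wt_part V n x) = (if snd i = n then 0 else bi_part i x)" for i
      by (simp add: bi.pr_minus) (simp add: bi_part_def component_component[OF weight_decomposition] component_zero[OF degree_decomposition])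
    then have "x - wt_part V n x \<in> below {} {i. snd i < n}"
      using that by (auto simp: wt_le_below below_empty_iff less_le)
    then show ?thesis using below_mono[of "{}" L] by auto
  qed
qed (use assms in \<open>auto intro: subsetD[OF below_superset]\<close>)

definition lower :: "int \<times> rat \<Rightarrow> (int \<times> rat) set" where
  "lower i = {j. fst j \<le> fst i \<and> snd j < snd i \<or> fst j < fst i \<and> snd j \<le> snd i}"

lemma I_sub_eq: "I_sub V i = below (zhu_ideal 1) (lower i)"
proof (cases i)
  case (Pair p n)
  have "zhu_ideal 1 \<union> (\<Union>q\<in>{..p}. \<Union>m\<in>half_ints \<inter> {..<n}. Vbi V q m) \<union> (\<Union>q\<in>{..<p}. \<Union>m\<in>half_ints \<inter> {..n}. Vbi V q m)
    = zhu_ideal 1 \<union> (\<Union>(p, n)\<in>lower i \<inter> bidegrees. Vbi V p n)"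
    unfolding lower_def bidegrees_def Pair by fastforce
  then show ?thesis by (simp add: I_sub_def below_def O_sub_eq Pair)
qed

lemma bi_range: "i \<in> bidegrees \<Longrightarrow> range (bi_part i) = Vbi V (fst i) (snd i)"
proof (intro equalityI subsetI)
  assume i: "i \<in> bidegrees"
  then have n: "snd i \<in> half_ints" by (auto simp: bidegrees_def)
  show "v \<in> Vbi V (fst i) (snd i)" if "v \<in> range (bi_part i)" for v
    using that bi_part_mem[OF n, of "fst i"] by auto
  show "v \<in> range (bi_part i)" if "v \<in> Vbi V (fst i) (snd i)" for v
    using bi_part_homogeneous[OF n that, of i] by (metis prod.collapse rangeI)
qed

text \<open>Here the filtration steps are not nested: the bigraded object is built from \<open>V\<close> itself, with \<open>O\<close> contained
in each \<^const>\<open>I_sub\<close>.\<close>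

lemma bi_filtered:
  "bi.filtered (\<lambda>x. x) (V_zhu V) {0} (\<lambda>(p, n). Vbi V p n) (\<lambda>i. below (zhu_ideal 1) (lower i))
     (\<lambda>(p, n). Vbi V p n) (I_sub V)"
  unfolding bi.filtered_def
proof (intro conjI ballI)
  show "quotient_map (\<lambda>x. x) (V_zhu V) {0}" by (simp add: V_zhu_eq quotient_map_alg_on)
next
  fix i assume i: "i \<in> bidegrees"
  then have n: "snd i \<in> half_ints" by (auto simp: bidegrees_def)
  show "range (bi_part i) \<subseteq> (case i of (p, n) \<Rightarrow> Vbi V p n)" by (simp add: bi_range[OF i] split_def)
  show "x - bi_part i x \<in> below (zhu_ideal 1) (lower i)" if "x \<in> (case i of (p, n) \<Rightarrow> Vbi V p n)" for x
    using bi_part_homogeneous[OF n, of x "fst i" i] that subspace_0[OF below_subspace] by (simp add: split_def)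
qed (auto simp: I_sub_eq subspace_0)

lemma mode_graded:
  "zhu_mode 0 (-1) (deg_part V p u) (deg_part V q v) \<in> range (deg_part V (p + q))"
  "n \<in> half_ints \<Longrightarrow> m \<in> half_ints \<Longrightarrow> zhu_mode 0 (-1) (wt_part V n u) (wt_part V m v) \<in> range (wt_part V (n + m))"
  "i \<in> bidegrees \<Longrightarrow> j \<in> bidegrees \<Longrightarrow> zhu_mode 0 (-1) (bi_part i u) (bi_part j v) \<in> range (bi_part (i + j))"
proof -
  show "zhu_mode 0 (-1) (deg_part V p u) (deg_part V q v) \<in> range (deg_part V (p + q))"
    using mode_degree[of "deg_part V p u" p "deg_part V q v" q "-1"]
    by (simp add: zhu_mode_0 component_range[OF degree_decomposition] component_mem[OF degree_decomposition] add.commute)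
  show "n \<in> half_ints \<Longrightarrow> m \<in> half_ints \<Longrightarrow> zhu_mode 0 (-1) (wt_part V n u) (wt_part V m v) \<in> range (wt_part V (n + m))"
    using mode_weight[of "wt_part V n u" n "wt_part V m v" m "-1"]
    by (simp add: zhu_mode_0 component_range[OF weight_decomposition] component_mem[OF weight_decomposition])
  show "zhu_mode 0 (-1) (bi_part i u) (bi_part j v) \<in> range (bi_part (i + j))" if ij: "i \<in> bidegrees" "j \<in> bidegrees"
  proof -
    have "bi_part i u \<in> Vbi V (fst i) (snd i)" "bi_part j v \<in> Vbi V (fst j) (snd j)"
      using bi_range[OF ij(1)] bi_range[OF ij(2)] by blast+
    from mode_Vbi[OF this, of "-1"] show ?thesis
      by (simp add: zhu_mode_0 bi_range[OF bi.index_add[OF ij]])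
  qed
qed

end

section \<open>The symbol maps and their kernels\<close>

context dg_vertex_operator_algebra
begin

definition kerF :: "'a set" where
  "kerF = deg.symbol_kernel (\<lambda>p. below (zhu_ideal 1) {i. fst i < p})"
definition kerW :: "'a set" where
  "kerW = wt.symbol_kernel (\<lambda>n. below (zhu_ideal 1) {i. snd i < n})"
definition kerFW :: "'a set" where
  "kerFW = bi.symbol_kernel (\<lambda>i. below (zhu_ideal 1) (lower i))"

lemma symb_eq:
  "symbF V = deg.symbol (A_alg V) (below_deg (FA V)) (A_class V)"
  "symbW V = wt.symbol (A_alg V) (below_wt (WA V)) (A_class V)"
  "symbFW V = bi.symbol (V_zhu V) (I_sub V) (\<lambda>x. x)"
  by (auto simp: fun_eq_iff symbF_def deg.symbol_def symbW_def wt.symbol_def symbFW_def bi.symbol_def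
      restrict_def bi_part_def split_def)

lemma filteredF: "deg.filtered (A_class V) (A_alg V) (zhu_ideal 1) (deg_le V)
    (\<lambda>p. below (zhu_ideal 1) {i. fst i < p}) (FA V) (below_deg (FA V))"
  by (rule deg_filtered[OF A_quotient(1) zhu_ideal_subspace]) (simp add: FA_def)

lemma filteredW: "wt.filtered (A_class V) (A_alg V) (zhu_ideal 1) (wt_le V)
    (\<lambda>n. below (zhu_ideal 1) {i. snd i < n}) (WA V) (below_wt (WA V))"
  by (rule wt_filtered[OF A_quotient(1) zhu_ideal_subspace]) (simp add: WA_def)

lemma below_mode_deg:
  assumes "ideal_for (zhu_mode \<epsilon> (-1)) L"
  shows "x \<in> below L {i. fst i < p} \<Longrightarrow> y \<in> below L {i. fst i \<le> q} \<Longrightarrow>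
      zhu_mode \<epsilon> (-1) x y \<in> below L {i. fst i < p + q}"
    "x \<in> below L {i. fst i \<le> p} \<Longrightarrow> y \<in> below L {i. fst i < q} \<Longrightarrow>
      zhu_mode \<epsilon> (-1) x y \<in> below L {i. fst i < p + q}"
proof -
  show "x \<in> below L {i. fst i < p} \<Longrightarrow> y \<in> below L {i. fst i \<le> q} \<Longrightarrow>
      zhu_mode \<epsilon> (-1) x y \<in> below L {i. fst i < p + q}"
    by (erule (1) zhu_mode_below[OF _ _ assms]) auto
  show "x \<in> below L {i. fst i \<le> p} \<Longrightarrow> y \<in> below L {i. fst i < q} \<Longrightarrow>
      zhu_mode \<epsilon> (-1) x y \<in> below L {i. fst i < p + q}"
    by (erule (1) zhu_mode_below[OF _ _ assms]) auto
qed

lemma below_mode_wt: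
  assumes "ideal_for (zhu_mode \<epsilon> (-1)) L"
  shows "x \<in> below L {i. snd i < p} \<Longrightarrow> y \<in> below L {i. snd i \<le> q} \<Longrightarrow>
      zhu_mode \<epsilon> (-1) x y \<in> below L {i. snd i < p + q}"
    "x \<in> below L {i. snd i \<le> p} \<Longrightarrow> y \<in> below L {i. snd i < q} \<Longrightarrow>
      zhu_mode \<epsilon> (-1) x y \<in> below L {i. snd i < p + q}"
proof -
  show "x \<in> below L {i. snd i < p} \<Longrightarrow> y \<in> below L {i. snd i \<le> q} \<Longrightarrow>
      zhu_mode \<epsilon> (-1) x y \<in> below L {i. snd i < p + q}"
    by (erule (1) zhu_mode_below[OF _ _ assms]) fastforce
  show "x \<in> below L {i. snd i \<le> p} \<Longrightarrow> y \<in> below L {i. snd i < q} \<Longrightarrow>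
      zhu_mode \<epsilon> (-1) x y \<in> below L {i. snd i < p + q}"
    by (erule (1) zhu_mode_below[OF _ _ assms]) fastforce
qed

lemma deg_part_below: "deg_part V p x \<in> below L {i. fst i \<le> p}"
proof -
  have "deg_part V p x \<in> below {} {i. fst i = p}"
    using component_mem[OF degree_decomposition] by (simp flip: Vdeg_below)
  then show ?thesis using below_mono[of "{}" L "{i. fst i = p}" "{i. fst i \<le> p}"] by auto
qed

lemma wt_part_below: "n \<in> half_ints \<Longrightarrow> wt_part V n x \<in> below L {i. snd i \<le> n}"
proof -
  assume n: "n \<in> half_ints"
  then have "wt_part V n x \<in> below {} {i. snd i = n}"
    using component_mem[OF weight_decomposition] by (simp flip: Vwt_below)
  then show ?thesis using below_mono[of "{}" L "{i. snd i = n}" "{i. snd i \<le> n}"] by auto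
qed

lemma bi_part_below: "i \<in> bidegrees \<Longrightarrow> bi_part i x \<in> below L {i}"
  using Vbi_below[of "snd i" "fst i" "{i}" L] bi_part_mem[of "snd i" "fst i" x] by (auto simp: bidegrees_def)

text \<open>The product \<open>\<ast>\<close> induces on symbols the product \<open>u\<^sub>-\<^sub>1 v\<close>, because the difference has smaller degree.\<close>

lemma grF_A_quotient:
  "quotient_map (symbF V) (grF_A V) kerF" "complex.compatible (symbF V) (grF_A V)"
  "symbF V u \<otimes>\<^bsub>grF_A V\<^esub> symbF V v = symbF V (zhu_mode 0 (-1) u v)"
proof -
  have gr: "grF_A V = gr_obj UNIV 1 (A_alg V) (FA V) (below_deg (FA V))" by (simp add: grF_A_def gr_deg_def)
  show "quotient_map (symbF V) (grF_A V) kerF"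
    unfolding gr kerF_def symb_eq by (rule deg.quotient_map_symbol[OF filteredF])
  show "complex.compatible (symbF V) (grF_A V)"
    unfolding gr symb_eq
    by (rule deg.compatible_symbol[OF filteredF A_quotient(2)]) (auto elim!: below_d zhu_ideal_d)
  have "gr_bilinear UNIV (FA V) (below_deg (FA V)) (FA V) (A_alg V) (below_deg (FA V)) (monoid.mult (A_alg V))
      (symbF V u) (symbF V v) = symbF V (zhu_mode 0 (-1) u v)"
    unfolding symb_eq
  proof (rule deg.gr_bilinear_symbol[OF filteredF filteredF filteredF A_quotient(3) biadditive_zhu_mode
        biadditive_zhu_mode mode_graded(1), where P = "\<lambda>p. below (zhu_ideal 1) {i. fst i \<le> p}"])
    fix p q u v
    have "deg_part V r w \<in> below {} {i. fst i = r}" for r w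
      using component_mem[OF degree_decomposition] by (simp flip: Vdeg_below)
    from zhu_mode_leading_below[OF this this]
    show "zhu_mode 1 (-1) (deg_part V p u) (deg_part V q v) - zhu_mode 0 (-1) (deg_part V p u) (deg_part V q v)
        \<in> below (zhu_ideal 1) {i. fst i < p + q}"
      by (simp add: zhu_mode_0)
  next
    show "below (zhu_ideal 1) {i. fst i < p} \<subseteq> below (zhu_ideal 1) {i. fst i \<le> p}" for p
      by (rule below_mono) auto
  qed (rule below_subspace deg_part_below below_mode_deg[OF zhu_ideal_ideal] | assumption)+
  then show "symbF V u \<otimes>\<^bsub>grF_A V\<^esub> symbF V v = symbF V (zhu_mode 0 (-1) u v)"
    by (simp add: gr gr_obj_def)
qed

lemma grW_A_quotient:
  "quotient_map (symbW V) (grW_A V) kerW" "complex.compatible (symbW V) (grW_A V)"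
  "symbW V u \<otimes>\<^bsub>grW_A V\<^esub> symbW V v = symbW V (zhu_mode 0 (-1) u v)"
proof -
  have gr: "grW_A V = gr_obj half_ints 0 (A_alg V) (WA V) (below_wt (WA V))" by (simp add: grW_A_def gr_wt_def)
  show "quotient_map (symbW V) (grW_A V) kerW"
    unfolding gr kerW_def symb_eq by (rule wt.quotient_map_symbol[OF filteredW])
  show "complex.compatible (symbW V) (grW_A V)"
    unfolding gr symb_eq
    by (rule wt.compatible_symbol[OF filteredW A_quotient(2)]) (auto elim!: below_d zhu_ideal_d)
  have "gr_bilinear half_ints (WA V) (below_wt (WA V)) (WA V) (A_alg V) (below_wt (WA V)) (monoid.mult (A_alg V))
      (symbW V u) (symbW V v) = symbW V (zhu_mode 0 (-1) u v)"
    unfolding symb_eq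
  proof (rule wt.gr_bilinear_symbol[OF filteredW filteredW filteredW A_quotient(3) biadditive_zhu_mode
        biadditive_zhu_mode mode_graded(2), where P = "\<lambda>p. below (zhu_ideal 1) {i. snd i \<le> p}"])
    fix n m u v assume nm: "n \<in> half_ints" "m \<in> half_ints"
    have "wt_part V r w \<in> below {} {i. snd i = r}" if "r \<in> half_ints" for r w
      using component_mem[OF weight_decomposition that] that by (simp flip: Vwt_below)
    from zhu_mode_leading_below[OF this this] nm
    show "zhu_mode 1 (-1) (wt_part V n u) (wt_part V m v) - zhu_mode 0 (-1) (wt_part V n u) (wt_part V m v)
        \<in> below (zhu_ideal 1) {i. snd i < n + m}"
      by (simp add: zhu_mode_0)
  next
    show "below (zhu_ideal 1) {i. snd i < p} \<subseteq> below (zhu_ideal 1) {i. snd i \<le> p}" for p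
      by (rule below_mono) auto
  qed (rule below_subspace wt_part_below below_mode_wt[OF zhu_ideal_ideal] | assumption)+
  then show "symbW V u \<otimes>\<^bsub>grW_A V\<^esub> symbW V v = symbW V (zhu_mode 0 (-1) u v)"
    by (simp add: gr gr_obj_def)
qed

lemma grFW_A_quotient:
  "quotient_map (symbFW V) (grFW_A V) kerFW" "complex.compatible (symbFW V) (grFW_A V)"
  "symbFW V u \<otimes>\<^bsub>grFW_A V\<^esub> symbFW V v = symbFW V (zhu_mode 0 (-1) u v)"
proof -
  let ?H = "\<lambda>(p, n). Vbi V p n"
  have gr: "grFW_A V = gr_obj bidegrees (1, 0) (V_zhu V) ?H (I_sub V)" by (simp add: grFW_A_def)
  show "quotient_map (symbFW V) (grFW_A V) kerFW"
    unfolding gr kerFW_def symb_eq by (rule bi.quotient_map_symbol[OF bi_filtered])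
  show "complex.compatible (symbFW V) (grFW_A V)"
    unfolding gr symb_eq
    by (rule bi.compatible_symbol[OF bi_filtered])
      (auto simp: V_zhu_eq compatible_alg_on lower_def elim!: below_d zhu_ideal_d)
  have mult: "x \<otimes>\<^bsub>V_zhu V\<^esub> y = zhu_mode 1 (-1) x y" for x y by (simp add: V_zhu_eq alg_on_def)
  have "gr_bilinear bidegrees ?H (I_sub V) ?H (V_zhu V) (I_sub V) (monoid.mult (V_zhu V))
      (symbFW V u) (symbFW V v) = symbFW V (zhu_mode 0 (-1) u v)"
    unfolding symb_eq
  proof (rule bi.gr_bilinear_symbol[OF bi_filtered bi_filtered bi_filtered mult biadditive_zhu_mode
        biadditive_zhu_mode mode_graded(3),
        where P = "\<lambda>i. below (zhu_ideal 1) {j. fst j \<le> fst i \<and> snd j \<le> snd i}"])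
    fix i j u v assume ij: "i \<in> bidegrees" "j \<in> bidegrees"
    show "zhu_mode 1 (-1) (bi_part i u) (bi_part j v) - zhu_mode 0 (-1) (bi_part i u) (bi_part j v)
        \<in> below (zhu_ideal 1) (lower (i + j))"
      unfolding zhu_mode_0
      by (rule zhu_mode_leading_below[OF bi_part_below[OF ij(1)] bi_part_below[OF ij(2)]]) (auto simp: lower_def)
  next
    fix i j x y
    assume "x \<in> below (zhu_ideal 1) (lower i)" "y \<in> below (zhu_ideal 1) {k. fst k \<le> fst j \<and> snd k \<le> snd j}"
    then show "zhu_mode 1 (-1) x y \<in> below (zhu_ideal 1) (lower (i + j))"
      by (rule zhu_mode_below[OF _ _ zhu_ideal_ideal]) (fastforce simp: lower_def)
  next
    fix i j x y
    assume "x \<in> below (zhu_ideal 1) {k. fst k \<le> fst i \<and> snd k \<le> snd i}" "y \<in> below (zhu_ideal 1) (lower j)"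
    then show "zhu_mode 1 (-1) x y \<in> below (zhu_ideal 1) (lower (i + j))"
      by (rule zhu_mode_below[OF _ _ zhu_ideal_ideal]) (fastforce simp: lower_def)
  next
    fix i show "below (zhu_ideal 1) (lower i) \<subseteq> below (zhu_ideal 1) {k. fst k \<le> fst i \<and> snd k \<le> snd i}"
      by (rule below_mono) (auto simp: lower_def)
  next
    fix i x assume "i \<in> bidegrees"
    then show "bi_part i x \<in> below (zhu_ideal 1) {k. fst k \<le> fst i \<and> snd k \<le> snd i}"
      by (rule subsetD[OF below_mono bi_part_below, rotated 2]) auto
  qed auto
  then show "symbFW V u \<otimes>\<^bsub>grFW_A V\<^esub> symbFW V v = symbFW V (zhu_mode 0 (-1) u v)"
    by (simp add: gr gr_obj_def)
qed

text \<open>The difference of \<open>u\<^sub>-\<^sub>2 v\<close> and \<open>u \<circ> v\<close> has smaller degree and smaller weight, and \<open>u \<circ> v\<close> is in \<open>O\<close>.\<close>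

lemma mode_minus_2_lower:
  assumes "h \<in> half_ints" "u \<in> Vbi V p h" "l \<in> half_ints" "v \<in> Vbi V q l"
  shows "mode V u (-2) v \<in> Vbi V (p + q + 2) (h + l + 1)"
    "mode V u (-2) v \<in> below (zhu_ideal 1) {i. fst i < p + q + 2 \<and> snd i < h + l + 1}"
proof -
  show "mode V u (-2) v \<in> Vbi V (p + q + 2) (h + l + 1)"
    using mode_Vbi[OF assms(2,4), of "-2"] by (simp add: add_ac)
  let ?W = "below (zhu_ideal 1) {i. fst i < p + q + 2 \<and> snd i < h + l + 1}"
  have "zhu_mode 1 (-2) u v - mode V u (-2) v \<in> ?W"
  proof (rule zhu_mode_leading[OF below_subspace assms(1,2,4)])
    fix n :: nat assume n: "n > 0"
    have half: "h + l - of_int (- 2) - 1 - of_nat n \<in> half_ints"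
      by (intro half_ints_diff half_ints_add half_ints_int half_ints_simps assms)
    show "Vbi V (p + q - 2 * - 2 - 2 - 2 * int n) (h + l - of_int (- 2) - 1 - of_nat n) \<subseteq> ?W"
      by (rule Vbi_below[OF half]) (use n in auto)
  qed
  moreover have "zhu_mode 1 (-2) u v \<in> ?W"
  proof (rule subsetD[OF below_superset])
    show "zhu_mode 1 (-2) u v \<in> zhu_ideal 1" unfolding zhu_ideal_def by (rule span_base) blast
  qed
  ultimately show "mode V u (-2) v \<in> ?W"
    using subspace_diff[OF below_subspace, of "zhu_mode 1 (-2) u v"] by fastforce
qed

lemma C2_subset:
  assumes "subspace K"
    and "\<And>p h w. h \<in> half_ints \<Longrightarrow> w \<in> Vbi V p h \<Longrightarrow>
      w \<in> below (zhu_ideal 1) {i. fst i < p \<and> snd i < h} \<Longrightarrow> w \<in> K"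
  shows "zhu_ideal 0 \<subseteq> K"
proof
  fix x assume "x \<in> zhu_ideal 0"
  then show "x \<in> K"
  proof (induction x rule: zhu_ideal_induct)
    case (generator p h u q l v)
    have "h + l + 1 \<in> half_ints" using generator by (intro half_ints_add half_ints_simps)
    then have "mode V u (-2) v \<in> K"
      using assms(2) mode_minus_2_lower[OF generator] by blast
    then show ?case by (simp add: binomial_fls_0 residue_one[of "-2", simplified])
  qed (use assms(1) in simp)
qed

text \<open>A bihomogeneous vector has a single nonzero component, in which \<open>mode_minus_2_lower\<close> makes its class vanish.\<close>

lemma C2_subset_kernels: "zhu_ideal 0 \<subseteq> kerF" "zhu_ideal 0 \<subseteq> kerW" "zhu_ideal 0 \<subseteq> kerFW"
proof -
  show "zhu_ideal 0 \<subseteq> kerF"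
  proof (rule C2_subset)
    show "subspace kerF" using complex.kernel_subspace(1)[OF grF_A_quotient(1,2)] .
    fix p :: int and h w
    assume "w \<in> Vbi V p h" and w: "w \<in> below (zhu_ideal 1) {i. fst i < p \<and> snd i < h}"
    then have "deg_part V r w = (if r = p then w else 0)" for r
      using component_of_homogeneous[OF degree_decomposition, of p w r] by (simp add: Vbi_def)
    moreover have "w \<in> below (zhu_ideal 1) {i. fst i < p}" using w by (rule subsetD[OF below_mono, rotated 2]) auto
    ultimately show "w \<in> kerF" by (simp add: kerF_def deg.symbol_kernel_def subspace_0)
  qed
  show "zhu_ideal 0 \<subseteq> kerW"
  proof (rule C2_subset)
    show "subspace kerW" using complex.kernel_subspace(1)[OF grW_A_quotient(1,2)] .
    fix p :: int and h w
    assume "h \<in> half_ints" "w \<in> Vbi V p h" and w: "w \<in> below (zhu_ideal 1) {i. fst i < p \<and> snd i < h}"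
    then have "wt_part V r w = (if r = h then w else 0)" for r
      using component_of_homogeneous[OF weight_decomposition, of h w r] by (simp add: Vbi_def)
    moreover have "w \<in> below (zhu_ideal 1) {i. snd i < h}" using w by (rule subsetD[OF below_mono, rotated 2]) auto
    ultimately show "w \<in> kerW" by (simp add: kerW_def wt.symbol_kernel_def subspace_0)
  qed
  show "zhu_ideal 0 \<subseteq> kerFW"
  proof (rule C2_subset)
    show "subspace kerFW" using complex.kernel_subspace(1)[OF grFW_A_quotient(1,2)] .
    fix p :: int and h w
    assume "h \<in> half_ints" "w \<in> Vbi V p h" and w: "w \<in> below (zhu_ideal 1) {i. fst i < p \<and> snd i < h}"
    then have "bi_part r w = (if r = (p, h) then w else 0)" for r
      by (simp add: bi_part_homogeneous)
    moreover have "w \<in> below (zhu_ideal 1) (lower (p, h))"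
      using w by (rule subsetD[OF below_mono, rotated 2]) (auto simp: lower_def)
    ultimately show "w \<in> kerFW" by (simp add: kerFW_def bi.symbol_kernel_def subspace_0)
  qed
qed
end

section \<open>The comparison maps\<close>

context dg_vertex_operator_algebra
begin

lemma eta_eq: "etaF V = (\<lambda>r. the_elem (symbF V ` r))" "etaW V = (\<lambda>r. the_elem (symbW V ` r))"
  "etaFW V = (\<lambda>r. the_elem (symbFW V ` r))"
  by (simp_all add: fun_eq_iff etaF_def etaW_def etaFW_def)

lemmas etaF_R_quotient = eta_quotient[OF grF_A_quotient C2_subset_kernels(1) eta_eq(1)]
lemmas etaW_R_quotient = eta_quotient[OF grW_A_quotient C2_subset_kernels(2) eta_eq(2)]
lemmas etaFW_R_quotient = eta_quotient[OF grFW_A_quotient C2_subset_kernels(3) eta_eq(3)]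

text \<open>By definition the maps are computed on the set of all vectors that represent an element of the base change, where the
symbol map is constant.\<close>

lemma psi_class: "psi V (eta_class V (grF_A V) (etaF V) v) = symbF V v"
  and phi_class: "phi V (eta_class V (grW_A V) (etaW V) v) = symbW V v"
  and Psi_class: "Psi V (eta_class V (grFW_A V) (etaFW V) v) = symbFW V v"
  by (simp_all add: psi_def phi_def Psi_def etaF_R_quotient(4) etaW_R_quotient(4) etaFW_R_quotient(4))

lemma grF_A_part_eq: "grF_A_part V p = symbF V ` Vdeg V p"
  using deg.gr_elem_image[OF filteredF, of p]
  by (simp add: grF_A_part_def symb_eq component_range[OF degree_decomposition])

lemma grW_A_part_eq: "n \<in> half_ints \<Longrightarrow> grW_A_part V n = symbW V ` Vwt V n"
  using wt.gr_elem_image[OF filteredW, of n]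
  by (simp add: grW_A_part_def symb_eq component_range[OF weight_decomposition])

lemma grFW_A_part_eq: "(p, n) \<in> bidegrees \<Longrightarrow> grFW_A_part V (p, n) = symbFW V ` Vbi V p n"
  using bi.gr_elem_image[OF bi_filtered, of "(p, n)"]
  by (simp add: grFW_A_part_def symb_eq bi_range)

lemma Psi_iso: "dg_module_iso bidegrees (grFW_A V) (grFW_A_part V)
    (etaFW_R V) (etaFW_R_part V) (etaFW_act V) (Psi V)"
proof (rule complex.dg_module_isoI[OF etaFW_R_quotient(1,2) grFW_A_quotient(1,2) Psi_class
      etaFW_R_quotient(3) grFW_A_quotient(3)])
  fix j assume "j \<in> bidegrees"
  then show "\<exists>S. etaFW_R_part V j = eta_class V (grFW_A V) (etaFW V) ` S \<and> grFW_A_part V j = symbFW V ` S"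
    by (cases j) (auto simp: etaFW_R_part_def grFW_A_part_eq)
qed

lemma psi_iso: "dg_module_iso UNIV (grF_A V) (grF_A_part V) (etaF_R V) (etaF_R_part V) (etaF_act V) (psi V)"
proof (rule complex.dg_module_isoI[OF etaF_R_quotient(1,2) grF_A_quotient(1,2) psi_class
      etaF_R_quotient(3) grF_A_quotient(3)])
  show "\<exists>S. etaF_R_part V j = eta_class V (grF_A V) (etaF V) ` S \<and> grF_A_part V j = symbF V ` S" for j
    by (auto simp: etaF_R_part_def grF_A_part_eq)
qed

lemma phi_iso: "dg_module_iso half_ints (grW_A V) (grW_A_part V) (etaW_R V) (etaW_R_part V) (etaW_act V) (phi V)"
proof (rule complex.dg_module_isoI[OF etaW_R_quotient(1,2) grW_A_quotient(1,2) phi_class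
      etaW_R_quotient(3) grW_A_quotient(3)])
  show "\<exists>S. etaW_R_part V j = eta_class V (grW_A V) (etaW V) ` S \<and> grW_A_part V j = symbW V ` S"
    if "j \<in> half_ints" for j
    using that by (auto simp: etaW_R_part_def grW_A_part_eq)
qed

text \<open>The source and the target of \<open>\<psi>\<close> are both quotients of \<open>V\<close> by \<^const>\<open>kerF\<close>, filtered by the images of \<^const>\<open>wt_le\<close>. The
product \<open>u\<^sub>-\<^sub>1 v\<close> is its own leading term.\<close>

lemma gr_psi_iso: "dg_module_iso bidegrees (grW_grF_A V) (grW_grF_A_part V)
    (grW_etaF_R V) (grW_etaF_R_part V) (grW_etaF_act V) (gr_psi V)"
  unfolding grW_grF_A_def grW_etaF_R_def gr_wt_def grW_etaF_act_def gr_psi_def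
proof (rule wt.graded_iso[where L = kerF and X = "wt_le V" and K = "\<lambda>n. below kerF {i. snd i < n}"
      and \<sigma> = "symbF V" and \<pi> = "eta_class V (grF_A V) (etaF V)" and \<nu> = "zhu_mode 0 (-1)"
      and P = "\<lambda>n. below kerF {i. snd i \<le> n}"])
  note ker = complex.kernel_subspace[OF grF_A_quotient(1,2)]
    complex.kernel_ideal[OF grF_A_quotient(1) biadditive_zhu_mode grF_A_quotient(3)]
  show "wt.filtered (symbF V) (grF_A V) kerF (wt_le V) (\<lambda>n. below kerF {i. snd i < n})
      (W_grF_A V) (below_wt (W_grF_A V))"
    by (rule wt_filtered[OF grF_A_quotient(1) ker(1)]) (simp add: W_grF_A_def)
  show "wt.filtered (eta_class V (grF_A V) (etaF V)) (etaF_R V) kerF (wt_le V) (\<lambda>n. below kerF {i. snd i < n})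
      (W_etaF_R V) (below_wt (W_etaF_R V))"
    by (rule wt_filtered[OF etaF_R_quotient(1) ker(1)]) (simp add: W_etaF_R_def)
  show "dV V x \<in> below kerF {i. snd i < n + 0}" if "x \<in> below kerF {i. snd i < n}" for n x
    using that by (auto elim!: below_d ker(2))
  show "below kerF {i. snd i < n} \<subseteq> below kerF {i. snd i \<le> n}" for n by (rule below_mono) auto
  show "zhu_mode 0 (-1) x y \<in> below kerF {i. snd i < n + m}"
    if "x \<in> below kerF {i. snd i < n}" "y \<in> below kerF {i. snd i \<le> m}" for n m x y
    using below_mode_wt(1)[OF ker(3) that] .
  show "zhu_mode 0 (-1) x y \<in> below kerF {i. snd i < n + m}"
    if "x \<in> below kerF {i. snd i \<le> n}" "y \<in> below kerF {i. snd i < m}" for n m x y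
    using below_mode_wt(2)[OF ker(3) that] .
  fix j assume "j \<in> bidegrees"
  then obtain p n where j: "j = (p, n)" "n \<in> half_ints" by (auto simp: bidegrees_def)
  show "\<exists>i\<in>half_ints. \<exists>Y. grW_etaF_R_part V j = gr_elem half_ints (etaF_R V) (below_wt (W_etaF_R V)) i `
          (W_etaF_R V i \<inter> eta_class V (grF_A V) (etaF V) ` Y)
      \<and> grW_grF_A_part V j = gr_elem half_ints (grF_A V) (below_wt (W_grF_A V)) i ` (W_grF_A V i \<inter> symbF V ` Y)"
    using j(2) by (intro bexI[of _ n] exI[of _ "Vdeg V p"])
      (simp_all add: j(1) grW_etaF_R_part_def grW_grF_A_part_def grF_A_part_eq etaF_R_part_def)
qed (rule grF_A_quotient etaF_R_quotient psi_class biadditive_zhu_mode below_subspace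
    | erule wt_part_below | erule (1) mode_graded)+

lemma gr_phi_iso: "dg_module_iso bidegrees (grF_grW_A V) (grF_grW_A_part V)
    (grF_etaW_R V) (grF_etaW_R_part V) (grF_etaW_act V) (gr_phi V)"
  unfolding grF_grW_A_def grF_etaW_R_def gr_deg_def grF_etaW_act_def gr_phi_def
proof (rule deg.graded_iso[where L = kerW and X = "deg_le V" and K = "\<lambda>p. below kerW {i. fst i < p}"
      and \<sigma> = "symbW V" and \<pi> = "eta_class V (grW_A V) (etaW V)" and \<nu> = "zhu_mode 0 (-1)"
      and P = "\<lambda>p. below kerW {i. fst i \<le> p}"])
  note ker = complex.kernel_subspace[OF grW_A_quotient(1,2)]
    complex.kernel_ideal[OF grW_A_quotient(1) biadditive_zhu_mode grW_A_quotient(3)]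
  show "deg.filtered (symbW V) (grW_A V) kerW (deg_le V) (\<lambda>p. below kerW {i. fst i < p})
      (F_grW_A V) (below_deg (F_grW_A V))"
    by (rule deg_filtered[OF grW_A_quotient(1) ker(1)]) (simp add: F_grW_A_def)
  show "deg.filtered (eta_class V (grW_A V) (etaW V)) (etaW_R V) kerW (deg_le V) (\<lambda>p. below kerW {i. fst i < p})
      (F_etaW_R V) (below_deg (F_etaW_R V))"
    by (rule deg_filtered[OF etaW_R_quotient(1) ker(1)]) (simp add: F_etaW_R_def)
  show "dV V x \<in> below kerW {i. fst i < p + 1}" if "x \<in> below kerW {i. fst i < p}" for p x
    using that by (auto elim!: below_d ker(2))
  show "below kerW {i. fst i < p} \<subseteq> below kerW {i. fst i \<le> p}" for p by (rule below_mono) auto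
  show "zhu_mode 0 (-1) x y \<in> below kerW {i. fst i < p + q}"
    if "x \<in> below kerW {i. fst i < p}" "y \<in> below kerW {i. fst i \<le> q}" for p q x y
    using below_mode_deg(1)[OF ker(3) that] .
  show "zhu_mode 0 (-1) x y \<in> below kerW {i. fst i < p + q}"
    if "x \<in> below kerW {i. fst i \<le> p}" "y \<in> below kerW {i. fst i < q}" for p q x y
    using below_mode_deg(2)[OF ker(3) that] .
  fix j assume "j \<in> bidegrees"
  then obtain p n where j: "j = (p, n)" "n \<in> half_ints" by (auto simp: bidegrees_def)
  show "\<exists>i\<in>UNIV. \<exists>Y. grF_etaW_R_part V j = gr_elem UNIV (etaW_R V) (below_deg (F_etaW_R V)) i `
          (F_etaW_R V i \<inter> eta_class V (grW_A V) (etaW V) ` Y)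
      \<and> grF_grW_A_part V j = gr_elem UNIV (grW_A V) (below_deg (F_grW_A V)) i ` (F_grW_A V i \<inter> symbW V ` Y)"
    by (intro bexI[of _ p] exI[of _ "Vwt V n"])
      (simp_all add: j grF_etaW_R_part_def grF_grW_A_part_def grW_A_part_eq etaW_R_part_def)
qed (rule grW_A_quotient etaW_R_quotient phi_class biadditive_zhu_mode below_subspace
    deg_part_below mode_graded)+

end

theorem theorem8p8:
  fixes V :: "'a::ab_group_add dg_voa"
  assumes "dg_vertex_operator_algebra V"
  shows "dg_module_iso bidegrees (grFW_A V) (grFW_A_part V)
           (etaFW_R V) (etaFW_R_part V) (etaFW_act V) (Psi V)
    \<and> dg_module_iso bidegrees (grW_grF_A V) (grW_grF_A_part V)
           (grW_etaF_R V) (grW_etaF_R_part V) (grW_etaF_act V) (gr_psi V)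
    \<and> dg_module_iso bidegrees (grF_grW_A V) (grF_grW_A_part V)
           (grF_etaW_R V) (grF_etaW_R_part V) (grF_etaW_act V) (gr_phi V)
    \<and> dg_module_iso UNIV (grF_A V) (grF_A_part V)
           (etaF_R V) (etaF_R_part V) (etaF_act V) (psi V)
    \<and> ((\<exists>p0. \<forall>p<p0. Vdeg V p = {0}) \<longrightarrow>
         dg_module_iso half_ints (grW_A V) (grW_A_part V)
           (etaW_R V) (etaW_R_part V) (etaW_act V) (phi V))"
proof -
  interpret dg_vertex_operator_algebra V by fact
  show ?thesis
    using Psi_iso gr_psi_iso gr_phi_iso psi_iso phi_iso by blast
qed

end
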